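(* For any Poisson manifold $(M,\pi)$, the hypercommutative algebra structure on the de Rham cohomology $H_{\mathrm{dR}}^*(M)$ induced in cohomology by the hypercommutative algebra structure on $\Omega(M)$ associated with $\pi$ (described in the context) is trivial, i.e. its operations satisfy $m_n=0$ for all $n>2$.
   Context: The ground field is $k=\mathbb{R}$; complexes are cochain complexes; operads are symmetric DG operads; $\mathcal{E}(X)$ is the endomorphism operad of a complex $X$. $[a,b]=ab-(-1)^{|a||b|}ba$. Poisson manifold: smooth manifold $M$ with bivector field $\pi\in\Gamma(\Lambda^2T(M))$, $[\pi,\pi]=0$ (Schouten--Nijenhuis bracket). $\Omega(M)$ is the de Rham complex, $i_\pi$ the interior product, $L_\pi=[i_\pi,d]$ the Lie derivative. $\mathcal{H}$, the hypercommutative operad, is the graded operad (zero differential) generated by symmetric operations $m_n$ of arity $n$ and degree $2(2-n)$, $n\geq2$, subject to the relations, for all $n\geq 0$ and elements $a,b,c,x_1,\dots,x_n$ of an algebra, $$\sum_{S_1\sqcup S_2=\{1,\dots,n\}}\pm m(m(a,b,x_{S_1}),c,x_{S_2})=\sum_{S_1\sqcup S_2=\{1,\dots,n\}}\pm m(a,m(b,c,x_{S_1}),x_{S_2}),$$ with Koszul signs, $m$ denoting the $m_r$ of the appropriate arity. The operation $m_2$ generates the commutative operad $\mathcal{C}\subset\mathcal{H}$, which is the degree $0$ part. The trivial hypercommutative algebra structure on a commutative algebra has $m_2$ equal to the product and $m_n=0$ for $n>2$. $\mathcal{BV}/\Delta$ is the DG operad generated by $\mu$ (arity $2$, degree $0$,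 symmetric), $\Delta$ (arity $1$, degree $-1$), and $\phi_n$ (arity $1$, degree $-2n$), $n\geq1$, subject to: $d(\mu)=0$, $\mu$ associative, $d(\Delta)=0$, $\Delta^2=0$, $\Delta$ is a differential operator of order $\leq2$ with respect to $\mu$, i.e. (with Koszul signs) $$\Delta(xyz)=\Delta(xy)z\pm\Delta(xz)y\pm\Delta(yz)x-\Delta(x)yz\mp\Delta(y)xz\mp\Delta(z)xy,$$ $d(\phi_1)=-\Delta$, and for $n\geq2$ $$d(\phi_n)+\sum_{p=2}^n\frac{1}{p!}\sum_{\substack{q_1+\cdots+q_p=n\\ q_1,\dots,q_p\geq 1}}[\phi_{q_1},\dots[\phi_{q_{p-1}},d(\phi_{q_p})]\dots]=0.$$ There is a quasi-isomorphism of DG operads $\theta\colon\mathcal{H}\to\mathcal{BV}/\Delta$ with $\theta(m_2)=\mu$, due to Khoroshkin--Markarian--Shadrin; it is fixed. The de Rham complex $\Omega(M)$ is a $\mathcal{BV}/\Delta$-algebra with $\mu$ the exterior product, $\Delta=L_\pi$, $\phi_1=i_\pi$, $\phi_n=0$ for $n\geq2$. Restriction of scalars along $\theta$ makes $\Omega(M)$ a hypercommutative algebra, and this induces the hypercommutative algebra structure on $H_{\mathrm{dR}}^*(M)$ considered in the claim. *)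

theory Defs
  imports "HOL-Analysis.Analysis"
begin

section \<open>Cochain complexes\<close>

(* Degree-wise carriers with explicit operations. In the quotients below elements are cosets, so
   no type-class vector space structure is available. *)
record 'x cochain =
  spc :: "int \<Rightarrow> 'x set"
  cadd :: "'x \<Rightarrow> 'x \<Rightarrow> 'x"
  cscl :: "real \<Rightarrow> 'x \<Rightarrow> 'x"
  czero :: "int \<Rightarrow> 'x"
  cdif :: "int \<Rightarrow> 'x \<Rightarrow> 'x"

definition cocycles :: "('x, 'z) cochain_scheme \<Rightarrow> int \<Rightarrow> 'x set" where
  "cocycles X p = {x \<in> spc X p. cdif X p x = czero X (p + 1)}"

definition coset :: "('x, 'z) cochain_scheme \<Rightarrow> int \<Rightarrow> 'x \<Rightarrow> 'x set" where
  "coset X p x = {cadd X x (cdif X (p - 1) y) | y. y \<in> spc X (p - 1)}"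

definition cohomology :: "('x, 'z) cochain_scheme \<Rightarrow> int \<Rightarrow> 'x set set" where
  "cohomology X p = coset X p ` cocycles X p"

(* An arbitrary enumeration of a finite set; only used for sums, where the order is irrelevant. *)
definition enum_of :: "'a set \<Rightarrow> 'a list" where
  "enum_of A = (SOME xs. set xs = A \<and> distinct xs)"

definition csum :: "('x, 'z) cochain_scheme \<Rightarrow> int \<Rightarrow> ('a \<Rightarrow> 'x) \<Rightarrow> 'a set \<Rightarrow> 'x" where
  "csum X p F A = foldr (\<lambda>a. cadd X (F a)) (enum_of A) (czero X p)"

definition ksgn :: "int \<Rightarrow> real" where
  "ksgn k = (if even k then 1 else - 1)"

section \<open>Symmetric DG operads\<close>

(* Coordinate-free form of symmetric operads with partial compositions: P(S) for finite label sets
   S of natural numbers (P(n) is P({0..<n})), relabelling along injections (the symmetric group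
   action when f maps S to S), and composition of x in P(S) with y in P(U) at a label a in S, which
   lies in P((S - {a}) \<union> U) and is used only if S - {a} and U are disjoint.
   The integer arguments are the degrees of the operands. *)
record 'a dg_operad =
  cpx :: "nat set \<Rightarrow> 'a cochain"
  ounit :: "nat \<Rightarrow> 'a"
  ocomp :: "nat set \<Rightarrow> int \<Rightarrow> nat \<Rightarrow> nat set \<Rightarrow> int \<Rightarrow> 'a \<Rightarrow> 'a \<Rightarrow> 'a"
  orelabel :: "(nat \<Rightarrow> nat) \<Rightarrow> nat set \<Rightarrow> int \<Rightarrow> 'a \<Rightarrow> 'a"

definition dg_operad_hom ::
    "'a dg_operad \<Rightarrow> 'b dg_operad \<Rightarrow> (nat set \<Rightarrow> int \<Rightarrow> 'a \<Rightarrow> 'b) \<Rightarrow> bool" where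
  "dg_operad_hom P Q h \<longleftrightarrow>
     (\<forall>S k. \<forall>x\<in>spc (cpx P S) k.
        h S k x \<in> spc (cpx Q S) k \<and>
        (\<forall>y\<in>spc (cpx P S) k. h S k (cadd (cpx P S) x y) = cadd (cpx Q S) (h S k x) (h S k y)) \<and>
        (\<forall>r. h S k (cscl (cpx P S) r x) = cscl (cpx Q S) r (h S k x)) \<and>
        h S (k + 1) (cdif (cpx P S) k x) = cdif (cpx Q S) k (h S k x) \<and>
        (\<forall>f. inj_on f S \<longrightarrow> h (f ` S) k (orelabel P f S k x) = orelabel Q f S k (h S k x))) \<and>
     (\<forall>a. h {a} 0 (ounit P a) = ounit Q a) \<and>
     (\<forall>S k a U l. \<forall>x\<in>spc (cpx P S) k. \<forall>y\<in>spc (cpx P U) l.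
        a \<in> S \<and> (S - {a}) \<inter> U = {} \<longrightarrow>
        h ((S - {a}) \<union> U) (k + l) (ocomp P S k a U l x y) =
          ocomp Q S k a U l (h S k x) (h U l y))"

definition dg_operad_quasi_iso ::
    "'a dg_operad \<Rightarrow> 'b dg_operad \<Rightarrow> (nat set \<Rightarrow> int \<Rightarrow> 'a \<Rightarrow> 'b) \<Rightarrow> bool" where
  "dg_operad_quasi_iso P Q h \<longleftrightarrow> dg_operad_hom P Q h \<and>
     (\<forall>S k. finite S \<longrightarrow>
        bij_betw (\<lambda>C. \<Union>x\<in>C. coset (cpx Q S) k (h S k x))
          (cohomology (cpx P S) k) (cohomology (cpx Q S) k))"

section \<open>Endomorphism operads\<close>

(* The tensor power of X over S is formed in the natural order of the labels. Multilinear maps on it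
   are functions of families of degree-tagged homogeneous elements. *)
definition inputs :: "('x, 'z) cochain_scheme \<Rightarrow> nat set \<Rightarrow> (nat \<Rightarrow> int \<times> 'x) set" where
  "inputs X S = PiE S (\<lambda>_. Sigma UNIV (spc X))"

definition total_deg :: "nat set \<Rightarrow> (nat \<Rightarrow> int \<times> 'x) \<Rightarrow> int" where
  "total_deg S \<xi> = (\<Sum>s\<in>S. fst (\<xi> s))"

(* Koszul sign for rearranging the factors labelled by W from the natural order into the order lt. *)
definition koszul :: "(nat \<Rightarrow> nat \<Rightarrow> bool) \<Rightarrow> nat set \<Rightarrow> (nat \<Rightarrow> int \<times> 'x) \<Rightarrow> real" where
  "koszul lt W \<xi> =
     (\<Prod>(u, v)\<in>{(u, v). u \<in> W \<and> v \<in> W \<and> u < v \<and> lt v u}. ksgn (fst (\<xi> u) * fst (\<xi> v)))"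

(* The order on (S - {a}) \<union> U in which the labels in U occupy the position of a. *)
definition insert_order :: "nat \<Rightarrow> nat set \<Rightarrow> nat \<Rightarrow> nat \<Rightarrow> bool" where
  "insert_order a U v w \<longleftrightarrow>
     (let pos = (\<lambda>u. if u \<in> U then a else u) in pos v < pos w \<or> (pos v = pos w \<and> v < w))"

definition endo_spc :: "('x, 'z) cochain_scheme \<Rightarrow> nat set \<Rightarrow> int \<Rightarrow> ((nat \<Rightarrow> int \<times> 'x) \<Rightarrow> 'x) set" where
  "endo_spc X S k = {F \<in> extensional (inputs X S).
     (\<forall>\<xi>\<in>inputs X S. F \<xi> \<in> spc X (total_deg S \<xi> + k)) \<and>
     (\<forall>\<xi>\<in>inputs X S. \<forall>s\<in>S. \<forall>p. \<forall>x\<in>spc X p. \<forall>y\<in>spc X p.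
        F (\<xi>(s := (p, cadd X x y))) = cadd X (F (\<xi>(s := (p, x)))) (F (\<xi>(s := (p, y))))) \<and>
     (\<forall>\<xi>\<in>inputs X S. \<forall>s\<in>S. \<forall>p. \<forall>x\<in>spc X p. \<forall>r.
        F (\<xi>(s := (p, cscl X r x))) = cscl X r (F (\<xi>(s := (p, x)))))}"

definition endo_dif ::
    "('x, 'z) cochain_scheme \<Rightarrow> nat set \<Rightarrow> int \<Rightarrow> ((nat \<Rightarrow> int \<times> 'x) \<Rightarrow> 'x) \<Rightarrow> (nat \<Rightarrow> int \<times> 'x) \<Rightarrow> 'x" where
  "endo_dif X S k F = (\<lambda>\<xi>\<in>inputs X S.
     cadd X (cdif X (total_deg S \<xi> + k) (F \<xi>))
       (cscl X (- ksgn k)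
         (csum X (total_deg S \<xi> + k + 1)
           (\<lambda>s. cscl X (ksgn (total_deg {t \<in> S. t < s} \<xi>))
                  (F (\<xi>(s := (fst (\<xi> s) + 1, cdif X (fst (\<xi> s)) (snd (\<xi> s)))))))
           S)))"

definition endo_cpx :: "('x, 'z) cochain_scheme \<Rightarrow> nat set \<Rightarrow> ((nat \<Rightarrow> int \<times> 'x) \<Rightarrow> 'x) cochain" where
  "endo_cpx X S = \<lparr>
     spc = endo_spc X S,
     cadd = (\<lambda>F G. \<lambda>\<xi>\<in>inputs X S. cadd X (F \<xi>) (G \<xi>)),
     cscl = (\<lambda>r F. \<lambda>\<xi>\<in>inputs X S. cscl X r (F \<xi>)),
     czero = (\<lambda>k. \<lambda>\<xi>\<in>inputs X S. czero X (total_deg S \<xi> + k)),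
     cdif = endo_dif X S\<rparr>"

definition endo_operad :: "('x, 'z) cochain_scheme \<Rightarrow> ((nat \<Rightarrow> int \<times> 'x) \<Rightarrow> 'x) dg_operad" where
  "endo_operad X = \<lparr>
     cpx = endo_cpx X,
     ounit = (\<lambda>a. \<lambda>\<xi>\<in>inputs X {a}. snd (\<xi> a)),
     ocomp = (\<lambda>S k a U l F G. \<lambda>\<xi>\<in>inputs X ((S - {a}) \<union> U).
       cscl X (koszul (insert_order a U) ((S - {a}) \<union> U) \<xi> *
               ksgn (l * total_deg {s \<in> S. s < a} \<xi>))
         (F (\<lambda>s\<in>S. if s = a then (total_deg U \<xi> + l, G (restrict \<xi> U)) else \<xi> s))),
     orelabel = (\<lambda>f S k F. \<lambda>\<xi>\<in>inputs X (f ` S).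
       cscl X (koszul (\<lambda>v w. inv_into S f v < inv_into S f w) (f ` S) \<xi>)
         (F (\<lambda>s\<in>S. \<xi> (f s))))\<rparr>"

definition unary_op :: "('x, 'z) cochain_scheme \<Rightarrow> ('x \<Rightarrow> 'x) \<Rightarrow> (nat \<Rightarrow> int \<times> 'x) \<Rightarrow> 'x" where
  "unary_op X D = (\<lambda>\<xi>\<in>inputs X {0}. D (snd (\<xi> 0)))"

definition binary_op :: "('x, 'z) cochain_scheme \<Rightarrow> ('x \<Rightarrow> 'x \<Rightarrow> 'x) \<Rightarrow> (nat \<Rightarrow> int \<times> 'x) \<Rightarrow> 'x" where
  "binary_op X m = (\<lambda>\<xi>\<in>inputs X {0, 1}. m (snd (\<xi> 0)) (snd (\<xi> 1)))"

(* The operation in cohomology induced by a cocycle F of the endomorphism operad: the union ranges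
   over all choices of representatives, and all of them give the same coset. *)
definition induced_op ::
    "('x, 'z) cochain_scheme \<Rightarrow> nat set \<Rightarrow> int \<Rightarrow> ((nat \<Rightarrow> int \<times> 'x) \<Rightarrow> 'x) \<Rightarrow>
     (nat \<Rightarrow> int) \<Rightarrow> (nat \<Rightarrow> 'x set) \<Rightarrow> 'x set" where
  "induced_op X S k F p c =
     (\<Union>\<xi>\<in>PiE S (\<lambda>s. {p s} \<times> c s). coset X ((\<Sum>s\<in>S. p s) + k) (F \<xi>))"

section \<open>DG operads presented by generators and relations\<close>

(* Formal operadic expressions. A generator g of arity n is symmetric, so it gives one element
   OGen g S for each label set S of size n, with all relabellings acting by f ` S. *)
datatype 'g opterm =
    OGen 'g "nat set"
  | OUnit nat
  | OComp "'g opterm" nat "'g opterm"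
  | ORelabel "nat \<Rightarrow> nat" "'g opterm"
  | OZero "nat set" int
  | OAdd "'g opterm" "'g opterm"
  | OScale real "'g opterm"
  | ODiff "'g opterm"

record 'g presentation =
  gens :: "'g set"
  arity :: "'g \<Rightarrow> nat"
  degr :: "'g \<Rightarrow> int"
  rels :: "('g opterm \<times> 'g opterm) set"

inductive typed :: "'g presentation \<Rightarrow> 'g opterm \<Rightarrow> nat set \<Rightarrow> int \<Rightarrow> bool" for P where
  "\<lbrakk>g \<in> gens P; finite S; card S = arity P g\<rbrakk> \<Longrightarrow> typed P (OGen g S) S (degr P g)"
| "typed P (OUnit a) {a} 0"
| "\<lbrakk>typed P t S k; typed P s U l; a \<in> S; (S - {a}) \<inter> U = {}\<rbrakk>
   \<Longrightarrow> typed P (OComp t a s) ((S - {a}) \<union> U) (k + l)"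
| "\<lbrakk>typed P t S k; inj_on f S\<rbrakk> \<Longrightarrow> typed P (ORelabel f t) (f ` S) k"
| "finite S \<Longrightarrow> typed P (OZero S k) S k"
| "\<lbrakk>typed P t S k; typed P s S k\<rbrakk> \<Longrightarrow> typed P (OAdd t s) S k"
| "typed P t S k \<Longrightarrow> typed P (OScale r t) S k"
| "typed P t S k \<Longrightarrow> typed P (ODiff t) S (k + 1)"

(* The least congruence containing the axioms of symmetric DG operads and the relations of P. *)
inductive opeq :: "'g presentation \<Rightarrow> 'g opterm \<Rightarrow> 'g opterm \<Rightarrow> bool" for P where
  rel: "(t, s) \<in> rels P \<Longrightarrow> opeq P t s"
  (* congruence *)
| refl: "typed P t S k \<Longrightarrow> opeq P t t"
| sym: "opeq P t s \<Longrightarrow> opeq P s t"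
| trans: "\<lbrakk>opeq P t s; opeq P s u\<rbrakk> \<Longrightarrow> opeq P t u"
| comp_cong: "\<lbrakk>opeq P t t'; opeq P s s'; typed P t S k; typed P s U l; a \<in> S; (S - {a}) \<inter> U = {}\<rbrakk>
    \<Longrightarrow> opeq P (OComp t a s) (OComp t' a s')"
| relabel_cong: "\<lbrakk>opeq P t t'; typed P t S k; inj_on f S\<rbrakk> \<Longrightarrow> opeq P (ORelabel f t) (ORelabel f t')"
| add_cong: "\<lbrakk>opeq P t t'; opeq P s s'; typed P t S k; typed P s S k\<rbrakk>
    \<Longrightarrow> opeq P (OAdd t s) (OAdd t' s')"
| scale_cong: "opeq P t t' \<Longrightarrow> opeq P (OScale r t) (OScale r t')"
| diff_cong: "opeq P t t' \<Longrightarrow> opeq P (ODiff t) (ODiff t')"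
  (* vector spaces *)
| add_assoc: "\<lbrakk>typed P t S k; typed P s S k; typed P u S k\<rbrakk>
    \<Longrightarrow> opeq P (OAdd (OAdd t s) u) (OAdd t (OAdd s u))"
| add_comm: "\<lbrakk>typed P t S k; typed P s S k\<rbrakk> \<Longrightarrow> opeq P (OAdd t s) (OAdd s t)"
| add_zero: "typed P t S k \<Longrightarrow> opeq P (OAdd t (OZero S k)) t"
| add_neg: "typed P t S k \<Longrightarrow> opeq P (OAdd t (OScale (- 1) t)) (OZero S k)"
| scale_one: "typed P t S k \<Longrightarrow> opeq P (OScale 1 t) t"
| scale_scale: "typed P t S k \<Longrightarrow> opeq P (OScale r (OScale q t)) (OScale (r * q) t)"
| scale_add_left: "typed P t S k \<Longrightarrow> opeq P (OScale (r + q) t) (OAdd (OScale r t) (OScale q t))"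
| scale_add_right: "\<lbrakk>typed P t S k; typed P s S k\<rbrakk>
    \<Longrightarrow> opeq P (OScale r (OAdd t s)) (OAdd (OScale r t) (OScale r s))"
  (* linearity of the structure maps *)
| comp_add_left: "\<lbrakk>typed P t S k; typed P t' S k; typed P s U l; a \<in> S; (S - {a}) \<inter> U = {}\<rbrakk>
    \<Longrightarrow> opeq P (OComp (OAdd t t') a s) (OAdd (OComp t a s) (OComp t' a s))"
| comp_add_right: "\<lbrakk>typed P t S k; typed P s U l; typed P s' U l; a \<in> S; (S - {a}) \<inter> U = {}\<rbrakk>
    \<Longrightarrow> opeq P (OComp t a (OAdd s s')) (OAdd (OComp t a s) (OComp t a s'))"
| comp_scale_left: "\<lbrakk>typed P t S k; typed P s U l; a \<in> S; (S - {a}) \<inter> U = {}\<rbrakk>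
    \<Longrightarrow> opeq P (OComp (OScale r t) a s) (OScale r (OComp t a s))"
| comp_scale_right: "\<lbrakk>typed P t S k; typed P s U l; a \<in> S; (S - {a}) \<inter> U = {}\<rbrakk>
    \<Longrightarrow> opeq P (OComp t a (OScale r s)) (OScale r (OComp t a s))"
| relabel_add: "\<lbrakk>typed P t S k; typed P s S k; inj_on f S\<rbrakk>
    \<Longrightarrow> opeq P (ORelabel f (OAdd t s)) (OAdd (ORelabel f t) (ORelabel f s))"
| relabel_scale: "\<lbrakk>typed P t S k; inj_on f S\<rbrakk>
    \<Longrightarrow> opeq P (ORelabel f (OScale r t)) (OScale r (ORelabel f t))"
| diff_add: "\<lbrakk>typed P t S k; typed P s S k\<rbrakk>
    \<Longrightarrow> opeq P (ODiff (OAdd t s)) (OAdd (ODiff t) (ODiff s))"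
| diff_scale: "typed P t S k \<Longrightarrow> opeq P (ODiff (OScale r t)) (OScale r (ODiff t))"
  (* the differential *)
| diff_diff: "typed P t S k \<Longrightarrow> opeq P (ODiff (ODiff t)) (OZero S (k + 2))"
| diff_comp: "\<lbrakk>typed P t S k; typed P s U l; a \<in> S; (S - {a}) \<inter> U = {}\<rbrakk>
    \<Longrightarrow> opeq P (ODiff (OComp t a s))
          (OAdd (OComp (ODiff t) a s) (OScale (ksgn k) (OComp t a (ODiff s))))"
| diff_relabel: "\<lbrakk>typed P t S k; inj_on f S\<rbrakk>
    \<Longrightarrow> opeq P (ODiff (ORelabel f t)) (ORelabel f (ODiff t))"
  (* relabelling *)
| relabel_ext: "\<lbrakk>typed P t S k; inj_on f S; \<And>s. s \<in> S \<Longrightarrow> f s = g s\<rbrakk>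
    \<Longrightarrow> opeq P (ORelabel f t) (ORelabel g t)"
| relabel_id: "typed P t S k \<Longrightarrow> opeq P (ORelabel id t) t"
| relabel_relabel: "\<lbrakk>typed P t S k; inj_on f S; inj_on g (f ` S)\<rbrakk>
    \<Longrightarrow> opeq P (ORelabel g (ORelabel f t)) (ORelabel (g \<circ> f) t)"
| relabel_gen: "\<lbrakk>typed P (OGen x S) S k; inj_on f S\<rbrakk>
    \<Longrightarrow> opeq P (ORelabel f (OGen x S)) (OGen x (f ` S))"
| relabel_unit: "opeq P (ORelabel f (OUnit a)) (OUnit (f a))"
| relabel_comp: "\<lbrakk>typed P t S k; typed P s U l; a \<in> S; (S - {a}) \<inter> U = {};
      inj_on f ((S - {a}) \<union> U); inj_on f1 S; \<And>x. x \<in> S - {a} \<Longrightarrow> f1 x = f x\<rbrakk>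
    \<Longrightarrow> opeq P (ORelabel f (OComp t a s)) (OComp (ORelabel f1 t) (f1 a) (ORelabel f s))"
  (* units and associativity of the partial compositions *)
| unit_left: "typed P t S k \<Longrightarrow> opeq P (OComp (OUnit a) a t) t"
| unit_right: "\<lbrakk>typed P t S k; a \<in> S; b \<notin> S - {a}\<rbrakk>
    \<Longrightarrow> opeq P (OComp t a (OUnit b)) (ORelabel (id(a := b)) t)"
| comp_seq: "\<lbrakk>typed P t S k; typed P s U l; typed P u V m; a \<in> S; b \<in> U;
      (S - {a}) \<inter> U = {}; ((S - {a}) \<union> (U - {b})) \<inter> V = {}\<rbrakk>
    \<Longrightarrow> opeq P (OComp (OComp t a s) b u) (OComp t a (OComp s b u))"
| comp_par: "\<lbrakk>typed P t S k; typed P s U l; typed P u V m; a \<in> S; b \<in> S; a \<noteq> b;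
      (S - {a}) \<inter> U = {}; (S - {b}) \<inter> V = {}; U \<inter> V = {}\<rbrakk>
    \<Longrightarrow> opeq P (OComp (OComp t a s) b u) (OScale (ksgn (l * m)) (OComp (OComp t b u) a s))"

definition opclass :: "'g presentation \<Rightarrow> 'g opterm \<Rightarrow> 'g opterm set" where
  "opclass P t = {s. opeq P t s}"

definition presented_operad :: "'g presentation \<Rightarrow> 'g opterm set dg_operad" where
  "presented_operad P = \<lparr>
     cpx = (\<lambda>S. \<lparr>
       spc = (\<lambda>k. opclass P ` {t. typed P t S k}),
       cadd = (\<lambda>x y. \<Union>t\<in>x. \<Union>s\<in>y. opclass P (OAdd t s)),
       cscl = (\<lambda>r x. \<Union>t\<in>x. opclass P (OScale r t)),
       czero = (\<lambda>k. opclass P (OZero S k)),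
       cdif = (\<lambda>k x. \<Union>t\<in>x. opclass P (ODiff t))\<rparr>),
     ounit = (\<lambda>a. opclass P (OUnit a)),
     ocomp = (\<lambda>S k a U l x y. \<Union>t\<in>x. \<Union>s\<in>y. opclass P (OComp t a s)),
     orelabel = (\<lambda>f S k x. \<Union>t\<in>x. opclass P (ORelabel f t))\<rparr>"

definition osum :: "nat set \<Rightarrow> int \<Rightarrow> ('a \<Rightarrow> 'g opterm) \<Rightarrow> 'a set \<Rightarrow> 'g opterm" where
  "osum S k F A = foldr (\<lambda>a. OAdd (F a)) (enum_of A) (OZero S k)"

section \<open>The hypercommutative operad\<close>

(* The generator n is m_n. *)
abbreviation hm :: "nat set \<Rightarrow> nat opterm" where
  "hm S \<equiv> OGen (card S) S"

(* The inputs a, b, c, x_1, ..., x_n carry the labels 0, 1, 2, 3, ..., n + 2; the composition takes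
   place at the auxiliary label n + 3. All generators have even degree, so there are no signs. *)
definition hycom_lhs :: "nat \<Rightarrow> nat opterm" where
  "hycom_lhs n = osum {..<n + 3} (- 2 * int n)
     (\<lambda>S. OComp (hm ({n + 3, 2} \<union> ({3..<n + 3} - S))) (n + 3) (hm ({0, 1} \<union> S)))
     (Pow {3..<n + 3})"

definition hycom_rhs :: "nat \<Rightarrow> nat opterm" where
  "hycom_rhs n = osum {..<n + 3} (- 2 * int n)
     (\<lambda>S. OComp (hm ({0, n + 3} \<union> ({3..<n + 3} - S))) (n + 3) (hm ({1, 2} \<union> S)))
     (Pow {3..<n + 3})"

definition hycom_pres :: "nat presentation" where
  "hycom_pres = \<lparr>
     gens = {2..},
     arity = id,
     degr = (\<lambda>n. 2 * (2 - int n)),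
     rels = {(ODiff (hm {..<n}), OZero {..<n} (2 * (2 - int n) + 1)) | n. 2 \<le> n}
          \<union> {(hycom_lhs n, hycom_rhs n) | n. True}\<rparr>"

definition hycom :: "nat opterm set dg_operad" where
  "hycom = presented_operad hycom_pres"

definition hycom_m :: "nat \<Rightarrow> nat opterm set" where
  "hycom_m n = opclass hycom_pres (hm {..<n})"

(* The operation m_N on the cohomology of X induced by a hypercommutative algebra structure
   \<sigma> (an operad morphism from hycom to the endomorphism operad of X), applied to classes c i of
   degree p i for i < N. *)
definition cohomology_m ::
    "('x, 'z) cochain_scheme \<Rightarrow> (nat set \<Rightarrow> int \<Rightarrow> nat opterm set \<Rightarrow> (nat \<Rightarrow> int \<times> 'x) \<Rightarrow> 'x) \<Rightarrow>
     nat \<Rightarrow> (nat \<Rightarrow> int) \<Rightarrow> (nat \<Rightarrow> 'x set) \<Rightarrow> 'x set" where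
  "cohomology_m X \<sigma> N p c =
     induced_op X {..<N} (2 * (2 - int N)) (\<sigma> {..<N} (2 * (2 - int N)) (hycom_m N)) p c"

definition null_class :: "('x, 'z) cochain_scheme \<Rightarrow> int \<Rightarrow> 'x set" where
  "null_class X p = coset X p (czero X p)"

section \<open>The operad BV/Delta\<close>

datatype bv_gen = Mu | Delta | Phi nat

(* Unary operations carry the label 0. *)
abbreviation bv_delta :: "bv_gen opterm" where
  "bv_delta \<equiv> OGen Delta {0}"

abbreviation bv_phi :: "nat \<Rightarrow> bv_gen opterm" where
  "bv_phi n \<equiv> OGen (Phi n) {0}"

(* (x y) z for inputs labelled i, j, l. *)
definition bv_triple :: "nat \<Rightarrow> nat \<Rightarrow> nat \<Rightarrow> bv_gen opterm" where
  "bv_triple i j l = OComp (OGen Mu {3, l}) 3 (OGen Mu {i, j})"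

(* D(x y) z for inputs labelled i, j, l. *)
definition bv_inner :: "bv_gen \<Rightarrow> nat \<Rightarrow> nat \<Rightarrow> nat \<Rightarrow> bv_gen opterm" where
  "bv_inner D i j l =
     OComp (OGen Mu {3, l}) 3 (OComp (OGen D {4}) 4 (OGen Mu {i, j}))"

(* The signs in the element-wise identity are Koszul signs, hence absent at the operadic level.
   Composing at label i with an operation labelled {i} applies it to the input i. *)
definition bv_order2 :: "bv_gen \<Rightarrow> int \<Rightarrow> bv_gen opterm \<times> bv_gen opterm" where
  "bv_order2 D k =
     (OComp (OGen D {3}) 3 (bv_triple 0 1 2),
      OAdd (OAdd (OAdd (bv_inner D 0 1 2) (bv_inner D 0 2 1)) (bv_inner D 1 2 0))
        (OScale (- 1)
          (OAdd (OAdd (OComp (bv_triple 0 1 2) 0 (OGen D {0}))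
                      (OComp (bv_triple 0 1 2) 1 (OGen D {1})))
                (OComp (bv_triple 0 1 2) 2 (OGen D {2})))))"

definition obracket :: "int \<Rightarrow> int \<Rightarrow> 'g opterm \<Rightarrow> 'g opterm \<Rightarrow> 'g opterm" where
  "obracket k l t s = OAdd (OComp t 0 s) (OScale (- ksgn (k * l)) (OComp s 0 t))"

fun bv_nested :: "nat list \<Rightarrow> bv_gen opterm" where
  "bv_nested [] = OZero {0} 1"
| "bv_nested [q] = ODiff (bv_phi q)"
| "bv_nested (q # qs) =
     obracket (- 2 * int q) (1 - 2 * int (sum_list qs)) (bv_phi q) (bv_nested qs)"

definition bv_phi_lhs :: "nat \<Rightarrow> bv_gen opterm" where
  "bv_phi_lhs n = OAdd (ODiff (bv_phi n))
     (osum {0} (1 - 2 * int n)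
       (\<lambda>p. OScale (1 / fact p)
         (osum {0} (1 - 2 * int n) bv_nested
           {qs. length qs = p \<and> sum_list qs = n \<and> (\<forall>q\<in>set qs. 1 \<le> q)}))
       {2..n})"

definition bv_pres :: "bv_gen presentation" where
  "bv_pres = \<lparr>
     gens = {Mu, Delta} \<union> {Phi n | n. 1 \<le> n},
     arity = (\<lambda>g. case g of Mu \<Rightarrow> 2 | Delta \<Rightarrow> 1 | Phi n \<Rightarrow> 1),
     degr = (\<lambda>g. case g of Mu \<Rightarrow> 0 | Delta \<Rightarrow> - 1 | Phi n \<Rightarrow> - 2 * int n),
     rels =
       {(ODiff (OGen Mu {0, 1}), OZero {0, 1} 1),
        (bv_triple 0 1 2, bv_triple 1 2 0),
        (ODiff bv_delta, OZero {0} 0),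
        (OComp bv_delta 0 bv_delta, OZero {0} (- 2)),
        bv_order2 Delta (- 1),
        (ODiff (bv_phi 1), OScale (- 1) bv_delta)}
       \<union> {(bv_phi_lhs n, OZero {0} (1 - 2 * int n)) | n. 2 \<le> n}\<rparr>"

definition bv_operad :: "bv_gen opterm set dg_operad" where
  "bv_operad = presented_operad bv_pres"

section \<open>Smooth manifolds\<close>

text \<open>
  \<^term>\<open>Euclidean_space n\<close> is the subspace of sequences vanishing from index n on, so the
  dimension is an arbitrary natural number, 0 included; coordinates are indexed by i < n.
\<close>

definition pderiv_at :: "nat \<Rightarrow> ((nat \<Rightarrow> real) \<Rightarrow> real) \<Rightarrow> (nat \<Rightarrow> real) \<Rightarrow> real" where
  "pderiv_at i f x = deriv (\<lambda>t. f (x(i := t))) (x i)"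

(* All iterated partial derivatives exist and are continuous on the open set U. *)
definition smooth_fun :: "nat \<Rightarrow> (nat \<Rightarrow> real) set \<Rightarrow> ((nat \<Rightarrow> real) \<Rightarrow> real) \<Rightarrow> bool" where
  "smooth_fun n U f \<longleftrightarrow> (\<forall>I. set I \<subseteq> {..<n} \<longrightarrow>
     continuous_map (subtopology (Euclidean_space n) U) euclideanreal (foldr pderiv_at I f) \<and>
     (\<forall>x\<in>U. \<forall>i<n. (\<lambda>t. foldr pderiv_at I f (x(i := t))) differentiable (at (x i))))"

type_synonym 'm chart = "'m set \<times> ('m \<Rightarrow> nat \<Rightarrow> real)"

definition chart_image :: "'m chart \<Rightarrow> (nat \<Rightarrow> real) set" where
  "chart_image c = snd c ` fst c"

definition transition :: "'m chart \<Rightarrow> 'm chart \<Rightarrow> (nat \<Rightarrow> real) \<Rightarrow> nat \<Rightarrow> real" where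
  "transition c c' y = snd c' (inv_into (fst c) (snd c) y)"

definition overlap :: "'m chart \<Rightarrow> 'm chart \<Rightarrow> (nat \<Rightarrow> real) set" where
  "overlap c c' = snd c ` (fst c \<inter> fst c')"

definition smooth_manifold :: "nat \<Rightarrow> 'm topology \<Rightarrow> 'm chart set \<Rightarrow> bool" where
  "smooth_manifold n M A \<longleftrightarrow>
     Hausdorff_space M \<and> second_countable M \<and>
     (\<forall>c\<in>A. openin M (fst c) \<and> openin (Euclidean_space n) (chart_image c) \<and>
        homeomorphic_map (subtopology M (fst c))
          (subtopology (Euclidean_space n) (chart_image c)) (snd c)) \<and>
     (\<Union>c\<in>A. fst c) = topspace M \<and>
     (\<forall>c\<in>A. \<forall>c'\<in>A. \<forall>j<n. smooth_fun n (overlap c c') (\<lambda>y. transition c c' y j))"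

section \<open>The de Rham complex\<close>

(* \<omega> c [i_1, ..., i_k] x is the value of the form on the coordinate fields i_1, ..., i_k of the
   chart c, at the point with coordinates x. *)
type_synonym 'm form = "'m chart \<Rightarrow> nat list \<Rightarrow> (nat \<Rightarrow> real) \<Rightarrow> real"

definition forms :: "nat \<Rightarrow> 'm chart set \<Rightarrow> int \<Rightarrow> 'm form set" where
  "forms n A p = {\<omega>.
     (\<forall>c I x. \<omega> c I x \<noteq> 0 \<longrightarrow>
        c \<in> A \<and> int (length I) = p \<and> set I \<subseteq> {..<n} \<and> x \<in> chart_image c) \<and>
     (\<forall>c I i j J x. \<omega> c (I @ i # j # J) x = - \<omega> c (I @ j # i # J) x) \<and>
     (\<forall>c\<in>A. \<forall>I. smooth_fun n (chart_image c) (\<omega> c I)) \<and>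
     (\<forall>c\<in>A. \<forall>c'\<in>A. \<forall>I. \<forall>x\<in>overlap c c'. set I \<subseteq> {..<n} \<longrightarrow>
        \<omega> c I x =
          (\<Sum>J\<in>{J. length J = length I \<and> set J \<subseteq> {..<n}}.
             (\<Prod>l<length I. pderiv_at (I ! l) (\<lambda>y. transition c c' y (J ! l)) x) *
             \<omega> c' J (transition c c' x)))}"

definition ext_deriv :: "nat \<Rightarrow> 'm chart set \<Rightarrow> 'm form \<Rightarrow> 'm form" where
  "ext_deriv n A \<omega> = (\<lambda>c I x.
     if c \<in> A \<and> set I \<subseteq> {..<n} \<and> x \<in> chart_image c
     then \<Sum>j<length I. (- 1) ^ j * pderiv_at (I ! j) (\<omega> c (take j I @ drop (Suc j) I)) x
     else 0)"

definition shuffle_sgn :: "nat \<Rightarrow> nat set \<Rightarrow> real" where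
  "shuffle_sgn k S = (- 1) ^ card {(a, b). a < b \<and> b < k \<and> a \<notin> S \<and> b \<in> S}"

definition wedge :: "'m form \<Rightarrow> 'm form \<Rightarrow> 'm form" where
  "wedge \<omega> \<eta> = (\<lambda>c I x.
     \<Sum>S\<in>Pow {..<length I}. shuffle_sgn (length I) S * \<omega> c (nths I S) x * \<eta> c (nths I (- S)) x)"

definition de_rham :: "nat \<Rightarrow> 'm chart set \<Rightarrow> 'm form cochain" where
  "de_rham n A = \<lparr>
     spc = forms n A,
     cadd = (\<lambda>\<omega> \<eta> c I x. \<omega> c I x + \<eta> c I x),
     cscl = (\<lambda>r \<omega> c I x. r * \<omega> c I x),
     czero = (\<lambda>_ c I x. 0),
     cdif = (\<lambda>_. ext_deriv n A)\<rparr>"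

section \<open>Poisson structures\<close>

(* \<pi> c i j are the components of \<pi> in the chart c, i.e. \<pi> = 1/2 (sum over i, j of \<pi> c i j times
   the wedge of the coordinate fields i and j). *)
type_synonym 'm bivector = "'m chart \<Rightarrow> nat \<Rightarrow> nat \<Rightarrow> (nat \<Rightarrow> real) \<Rightarrow> real"

definition bivector_field :: "nat \<Rightarrow> 'm chart set \<Rightarrow> 'm bivector \<Rightarrow> bool" where
  "bivector_field n A \<pi> \<longleftrightarrow>
     (\<forall>c\<in>A. \<forall>i<n. \<forall>j<n. smooth_fun n (chart_image c) (\<pi> c i j) \<and>
        (\<forall>x\<in>chart_image c. \<pi> c i j x = - \<pi> c j i x)) \<and>
     (\<forall>c\<in>A. \<forall>c'\<in>A. \<forall>x\<in>overlap c c'. \<forall>k<n. \<forall>l<n.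
        \<pi> c' k l (transition c c' x) =
          (\<Sum>i<n. \<Sum>j<n. pderiv_at i (\<lambda>y. transition c c' y k) x *
             pderiv_at j (\<lambda>y. transition c c' y l) x * \<pi> c i j x))"

(* Components of the Schouten-Nijenhuis bracket of two bivector fields (a trivector field). *)
definition schouten ::
    "nat \<Rightarrow> 'm bivector \<Rightarrow> 'm bivector \<Rightarrow> 'm chart \<Rightarrow> nat \<Rightarrow> nat \<Rightarrow> nat \<Rightarrow> (nat \<Rightarrow> real) \<Rightarrow> real" where
  "schouten n P Q c i j k x =
     (\<Sum>l<n.
        P c l i x * pderiv_at l (Q c j k) x + Q c l i x * pderiv_at l (P c j k) x +
        P c l j x * pderiv_at l (Q c k i) x + Q c l j x * pderiv_at l (P c k i) x +
        P c l k x * pderiv_at l (Q c i j) x + Q c l k x * pderiv_at l (P c i j) x)"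

definition poisson_manifold :: "nat \<Rightarrow> 'm topology \<Rightarrow> 'm chart set \<Rightarrow> 'm bivector \<Rightarrow> bool" where
  "poisson_manifold n M A \<pi> \<longleftrightarrow> smooth_manifold n M A \<and> bivector_field n A \<pi> \<and>
     (\<forall>c\<in>A. \<forall>i<n. \<forall>j<n. \<forall>k<n. \<forall>x\<in>chart_image c. schouten n \<pi> \<pi> c i j k x = 0)"

definition interior :: "nat \<Rightarrow> 'm bivector \<Rightarrow> 'm form \<Rightarrow> 'm form" where
  "interior n \<pi> \<omega> = (\<lambda>c I x. 1 / 2 * (\<Sum>i<n. \<Sum>j<n. \<pi> c i j x * \<omega> c (i # j # I) x))"

(* The interior product has even degree, so the graded commutator with d is the plain one. *)
definition lie_deriv :: "nat \<Rightarrow> 'm chart set \<Rightarrow> 'm bivector \<Rightarrow> 'm form \<Rightarrow> 'm form" where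
  "lie_deriv n A \<pi> \<omega> = (\<lambda>c I x.
     interior n \<pi> (ext_deriv n A \<omega>) c I x - ext_deriv n A (interior n \<pi> \<omega>) c I x)"

(* \<rho> is the structure map of the BV/Delta-algebra of differential forms on (M, \<pi>). It is determined
   by its values on the generators. *)
definition de_rham_bv_structure :: "nat \<Rightarrow> 'm chart set \<Rightarrow> 'm bivector \<Rightarrow>
    (nat set \<Rightarrow> int \<Rightarrow> bv_gen opterm set \<Rightarrow> (nat \<Rightarrow> int \<times> 'm form) \<Rightarrow> 'm form) \<Rightarrow> bool" where
  "de_rham_bv_structure n A \<pi> \<rho> \<longleftrightarrow>
     dg_operad_hom bv_operad (endo_operad (de_rham n A)) \<rho> \<and>
     \<rho> {0, 1} 0 (opclass bv_pres (OGen Mu {0, 1})) = binary_op (de_rham n A) wedge \<and>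
     \<rho> {0} (- 1) (opclass bv_pres bv_delta) = unary_op (de_rham n A) (lie_deriv n A \<pi>) \<and>
     \<rho> {0} (- 2) (opclass bv_pres (bv_phi 1)) = unary_op (de_rham n A) (interior n \<pi>) \<and>
     (\<forall>i\<ge>2. \<rho> {0} (- 2 * int i) (opclass bv_pres (bv_phi i)) =
        czero (endo_cpx (de_rham n A) {0}) (- 2 * int i))"

end

theory Submission
  imports Defs
begin

text \<open>
The operation \<open>m\<^sub>N\<close> is a cocycle of degree \<open>2(2 - N)\<close>, which is nonzero for \<open>N > 2\<close>, so its
image under \<open>\<theta>\<close> is a cocycle of nonzero degree in BV/Delta. The representation of BV/Delta on
\<open>\<Omega>(M)\<close> factors through a quotient Q of BV/Delta in which every cocycle of nonzero degree is a
coboundary. Hence \<open>m\<^sub>N\<close> acts on \<open>\<Omega>(M)\<close> as a coboundary of the endomorphism complex, and a coboundary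
takes closed forms to exact ones.

The quotient Q is given by the relations \<open>\<phi>\<^sub>n = 0\<close> for \<open>n \<ge> 2\<close>, \<open>[\<phi>\<^sub>1, \<Delta>] = 0\<close> and
"\<open>\<phi>\<^sub>1\<close> is a differential operator of order at most 2". It is contractible onto the
commutative operad: let \<open>h\<close> be the derivation of degree \<open>-1\<close> with
\<open>h(\<Delta>) = -\<phi>\<^sub>1\<close> and \<open>h(\<phi>\<^sub>1) = h(\<mu>) = 0\<close>. It preserves the relations: it turns the order 2
condition on \<open>\<Delta>\<close> into the one on \<open>\<phi>\<^sub>1\<close>, and \<open>\<Delta>\<^sup>2 = 0\<close> into \<open>[\<phi>\<^sub>1, \<Delta>] = 0\<close>.
Then \<open>W = dh + hd\<close> is the derivation that multiplies an expression by its weight, where \<open>\<mu>\<close>, \<open>\<Delta>\<close>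
and \<open>\<phi>\<^sub>n\<close> have weights 0, 1 and n. Thus cocycles of positive weight are coboundaries, while
the part of weight 0 is concentrated in degree 0 (lemmas \<open>homotopy_formula\<close> and \<open>closed_imp_exact\<close>).
This is a form of the homotopy that scales \<open>\<pi>\<close> to 0.

That the representation factors through Q means two things. The interior product \<open>i\<^sub>\<pi>\<close> has order at
most 2 because it is a combination of composites of two contractions, each of which is an odd derivation of the
exterior product (\<open>interior_order2\<close>). And \<open>[i\<^sub>\<pi>, L\<^sub>\<pi>] = 0\<close> is the second defining relation of BV/Delta,
\<open>d(\<phi>\<^sub>2) + [\<phi>\<^sub>1, d(\<phi>\<^sub>1)]/2 = 0\<close>, evaluated where \<open>\<phi>\<^sub>2\<close> acts by 0 (\<open>sem_phi_delta_commute\<close>).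

Derivations of Q are defined on formal expressions by recursion, and the essential point is that they
respect the congruence generated by the operad axioms and the relations (\<open>der_respects\<close>). The
identities that this requires are checked in a vector space of classes of expressions, the type
\<open>qop\<close>. The operad axioms never have to be verified for the endomorphism operad itself: they hold
on the image of a morphism out of BV/Delta (\<open>sem_congruence\<close>).
\<close>

section \<open>Typing of operadic expressions\<close>

primrec tset :: "'g opterm \<Rightarrow> nat set" where
  "tset (OGen g S) = S"
| "tset (OUnit a) = {a}"
| "tset (OComp t a s) = (tset t - {a}) \<union> tset s"
| "tset (ORelabel f t) = f ` tset t"
| "tset (OZero S k) = S"
| "tset (OAdd t s) = tset t"
| "tset (OScale r t) = tset t"
| "tset (ODiff t) = tset t"

primrec tdeg :: "'g presentation \<Rightarrow> 'g opterm \<Rightarrow> int" where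
  "tdeg P (OGen g S) = degr P g"
| "tdeg P (OUnit a) = 0"
| "tdeg P (OComp t a s) = tdeg P t + tdeg P s"
| "tdeg P (ORelabel f t) = tdeg P t"
| "tdeg P (OZero S k) = k"
| "tdeg P (OAdd t s) = tdeg P t"
| "tdeg P (OScale r t) = tdeg P t"
| "tdeg P (ODiff t) = tdeg P t + 1"

text \<open>
An expression has at most one type, so being typed is a property of the expression, and label set and
degree are functions of it. This makes typing decidable by rewriting (\<open>wf_term_simps\<close> below).
\<close>

definition wf_term :: "'g presentation \<Rightarrow> 'g opterm \<Rightarrow> bool" where
  "wf_term P t \<longleftrightarrow> typed P t (tset t) (tdeg P t)"

lemma typed_unique: "typed P t S k \<Longrightarrow> tset t = S \<and> tdeg P t = k"
  by (induction rule: typed.induct) auto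

lemma typed_iff: "typed P t S k \<longleftrightarrow> wf_term P t \<and> tset t = S \<and> tdeg P t = k"
  unfolding wf_term_def using typed_unique by blast

lemma finite_tset: "wf_term P t \<Longrightarrow> finite (tset t)"
proof -
  have "typed P t S k \<Longrightarrow> finite S" for S k
    by (induction rule: typed.induct) auto
  then show "wf_term P t \<Longrightarrow> finite (tset t)" by (auto simp: wf_term_def)
qed

inductive_simps typed_simps:
  "typed P (OGen g S) U k" "typed P (OUnit a) U k" "typed P (OComp t a s) U k"
  "typed P (ORelabel f t) U k" "typed P (OZero S l) U k" "typed P (OAdd t s) U k"
  "typed P (OScale r t) U k" "typed P (ODiff t) U k"

lemma wf_term_simps [simp]:
  "wf_term P (OGen g S) \<longleftrightarrow> g \<in> gens P \<and> finite S \<and> card S = arity P g"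
  "wf_term P (OUnit a)"
  "wf_term P (OComp t a s) \<longleftrightarrow> wf_term P t \<and> wf_term P s \<and> a \<in> tset t \<and> (tset t - {a}) \<inter> tset s = {}"
  "wf_term P (ORelabel f t) \<longleftrightarrow> wf_term P t \<and> inj_on f (tset t)"
  "wf_term P (OZero S k) \<longleftrightarrow> finite S"
  "wf_term P (OAdd t s) \<longleftrightarrow> wf_term P t \<and> wf_term P s \<and> tset t = tset s \<and> tdeg P t = tdeg P s"
  "wf_term P (OScale r t) \<longleftrightarrow> wf_term P t"
  "wf_term P (ODiff t) \<longleftrightarrow> wf_term P t"
  subgoal unfolding wf_term_def[of P "OGen g S"] typed_simps by auto
  subgoal unfolding wf_term_def[of P "OUnit a"] typed_simps by auto
  subgoal unfolding wf_term_def[of P "OComp t a s"] typed_simps by (auto simp: typed_iff)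
  subgoal unfolding wf_term_def[of P "ORelabel f t"] typed_simps by (auto simp: typed_iff)
  subgoal unfolding wf_term_def[of P "OZero S k"] typed_simps by auto
  subgoal unfolding wf_term_def[of P "OAdd t s"] typed_simps by (auto simp: typed_iff)
  subgoal unfolding wf_term_def[of P "OScale r t"] typed_simps by (auto simp: typed_iff)
  subgoal unfolding wf_term_def[of P "ODiff t"] typed_simps by (auto simp: typed_iff)
  done

lemma wf_term_typed: "wf_term P t \<Longrightarrow> typed P t (tset t) (tdeg P t)"
  by (simp add: wf_term_def)

lemma opeq_wf:
  assumes rels: "\<And>t s. (t, s) \<in> rels P \<Longrightarrow> wf_term P t \<and> wf_term P s \<and> tset t = tset s \<and> tdeg P t = tdeg P s"
    and "opeq P t s"
  shows "wf_term P t \<and> wf_term P s \<and> tset t = tset s \<and> tdeg P t = tdeg P s"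
  using assms(2)
proof (induction rule: opeq.induct)
  case (rel t s)
  then show ?case using rels by blast
next
  case (unit_right t S k a b)
  then show ?case by (auto simp: typed_iff inj_on_def)
next
  case (relabel_ext t S k f g)
  then show ?case by (auto simp: typed_iff inj_on_def image_iff)
next
  case (relabel_comp t S k s U l a f f1)
  then have "f1 ` S - {f1 a} = f1 ` (S - {a})"
    using inj_on_image_set_diff[OF relabel_comp(6), of S "{a}"] by simp
  also have "\<dots> = f ` (S - {a})" using relabel_comp by (auto intro!: image_cong)
  finally have "f1 ` S - {f1 a} = f ` (S - {a})" .
  moreover have "f ` (S - {a}) \<inter> f ` U = {}"
    using relabel_comp(4) inj_on_image_Int[OF relabel_comp(5), of "S - {a}" U] by simp
  moreover have "inj_on f U" using relabel_comp(5) by (rule inj_on_subset) simp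
  moreover have "f1 ` S - {f1 a} \<union> f ` U = f ` (S - {a} \<union> U)"
    using calculation(1) by blast
  ultimately show ?case using relabel_comp(1-6) by (simp add: typed_iff)
next
  case (relabel_relabel t S k f g)
  then show ?case by (auto simp: typed_iff comp_inj_on image_comp)
next
  case (relabel_gen x S k f)
  then show ?case by (auto simp: typed_iff card_image)
next
  case (comp_seq t S k s U l u V m a b)
  then show ?case by (auto simp: typed_iff)
next
  case (comp_par t S k s U l u V m a b)
  then show ?case by (auto simp: typed_iff)
qed (auto simp: typed_iff finite_tset)

section \<open>The quotient operad and its space of classes\<close>

text \<open>
The quotient Q of BV/Delta. The relations of BV/Delta for \<open>n \<ge> 2\<close> follow from the ones listed here
(\<open>bv_phi_lhs_zero\<close>): in Q only \<open>[\<phi>\<^sub>1, [\<dots>, [\<phi>\<^sub>1, d\<phi>\<^sub>1]]]\<close> survives of the nested brackets, and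
\<open>d\<phi>\<^sub>1 = -\<Delta>\<close> commutes with \<open>\<phi>\<^sub>1\<close>.
\<close>

definition bvq_pres :: "bv_gen presentation" where
  "bvq_pres = bv_pres\<lparr>rels :=
       {(ODiff (OGen Mu {0, 1}), OZero {0, 1} 1),
        (bv_triple 0 1 2, bv_triple 1 2 0),
        (ODiff bv_delta, OZero {0} 0),
        (OComp bv_delta 0 bv_delta, OZero {0} (- 2)),
        bv_order2 Delta (- 1),
        (ODiff (bv_phi 1), OScale (- 1) bv_delta),
        bv_order2 (Phi 1) (- 2),
        (OComp (bv_phi 1) 0 bv_delta, OComp bv_delta 0 (bv_phi 1))}
       \<union> {(bv_phi n, OZero {0} (- 2 * int n)) | n. 2 \<le> n}\<rparr>"

lemma bvq_sig [simp]:
  "gens bvq_pres = {Mu, Delta} \<union> {Phi n | n. 1 \<le> n}"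
  "arity bvq_pres Mu = 2" "arity bvq_pres Delta = 1" "arity bvq_pres (Phi n) = 1"
  "degr bvq_pres Mu = 0" "degr bvq_pres Delta = - 1" "degr bvq_pres (Phi n) = - 2 * int n"
  by (simp_all add: bvq_pres_def bv_pres_def)

lemmas bv_term_defs = bv_order2_def bv_triple_def bv_inner_def

lemma rels_bvq: "rels bvq_pres =
       {(ODiff (OGen Mu {0, 1}), OZero {0, 1} 1),
        (bv_triple 0 1 2, bv_triple 1 2 0),
        (ODiff bv_delta, OZero {0} 0),
        (OComp bv_delta 0 bv_delta, OZero {0} (- 2)),
        bv_order2 Delta (- 1),
        (ODiff (bv_phi 1), OScale (- 1) bv_delta),
        bv_order2 (Phi 1) (- 2),
        (OComp (bv_phi 1) 0 bv_delta, OComp bv_delta 0 (bv_phi 1))}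
       \<union> {(bv_phi n, OZero {0} (- 2 * int n)) | n. 2 \<le> n}"
  by (simp add: bvq_pres_def)

lemma bvq_rels_wf:
  assumes "(t, s) \<in> rels bvq_pres"
  shows "wf_term bvq_pres t \<and> wf_term bvq_pres s \<and> tset t = tset s \<and> tdeg bvq_pres t = tdeg bvq_pres s"
  using assms unfolding rels_bvq
  by (auto simp: bv_term_defs card_insert_if)

abbreviation qwf :: "bv_gen opterm \<Rightarrow> bool" where "qwf \<equiv> wf_term bvq_pres"
abbreviation qdeg :: "bv_gen opterm \<Rightarrow> int" where "qdeg \<equiv> tdeg bvq_pres"
abbreviation qeq :: "bv_gen opterm \<Rightarrow> bv_gen opterm \<Rightarrow> bool" where "qeq \<equiv> opeq bvq_pres"

lemma qeq_wf:
  assumes "qeq t s"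
  shows "qwf t" "qwf s" "tset t = tset s" "qdeg t = qdeg s"
  using opeq_wf[OF bvq_rels_wf assms] by auto

text \<open>
An element of the type \<open>qop\<close> is a family of expressions, one of each type \<open>(S, k)\<close>, up to equality
in Q. This is the product of all the spaces \<open>Q(S)\<^sub>k\<close>. Having a single type with total
addition makes linear algebra in Q available to the simplifier; equations between expressions
of one type are equations between their images under \<open>cls\<close> (\<open>cls_eq_iff\<close>).
\<close>

definition famrel :: "(nat set \<Rightarrow> int \<Rightarrow> bv_gen opterm) \<Rightarrow> (nat set \<Rightarrow> int \<Rightarrow> bv_gen opterm) \<Rightarrow> bool" where
  "famrel x y \<longleftrightarrow> (\<forall>S k. finite S \<longrightarrow> typed bvq_pres (x S k) S k \<and> qeq (x S k) (y S k))"

lemma qeq_typed: "qeq t s \<Longrightarrow> typed bvq_pres t S k \<Longrightarrow> typed bvq_pres s S k"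
  using qeq_wf by (auto simp: typed_iff)

quotient_type qop = "nat set \<Rightarrow> int \<Rightarrow> bv_gen opterm" / partial: famrel
proof (rule part_equivpI)
  show "\<exists>x. famrel x x"
    by (rule exI[of _ "\<lambda>S k. OZero S k"]) (auto simp: famrel_def intro: typed.intros opeq.intros(2))
  show "symp famrel"
    by (auto simp: symp_def famrel_def intro: opeq.intros(3) qeq_typed)
  show "transp famrel"
    unfolding transp_def famrel_def by (blast intro: opeq.intros(4))
qed

instantiation qop :: real_vector
begin
lift_definition zero_qop :: qop is "\<lambda>S k. OZero S k"
  by (auto simp: famrel_def intro: typed.intros opeq.intros(2))
lift_definition plus_qop :: "qop \<Rightarrow> qop \<Rightarrow> qop" is "\<lambda>x y S k. OAdd (x S k) (y S k)"
  unfolding famrel_def by (blast intro: typed.intros opeq.add_cong)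
lift_definition scaleR_qop :: "real \<Rightarrow> qop \<Rightarrow> qop" is "\<lambda>r x S k. OScale r (x S k)"
  unfolding famrel_def by (blast intro: typed.intros opeq.scale_cong)
lift_definition uminus_qop :: "qop \<Rightarrow> qop" is "\<lambda>x S k. OScale (- 1) (x S k)"
  unfolding famrel_def by (blast intro: typed.intros opeq.scale_cong)
lift_definition minus_qop :: "qop \<Rightarrow> qop \<Rightarrow> qop" is "\<lambda>x y S k. OAdd (x S k) (OScale (- 1) (y S k))"
  unfolding famrel_def by (blast intro: typed.intros opeq.add_cong opeq.scale_cong)
instance
proof
  fix a b c :: qop and r q :: real
  show "a + b + c = a + (b + c)"
    by transfer (auto simp: famrel_def intro!: typed.intros opeq.add_assoc)
  show "a + b = b + a"
    by transfer (auto simp: famrel_def intro!: typed.intros opeq.add_comm)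
  show "0 + a = a"
    by transfer (auto simp: famrel_def intro!: typed.intros
        intro: opeq.trans[OF opeq.add_comm opeq.add_zero] typed.intros)
  show "- a + a = 0"
    by transfer (auto simp: famrel_def intro!: typed.intros
        intro: opeq.trans[OF opeq.add_comm opeq.add_neg] typed.intros)
  show "a - b = a + - b"
    by transfer (auto simp: famrel_def intro!: typed.intros opeq.refl)
  show "r *\<^sub>R (a + b) = r *\<^sub>R a + r *\<^sub>R b"
    by transfer (auto simp: famrel_def intro!: typed.intros opeq.scale_add_right)
  show "(r + q) *\<^sub>R a = r *\<^sub>R a + q *\<^sub>R a"
    by transfer (auto simp: famrel_def intro!: typed.intros opeq.scale_add_left)
  show "r *\<^sub>R q *\<^sub>R a = (r * q) *\<^sub>R a"
    by transfer (auto simp: famrel_def intro!: typed.intros opeq.scale_scale)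
  show "1 *\<^sub>R a = a"
    by transfer (auto simp: famrel_def intro!: typed.intros opeq.scale_one)
qed
end

lemma qeq_zero: "finite S \<Longrightarrow> qeq (OZero S k) (OZero S k)"
  by (rule opeq.refl) (rule typed.intros)

lift_definition cls :: "bv_gen opterm \<Rightarrow> qop" is
  "\<lambda>t S k. if typed bvq_pres t S k then t else OZero S k"
  by (simp add: famrel_def typed_iff opeq.refl[OF wf_term_typed] qeq_zero)

lemma cls_eq_iff:
  assumes "qwf t" "qwf s" "tset t = tset s" "qdeg t = qdeg s"
  shows "cls t = cls s \<longleftrightarrow> qeq t s"
proof -
  let ?F = "\<lambda>t S k. if typed bvq_pres t S k then t else OZero S k"
  have F: "famrel (?F u) (?F u)" for u
    using cls.rsp by (simp add: rel_fun_def)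
  have "cls t = cls s \<longleftrightarrow> famrel (?F t) (?F s)"
    using Quotient_rel[OF Quotient_qop, of "?F t" "?F s"] F[of t] F[of s]
    unfolding cls_def map_fun_def by simp
  also have "\<dots> \<longleftrightarrow> qeq t s"
    using assms finite_tset[OF assms(1)] by (auto simp: famrel_def typed_iff qeq_zero)
  finally show ?thesis .
qed

lemma cls_eqI: "qeq t s \<Longrightarrow> cls t = cls s"
  using cls_eq_iff qeq_wf by blast

lemma cls_zero: "cls (OZero S k) = 0"
  by transfer (simp add: famrel_def typed_iff qeq_zero)

lemma qeq_zero_zero: "finite S \<Longrightarrow> qeq (OZero S k) (OAdd (OZero S k) (OZero S k))"
  by (metis opeq.sym opeq.add_zero typed.intros(5))

lemma cls_add:
  assumes "qwf t" "qwf s" "tset t = tset s" "qdeg t = qdeg s"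
  shows "cls (OAdd t s) = cls t + cls s"
  using assms
  by transfer (auto simp: famrel_def typed_iff qeq_zero_zero intro!: opeq.refl[OF wf_term_typed])

lemma qeq_scale_zero: "finite S \<Longrightarrow> qeq (OScale r (OZero S k)) (OZero S k)"
proof -
  assume "finite S"
  then have *: "qwf (OZero S k)" by simp
  have "qeq (OScale r (OZero S k)) (OAdd (OScale r (OZero S k)) (OScale r (OZero S k)))"
    using \<open>finite S\<close> opeq.trans[OF opeq.scale_cong[OF qeq_zero_zero] opeq.scale_add_right]
    by (auto simp: typed_iff)
  then have "qeq (OAdd (OScale r (OZero S k)) (OScale (-1) (OScale r (OZero S k))))
     (OAdd (OAdd (OScale r (OZero S k)) (OScale r (OZero S k))) (OScale (-1) (OScale r (OZero S k))))"
    using \<open>finite S\<close> by (intro opeq.add_cong[where S=S and k=k]) (auto simp: typed_iff intro!: opeq.refl typed.intros)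
  moreover have "qeq (OAdd (OAdd (OScale r (OZero S k)) (OScale r (OZero S k))) (OScale (-1) (OScale r (OZero S k))))
     (OAdd (OScale r (OZero S k)) (OAdd (OScale r (OZero S k)) (OScale (-1) (OScale r (OZero S k)))))"
    using \<open>finite S\<close> by (intro opeq.add_assoc[where S=S and k=k]) (auto simp: typed_iff)
  moreover have z: "qeq (OAdd (OScale r (OZero S k)) (OScale (-1) (OScale r (OZero S k)))) (OZero S k)"
    using \<open>finite S\<close> by (intro opeq.add_neg) (auto simp: typed_iff)
  moreover have "qeq (OAdd (OScale r (OZero S k)) (OAdd (OScale r (OZero S k)) (OScale (-1) (OScale r (OZero S k)))))
     (OAdd (OScale r (OZero S k)) (OZero S k))"
    using \<open>finite S\<close> by (intro opeq.add_cong[where S=S and k=k] z) (auto simp: typed_iff intro!: opeq.refl typed.intros)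
  moreover have "qeq (OAdd (OScale r (OZero S k)) (OZero S k)) (OScale r (OZero S k))"
    using \<open>finite S\<close> by (intro opeq.add_zero) (auto simp: typed_iff)
  ultimately show ?thesis by (meson opeq.sym opeq.trans)
qed

lemma cls_scale:
  assumes "qwf t"
  shows "cls (OScale r t) = r *\<^sub>R cls t"
  using assms
  by transfer (auto simp: famrel_def typed_iff intro!: opeq.refl[OF wf_term_typed] opeq.sym[OF qeq_scale_zero])

section \<open>Derivations\<close>

lemma ksgn_add: "ksgn (a + b) = ksgn a * ksgn b"
  by (simp add: ksgn_def)

lemma ksgn_minus: "ksgn (- a) = ksgn a"
  by (simp add: ksgn_def)

lemma ksgn_diff: "ksgn (a - b) = ksgn a * ksgn b"
  by (simp add: ksgn_def)

lemma ksgn_mult_self: "ksgn a * ksgn a = 1"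
  by (simp add: ksgn_def)

lemma ksgn_mult_self': "ksgn a * (ksgn a * x) = x"
  by (simp add: ksgn_def)

lemma ksgn_01: "ksgn 0 = 1" "ksgn 1 = - 1" "ksgn (- 1) = - 1" "ksgn 2 = 1" "ksgn (- 2) = 1" "ksgn (2 * a) = 1"
  by (simp_all add: ksgn_def)

lemma cls_comp_cong:
  assumes "cls t = cls t'" "cls s = cls s'" "tset t = tset t'" "tset s = tset s'"
    "qdeg t = qdeg t'" "qdeg s = qdeg s'" "qwf t'" "qwf s'" "qwf (OComp t a s)"
  shows "cls (OComp t a s) = cls (OComp t' a s')"
proof -
  have "qeq t t'" "qeq s s'" using assms by (auto simp: cls_eq_iff)
  then have "qeq (OComp t a s) (OComp t' a s')"
    using assms by (intro opeq.comp_cong[where S = "tset t" and U = "tset s"]) (auto simp: typed_iff)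
  then show ?thesis by (rule cls_eqI)
qed

lemma cls_relabel_cong:
  assumes "cls t = cls t'" "tset t = tset t'" "qdeg t = qdeg t'" "qwf t'" "qwf (ORelabel f t)"
  shows "cls (ORelabel f t) = cls (ORelabel f t')"
proof -
  have "qeq t t'" using assms by (auto simp: cls_eq_iff)
  then have "qeq (ORelabel f t) (ORelabel f t')"
    using assms by (intro opeq.relabel_cong[where S = "tset t"]) (auto simp: typed_iff)
  then show ?thesis by (rule cls_eqI)
qed

lemma cls_diff_cong:
  assumes "cls t = cls t'" "tset t = tset t'" "qdeg t = qdeg t'" "qwf t'" "qwf t"
  shows "cls (ODiff t) = cls (ODiff t')"
  using assms by (metis cls_eq_iff cls_eqI opeq.diff_cong)

lemma cls_comp_add:
  "qwf (OComp (OAdd t t') a s) \<Longrightarrow> cls (OComp (OAdd t t') a s) = cls (OComp t a s) + cls (OComp t' a s)"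
  "qwf (OComp t a (OAdd s s')) \<Longrightarrow> cls (OComp t a (OAdd s s')) = cls (OComp t a s) + cls (OComp t a s')"
  by (subst cls_add[symmetric], auto intro!: cls_eqI opeq.comp_add_left opeq.comp_add_right simp: typed_iff)+

lemma cls_comp_scale:
  "qwf (OComp t a s) \<Longrightarrow> cls (OComp (OScale r t) a s) = r *\<^sub>R cls (OComp t a s)"
  "qwf (OComp t a s) \<Longrightarrow> cls (OComp t a (OScale r s)) = r *\<^sub>R cls (OComp t a s)"
  by (subst cls_scale[symmetric], auto intro!: cls_eqI opeq.comp_scale_left opeq.comp_scale_right simp: typed_iff)+

lemma cls_relabel_add:
  "qwf (ORelabel f (OAdd t s)) \<Longrightarrow> cls (ORelabel f (OAdd t s)) = cls (ORelabel f t) + cls (ORelabel f s)"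
  by (subst cls_add[symmetric], auto intro!: cls_eqI opeq.relabel_add simp: typed_iff)

lemma cls_relabel_scale:
  "qwf (ORelabel f t) \<Longrightarrow> cls (ORelabel f (OScale r t)) = r *\<^sub>R cls (ORelabel f t)"
  by (subst cls_scale[symmetric], auto intro!: cls_eqI opeq.relabel_scale simp: typed_iff)

lemma cls_diff_add:
  "qwf (OAdd t s) \<Longrightarrow> cls (ODiff (OAdd t s)) = cls (ODiff t) + cls (ODiff s)"
  by (subst cls_add[symmetric], auto intro!: cls_eqI opeq.diff_add simp: typed_iff)

lemma cls_diff_scale:
  "qwf t \<Longrightarrow> cls (ODiff (OScale r t)) = r *\<^sub>R cls (ODiff t)"
  by (subst cls_scale[symmetric], auto intro!: cls_eqI opeq.diff_scale simp: typed_iff)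

lemma cls_scale0: "finite S \<Longrightarrow> cls (OZero S k) = cls (OScale 0 (OZero S k))"
  by (simp add: cls_zero cls_scale)

lemma cls_op_zero:
  "qwf (OComp (OZero S k) a s) \<Longrightarrow> cls (OComp (OZero S k) a s) = 0"
  "qwf (OComp t a (OZero S k)) \<Longrightarrow> cls (OComp t a (OZero S k)) = 0"
  "qwf (ORelabel f (OZero S k)) \<Longrightarrow> cls (ORelabel f (OZero S k)) = 0"
  "finite S \<Longrightarrow> cls (ODiff (OZero S k)) = 0"
proof -
  assume "qwf (OComp (OZero S k) a s)"
  then have "cls (OComp (OZero S k) a s) = cls (OComp (OScale 0 (OZero S k)) a s)"
    by (intro cls_comp_cong cls_scale0) auto
  also have "\<dots> = 0" using \<open>qwf (OComp (OZero S k) a s)\<close> by (simp add: cls_comp_scale)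
  finally show "cls (OComp (OZero S k) a s) = 0" .
next
  assume "qwf (OComp t a (OZero S k))"
  then have "cls (OComp t a (OZero S k)) = cls (OComp t a (OScale 0 (OZero S k)))"
    by (intro cls_comp_cong cls_scale0) auto
  also have "\<dots> = 0" using \<open>qwf (OComp t a (OZero S k))\<close> by (simp add: cls_comp_scale)
  finally show "cls (OComp t a (OZero S k)) = 0" .
next
  assume "qwf (ORelabel f (OZero S k))"
  then have "cls (ORelabel f (OZero S k)) = cls (ORelabel f (OScale 0 (OZero S k)))"
    by (intro cls_relabel_cong cls_scale0) auto
  also have "\<dots> = 0" using \<open>qwf (ORelabel f (OZero S k))\<close> by (simp add: cls_relabel_scale)
  finally show "cls (ORelabel f (OZero S k)) = 0" .
next
  assume "finite S"
  then have "cls (ODiff (OZero S k)) = cls (ODiff (OScale 0 (OZero S k)))"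
    by (intro cls_diff_cong cls_scale0) auto
  also have "\<dots> = 0" using \<open>finite S\<close> by (simp add: cls_diff_scale)
  finally show "cls (ODiff (OZero S k)) = 0" .
qed

lemma cls_diff_comp:
  assumes "qwf (OComp t a s)"
  shows "cls (ODiff (OComp t a s)) =
    cls (OComp (ODiff t) a s) + ksgn (qdeg t) *\<^sub>R cls (OComp t a (ODiff s))"
proof -
  have *: "qeq (ODiff (OComp t a s)) (OAdd (OComp (ODiff t) a s) (OScale (ksgn (qdeg t)) (OComp t a (ODiff s))))"
    using assms by (intro opeq.diff_comp) (auto simp: typed_iff)
  show ?thesis using assms unfolding cls_eqI[OF *] by (simp add: cls_add cls_scale)
qed

lemma cls_diff_relabel:
  "qwf (ORelabel f t) \<Longrightarrow> cls (ODiff (ORelabel f t)) = cls (ORelabel f (ODiff t))"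
  by (auto intro!: cls_eqI opeq.diff_relabel simp: typed_iff)

lemma cls_diff_diff: "qwf t \<Longrightarrow> cls (ODiff (ODiff t)) = 0"
  using cls_eqI[OF opeq.diff_diff] by (auto simp: typed_iff cls_zero)

lemmas cls_lin = cls_add cls_scale cls_zero cls_comp_add cls_comp_scale cls_relabel_add
  cls_relabel_scale cls_diff_add cls_diff_scale cls_op_zero

text \<open>
The derivation of degree \<open>e\<close> with values \<open>G\<close> on the generators and commutator \<open>E\<close> with the
differential. Since \<open>d\<close> is a formal operation on expressions, its interaction with a derivation has to be
prescribed; the last equation reads \<open>[D, d] = E\<close>.
\<close>

primrec der :: "int \<Rightarrow> (bv_gen \<Rightarrow> nat set \<Rightarrow> bv_gen opterm) \<Rightarrow> (bv_gen opterm \<Rightarrow> bv_gen opterm) \<Rightarrow>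
    bv_gen opterm \<Rightarrow> bv_gen opterm" where
  "der e G E (OGen g S) = G g S"
| "der e G E (OUnit a) = OZero {a} e"
| "der e G E (OComp t a s) =
     OAdd (OComp (der e G E t) a s) (OScale (ksgn (e * qdeg t)) (OComp t a (der e G E s)))"
| "der e G E (ORelabel f t) = ORelabel f (der e G E t)"
| "der e G E (OZero S k) = OZero S (k + e)"
| "der e G E (OAdd t s) = OAdd (der e G E t) (der e G E s)"
| "der e G E (OScale r t) = OScale r (der e G E t)"
| "der e G E (ODiff t) = OAdd (E t) (OScale (ksgn e) (ODiff (der e G E t)))"

text \<open>
A derivation of degree \<open>e\<close> of the operad Q that commutes with \<open>d\<close> in the graded sense,
represented by a map of expressions.
\<close>

definition graded_derivation :: "int \<Rightarrow> (bv_gen opterm \<Rightarrow> bv_gen opterm) \<Rightarrow> bool" where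
  "graded_derivation e E \<longleftrightarrow>
     (\<forall>t. qwf t \<longrightarrow> qwf (E t) \<and> tset (E t) = tset t \<and> qdeg (E t) = qdeg t + e) \<and>
     (\<forall>t s. qeq t s \<longrightarrow> cls (E t) = cls (E s)) \<and>
     (\<forall>S k. finite S \<longrightarrow> cls (E (OZero S k)) = 0) \<and>
     (\<forall>t s. qwf (OAdd t s) \<longrightarrow> cls (E (OAdd t s)) = cls (E t) + cls (E s)) \<and>
     (\<forall>r t. qwf t \<longrightarrow> cls (E (OScale r t)) = r *\<^sub>R cls (E t)) \<and>
     (\<forall>t a s. qwf (OComp t a s) \<longrightarrow> cls (E (OComp t a s)) =
        cls (OComp (E t) a s) + ksgn (e * qdeg t) *\<^sub>R cls (OComp t a (E s))) \<and>
     (\<forall>f t. qwf (ORelabel f t) \<longrightarrow> cls (E (ORelabel f t)) = cls (ORelabel f (E t))) \<and>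
     (\<forall>t. qwf t \<longrightarrow> cls (E (ODiff t)) = ksgn e *\<^sub>R cls (ODiff (E t)))"

lemma der_wf:
  assumes E: "\<And>t. qwf t \<Longrightarrow> qwf (E t) \<and> tset (E t) = tset t \<and> qdeg (E t) = qdeg t + (e + 1)"
    and G: "\<And>g S. qwf (OGen g S) \<Longrightarrow>
       qwf (G g S) \<and> tset (G g S) = S \<and> qdeg (G g S) = degr bvq_pres g + e"
  shows "qwf t \<Longrightarrow> qwf (der e G E t) \<and> tset (der e G E t) = tset t \<and> qdeg (der e G E t) = qdeg t + e"
proof (induction t)
  case (OGen g S)
  then show ?case using G[of g S] by simp
qed (auto simp: E)

text \<open>
For each operad axiom, applying the Leibniz rule to both sides gives instances of the same
axiom in which one argument \<open>t\<close> has been replaced by \<open>D t\<close>, with equal signs; so hypotheses are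
needed only on the generators and the relations. The axiom \<open>d\<^sup>2 = 0\<close> is where \<open>E\<close> has to commute with \<open>d\<close>.
\<close>

theorem der_respects:
  fixes e :: int
  assumes E: "graded_derivation (e + 1) E"
    and G: "\<And>g S. qwf (OGen g S) \<Longrightarrow>
       qwf (G g S) \<and> tset (G g S) = S \<and> qdeg (G g S) = degr bvq_pres g + e"
    and Grel: "\<And>g S f. qwf (OGen g S) \<Longrightarrow> inj_on f S \<Longrightarrow> cls (ORelabel f (G g S)) = cls (G g (f ` S))"
    and rels: "\<And>t s. (t, s) \<in> rels bvq_pres \<Longrightarrow> cls (der e G E t) = cls (der e G E s)"
    and "qeq t s"
  shows "cls (der e G E t) = cls (der e G E s)"
proof -
  let ?D = "der e G E"
  have Ewf: "\<And>t. qwf t \<Longrightarrow> qwf (E t)" "\<And>t. qwf t \<Longrightarrow> tset (E t) = tset t"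
      "\<And>t. qwf t \<Longrightarrow> qdeg (E t) = qdeg t + (e + 1)"
    and Ezero: "\<And>S k. finite S \<Longrightarrow> cls (E (OZero S k)) = 0"
    and Eadd: "\<And>t s. qwf (OAdd t s) \<Longrightarrow> cls (E (OAdd t s)) = cls (E t) + cls (E s)"
    and Escale: "\<And>r t. qwf t \<Longrightarrow> cls (E (OScale r t)) = r *\<^sub>R cls (E t)"
    and Ecomp: "\<And>t a s. qwf (OComp t a s) \<Longrightarrow> cls (E (OComp t a s)) =
        cls (OComp (E t) a s) + ksgn ((e + 1) * qdeg t) *\<^sub>R cls (OComp t a (E s))"
    and Erelabel: "\<And>f t. qwf (ORelabel f t) \<Longrightarrow> cls (E (ORelabel f t)) = cls (ORelabel f (E t))"
    and Ediff: "\<And>t. qwf t \<Longrightarrow> cls (E (ODiff t)) = ksgn (e + 1) *\<^sub>R cls (ODiff (E t))"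
    using E unfolding graded_derivation_def by (elim conjE; simp)+
  have Eeq: "cls (E t) = cls (E s)" if "qeq t s" for t s
    using E[unfolded graded_derivation_def, THEN conjunct2, THEN conjunct1] that by simp
  have D': "qwf t \<Longrightarrow> qwf (?D t) \<and> tset (?D t) = tset t \<and> qdeg (?D t) = qdeg t + e" for t
    by (rule der_wf[OF _ G]) (simp_all add: Ewf)
  have D: "qwf (?D t)" "tset (?D t) = tset t" "qdeg (?D t) = qdeg t + e" if "qwf t" for t
    using D'[OF that] by auto
  note ext = Ewf D
  note sg = ksgn_add ksgn_diff ksgn_minus ksgn_01 ksgn_mult_self ksgn_mult_self' algebra_simps
  show ?thesis
    using \<open>qeq t s\<close>
  proof (induction rule: opeq.induct)
    case (rel t s)
    then show ?case by (rule rels)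
  next
    case (refl t S k)
    show ?case ..
  next
    case (sym t s)
    then show ?case by simp
  next
    case (trans t s u)
    then show ?case by simp
  next
    case (comp_cong t t' s s' S k U l a)
    note wf = qeq_wf[OF comp_cong.hyps(1)] qeq_wf[OF comp_cong.hyps(2)]
    have c: "cls t = cls t'" "cls s = cls s'" using comp_cong cls_eqI by auto
    have "cls (OComp (?D t) a s) = cls (OComp (?D t') a s')"
      using comp_cong wf c by (intro cls_comp_cong) (auto simp: ext typed_iff)
    moreover have "cls (OComp t a (?D s)) = cls (OComp t' a (?D s'))"
      using comp_cong wf c by (intro cls_comp_cong) (auto simp: ext typed_iff)
    ultimately show ?case
      using comp_cong wf by (simp add: cls_lin ext typed_iff)
  next
    case (relabel_cong t t' S k f)
    note wf = qeq_wf[OF relabel_cong.hyps(1)]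
    have "cls (ORelabel f (?D t)) = cls (ORelabel f (?D t'))"
      using relabel_cong wf by (intro cls_relabel_cong) (auto simp: ext typed_iff)
    then show ?case by simp
  next
    case (add_cong t t' s s' S k)
    note wf = qeq_wf[OF add_cong.hyps(1)] qeq_wf[OF add_cong.hyps(2)]
    then show ?case using add_cong by (simp add: cls_lin ext typed_iff)
  next
    case (scale_cong t t' r)
    note wf = qeq_wf[OF scale_cong.hyps(1)]
    then show ?case using scale_cong by (simp add: cls_lin ext typed_iff)
  next
    case (diff_cong t t')
    note wf = qeq_wf[OF diff_cong.hyps(1)]
    have "cls (ODiff (?D t)) = cls (ODiff (?D t'))"
      using diff_cong wf by (intro cls_diff_cong) (auto simp: ext)
    then show ?case using wf Eeq[OF diff_cong.hyps(1)] by (simp add: cls_lin ext)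
  next
    case (comp_add_left t S k t' s U l a)
    then show ?case by (simp add: cls_lin ext typed_iff scaleR_add_right)
  next
    case (comp_add_right t S k s U l s' a)
    then show ?case by (simp add: cls_lin ext typed_iff scaleR_add_right)
  next
    case (comp_scale_left t S k s U l a r)
    then show ?case by (simp add: cls_lin ext typed_iff sg)
  next
    case (comp_scale_right t S k s U l a r)
    then show ?case by (simp add: cls_lin ext typed_iff sg)
  next
    case (diff_add t S k s)
    then show ?case by (simp add: cls_lin ext typed_iff Eadd scaleR_add_right)
  next
    case (diff_scale t S k r)
    then show ?case by (simp add: cls_lin ext typed_iff Escale sg)
  next
    case (diff_diff t S k)
    then show ?case by (simp add: cls_lin ext typed_iff Ediff cls_diff_diff finite_tset sg)
  next
    case (diff_comp t S k s U l a)
    then show ?case by (simp add: cls_lin ext typed_iff Ecomp cls_diff_comp sg)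
  next
    case (diff_relabel t S k f)
    then show ?case by (simp add: cls_lin ext typed_iff Erelabel cls_diff_relabel sg)
  next
    case (relabel_ext t S k f g)
    then show ?case
      by (auto simp: ext typed_iff intro!: cls_eqI opeq.relabel_ext[where S = S])
  next
    case (relabel_id t S k)
    then show ?case
      by (auto simp: ext typed_iff intro!: cls_eqI opeq.relabel_id)
  next
    case (relabel_relabel t S k f g)
    then show ?case
      by (auto simp: ext typed_iff intro!: cls_eqI opeq.relabel_relabel)
  next
    case (relabel_gen x S k f)
    then show ?case using Grel[of x S f] by (auto simp: typed_iff)
  next
    case (relabel_unit f a)
    then show ?case by (simp add: cls_lin)
  next
    case (relabel_comp t S k s U l a f f1)
    have wf: "qwf t" "qwf s" "tset t = S" "tset s = U" using relabel_comp by (auto simp: typed_iff)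
    have *: "qeq (ORelabel f (OComp t' a s')) (OComp (ORelabel f1 t') (f1 a) (ORelabel f s'))"
      if "qwf t'" "qwf s'" "tset t' = S" "tset s' = U" for t' s'
      using relabel_comp that by (intro opeq.relabel_comp[where S = S and U = U]) (auto simp: typed_iff)
    note w = qeq_wf[OF *]
    show ?case
      using w(1,2)[of t s] w(1,2)[of "?D t" s] w(1,2)[of t "?D s"] wf
      by (simp add: cls_lin ext *[THEN cls_eqI])
  next
    case (unit_left t S k a)
    then show ?case
      by (auto simp: cls_lin ext typed_iff sg intro!: cls_eqI opeq.unit_left)
  next
    case (unit_right t S k a b)
    then show ?case
      by (auto simp: cls_lin ext typed_iff sg intro!: cls_eqI opeq.unit_right)
  next
    case (comp_seq t S k s U l u V m a b)
    have wf: "qwf t" "qwf s" "qwf u" "tset t = S" "tset s = U" "tset u = V" "qdeg t = k" "qdeg s = l"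
      using comp_seq by (auto simp: typed_iff)
    have *: "qeq (OComp (OComp t' a s') b u') (OComp t' a (OComp s' b u'))"
      if "qwf t'" "qwf s'" "qwf u'" "tset t' = S" "tset s' = U" "tset u' = V" for t' s' u'
      using comp_seq that by (intro opeq.comp_seq[where S = S and U = U and V = V]) (auto simp: typed_iff)
    note w = qeq_wf[OF *]
    show ?case
      using w(1,2)[of t s u] w(1,2)[of "?D t" s u] w(1,2)[of t "?D s" u] w(1,2)[of t s "?D u"] wf
      by (simp add: cls_lin ext *[THEN cls_eqI] sg)
  next
    case (comp_par t S k s U l u V m a b)
    have wf: "qwf t" "qwf s" "qwf u" "tset t = S" "tset s = U" "tset u = V" "qdeg t = k" "qdeg s = l" "qdeg u = m"
      using comp_par by (auto simp: typed_iff)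
    have *: "qeq (OComp (OComp t' a s') b u') (OScale (ksgn (qdeg s' * qdeg u')) (OComp (OComp t' b u') a s'))"
      if "qwf t'" "qwf s'" "qwf u'" "tset t' = S" "tset s' = U" "tset u' = V" for t' s' u'
      using comp_par that by (intro opeq.comp_par[where S = S and U = U and V = V]) (auto simp: typed_iff)
    note w = qeq_wf[OF *]
    have **: "cls (OComp (OComp t' a s') b u') = ksgn (qdeg s' * qdeg u') *\<^sub>R cls (OComp (OComp t' b u') a s')"
      if "qwf t'" "qwf s'" "qwf u'" "tset t' = S" "tset s' = U" "tset u' = V" for t' s' u'
      using cls_eqI[OF *[OF that]] w(2)[OF that] by (simp add: cls_scale)
    show ?case
      using w(1,2)[of t s u] w(1,2)[of "?D t" s u] w(1,2)[of t "?D s" u] w(1,2)[of t s "?D u"] wf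
      by (simp add: cls_lin ext ** sg)
  qed (auto simp: cls_lin ext typed_iff sg finite_tset)
qed

section \<open>The weight and the homotopy\<close>

lemma typed_cong:
  assumes "gens P = gens P'" "arity P = arity P'" "degr P = degr P'"
  shows "typed P = typed P'"
proof -
  have *: "typed P' t S k"
    if "gens P = gens P'" "arity P = arity P'" "degr P = degr P'" "typed P t S k" for P P' :: "'b presentation" and t S k
    using that(4)
  proof (induction rule: typed.induct)
    case (1 g S)
    then show ?case using typed.intros(1)[of g P' S] that(1-3) by simp
  qed (blast intro: typed.intros)+
  show ?thesis using *[of P P'] *[of P' P] assms by (intro ext iffI) simp_all
qed

lemma opeq_mono:
  assumes sig: "gens P = gens P'" "arity P = arity P'" "degr P = degr P'"
    and rels: "\<And>t s. (t, s) \<in> rels P \<Longrightarrow> opeq P' t s"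
    and "opeq P t s"
  shows "opeq P' t s"
  using \<open>opeq P t s\<close>
proof (induction rule: opeq.induct)
  case (rel t s)
  then show ?case by (rule rels)
next
  case relabel_ext
  then show ?case unfolding typed_cong[OF sig] by (blast intro: opeq.relabel_ext)
next
  case relabel_comp
  then show ?case unfolding typed_cong[OF sig] by (blast intro: opeq.relabel_comp)
qed (unfold typed_cong[OF sig], (rule opeq.intros(2-38); assumption)+)

lemma famrelI:
  assumes "\<And>S k. finite S \<Longrightarrow> qeq (x S k) (y S k)"
    and "\<And>S k. finite S \<Longrightarrow> qwf (x S k) \<and> tset (x S k) = S \<and> qdeg (x S k) = k"
  shows "famrel x y"
  using assms by (simp add: famrel_def typed_iff)

lemma famrelD:
  assumes "famrel x y" "finite S"
  shows "qeq (x S k) (y S k)" "qwf (x S k)" "tset (x S k) = S" "qdeg (x S k) = k"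
  using assms by (simp_all add: famrel_def typed_iff)

text \<open>
Partial composition on classes. It is bilinear without side conditions, so that sums, multiples and
zeros can be pulled out of nested compositions.
\<close>

lift_definition qcomp :: "nat set \<Rightarrow> int \<Rightarrow> nat \<Rightarrow> nat set \<Rightarrow> int \<Rightarrow> qop \<Rightarrow> qop \<Rightarrow> qop" is
  "\<lambda>S k a U l x y T m. if finite S \<and> finite U \<and> a \<in> S \<and> (S - {a}) \<inter> U = {} \<and> T = (S - {a}) \<union> U \<and> m = k + l
     then OComp (x S k) a (y U l) else OZero T m"
  by (rule famrelI) (simp_all add: famrelD typed_iff qeq_zero opeq.comp_cong)

lemma cls_comp_conv_qcomp:
  assumes "qwf (OComp t a s)"
  shows "cls (OComp t a s) = qcomp (tset t) (qdeg t) a (tset s) (qdeg s) (cls t) (cls s)"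
  using assms
proof (transfer, goal_cases)
  case (1 t a s)
  then have "qeq (OComp t a s) (OComp t a s)" by (intro opeq.refl[OF wf_term_typed])
  with 1 show ?case
    by (intro famrelI) (simp_all add: typed_iff finite_tset[where P = bvq_pres] qeq_zero)
qed

lemma qcomp_scale:
  "qcomp S k a U l (r *\<^sub>R x) y = r *\<^sub>R qcomp S k a U l x y"
  "qcomp S k a U l x (r *\<^sub>R y) = r *\<^sub>R qcomp S k a U l x y"
  by (transfer, rule famrelI, simp_all add: famrelD typed_iff
      opeq.comp_scale_left opeq.comp_scale_right opeq.sym[OF qeq_scale_zero])+

lemma qcomp_add:
  "qcomp S k a U l (x + x') y = qcomp S k a U l x y + qcomp S k a U l x' y"
  "qcomp S k a U l x (y + y') = qcomp S k a U l x y + qcomp S k a U l x y'"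
  by (transfer, rule famrelI, simp_all add: famrelD typed_iff
      opeq.comp_add_left opeq.comp_add_right qeq_zero_zero)+

lemma qcomp_zero:
  "qcomp S k a U l 0 y = 0"
  "qcomp S k a U l x 0 = 0"
  using qcomp_scale(1)[of S k a U l 0 0 y] qcomp_scale(2)[of S k a U l x 0 0] by simp_all

lemma qcomp_uminus:
  "qcomp S k a U l (- x) y = - qcomp S k a U l x y"
  "qcomp S k a U l x (- y) = - qcomp S k a U l x y"
  using qcomp_scale(1)[of S k a U l "- 1" x y] qcomp_scale(2)[of S k a U l x "- 1" y] by simp_all

lemmas qcomp_lin = qcomp_scale qcomp_add qcomp_zero qcomp_uminus cls_comp_conv_qcomp cls_add cls_scale cls_zero

fun bv_weight :: "bv_gen \<Rightarrow> nat" where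
  "bv_weight Mu = 0"
| "bv_weight Delta = 1"
| "bv_weight (Phi n) = n"

definition weight_op :: "bv_gen opterm \<Rightarrow> bv_gen opterm" where
  "weight_op = der 0 (\<lambda>g S. OScale (real (bv_weight g)) (OGen g S)) (\<lambda>t. OZero (tset t) (qdeg t + 1))"

text \<open>
The homotopy \<open>h\<close>. It is prescribed to satisfy \<open>hd + dh = W\<close>, which is consistent because \<open>W\<close>
commutes with \<open>d\<close>.
\<close>

definition homotopy_op :: "bv_gen opterm \<Rightarrow> bv_gen opterm" where
  "homotopy_op = der (- 1) (\<lambda>g S. case g of Delta \<Rightarrow> OScale (- 1) (OGen (Phi 1) S)
     | _ \<Rightarrow> OZero S (degr bvq_pres g - 1)) weight_op"

lemma zero_derivation: "graded_derivation 1 (\<lambda>t. OZero (tset t) (qdeg t + 1))"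
  unfolding graded_derivation_def
  by (auto simp: finite_tset cls_lin)

lemma qwf_gen:
  "qwf (OGen g S) \<longleftrightarrow> (case g of Mu \<Rightarrow> finite S \<and> card S = 2 | Delta \<Rightarrow> finite S \<and> card S = 1
     | Phi n \<Rightarrow> 1 \<le> n \<and> finite S \<and> card S = 1)"
  by (cases g) auto

lemma cls_rels:
  "cls (ODiff (OGen Mu {0, 1})) = 0"
  "cls (bv_triple 0 1 2) = cls (bv_triple 1 2 0)"
  "cls (ODiff bv_delta) = 0"
  "cls (OComp bv_delta 0 bv_delta) = 0"
  "cls (fst (bv_order2 Delta (- 1))) = cls (snd (bv_order2 Delta (- 1)))"
  "cls (ODiff (bv_phi 1)) = - cls bv_delta"
  "cls (fst (bv_order2 (Phi 1) (- 2))) = cls (snd (bv_order2 (Phi 1) (- 2)))"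
  "cls (OComp (bv_phi 1) 0 bv_delta) = cls (OComp bv_delta 0 (bv_phi 1))"
  "2 \<le> n \<Longrightarrow> cls (bv_phi n) = 0"
proof -
  have *: "cls t = cls s" if "(t, s) \<in> rels bvq_pres" for t s
    using that by (intro cls_eqI opeq.rel)
  show "cls (ODiff (OGen Mu {0, 1})) = 0" using *[of "ODiff (OGen Mu {0, 1})" "OZero {0, 1} 1"]
    by (simp add: rels_bvq cls_zero)
  show "cls (bv_triple 0 1 2) = cls (bv_triple 1 2 0)" by (rule *) (simp add: rels_bvq)
  show "cls (ODiff bv_delta) = 0" using *[of "ODiff bv_delta" "OZero {0} 0"]
    by (simp add: rels_bvq cls_zero)
  show "cls (OComp bv_delta 0 bv_delta) = 0" using *[of "OComp bv_delta 0 bv_delta" "OZero {0} (- 2)"]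
    by (simp add: rels_bvq cls_zero)
  show "cls (fst (bv_order2 Delta (- 1))) = cls (snd (bv_order2 Delta (- 1)))"
    by (rule *) (simp add: rels_bvq)
  show "cls (ODiff (bv_phi 1)) = - cls bv_delta"
    using *[of "ODiff (bv_phi 1)" "OScale (- 1) bv_delta"]
    by (simp add: rels_bvq cls_scale)
  show "cls (fst (bv_order2 (Phi 1) (- 2))) = cls (snd (bv_order2 (Phi 1) (- 2)))"
    by (rule *) (simp add: rels_bvq)
  show "cls (OComp (bv_phi 1) 0 bv_delta) = cls (OComp bv_delta 0 (bv_phi 1))"
    by (rule *) (simp add: rels_bvq)
  show "2 \<le> n \<Longrightarrow> cls (bv_phi n) = 0" using *[of "bv_phi n" "OZero {0} (- 2 * int n)"]
    by (simp add: rels_bvq cls_zero)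
qed

lemma rels_bvq_cases:
  assumes "(t, s) \<in> rels bvq_pres"
  obtains "t = ODiff (OGen Mu {0, 1})" "s = OZero {0, 1} 1"
  | "t = bv_triple 0 1 2" "s = bv_triple 1 2 0"
  | "t = ODiff bv_delta" "s = OZero {0} 0"
  | "t = OComp bv_delta 0 bv_delta" "s = OZero {0} (- 2)"
  | "t = fst (bv_order2 Delta (- 1))" "s = snd (bv_order2 Delta (- 1))"
  | "t = ODiff (bv_phi 1)" "s = OScale (- 1) bv_delta"
  | "t = fst (bv_order2 (Phi 1) (- 2))" "s = snd (bv_order2 (Phi 1) (- 2))"
  | "t = OComp (bv_phi 1) 0 bv_delta" "s = OComp bv_delta 0 (bv_phi 1)"
  | n where "2 \<le> n" "t = bv_phi n" "s = OZero {0} (- 2 * int n)"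
proof -
  note that' = that
  have "(t, s) = (ODiff (OGen Mu {0, 1}), OZero {0, 1} 1) \<or> (t, s) = (bv_triple 0 1 2, bv_triple 1 2 0)
    \<or> (t, s) = (ODiff bv_delta, OZero {0} 0) \<or> (t, s) = (OComp bv_delta 0 bv_delta, OZero {0} (- 2))
    \<or> (t, s) = bv_order2 Delta (- 1) \<or> (t, s) = (ODiff (bv_phi 1), OScale (- 1) bv_delta)
    \<or> (t, s) = bv_order2 (Phi 1) (- 2)
    \<or> (t, s) = (OComp (bv_phi 1) 0 bv_delta, OComp bv_delta 0 (bv_phi 1))
    \<or> (\<exists>n\<ge>2. t = bv_phi n \<and> s = OZero {0} (- 2 * int n))"
    using assms unfolding rels_bvq by blast
  then show thesis
    by (elim disjE exE conjE; (rule that; simp; fail)?) (metis fst_conv snd_conv that)+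
qed

lemma weight_op_respects: "qeq t s \<Longrightarrow> cls (weight_op t) = cls (weight_op s)"
  unfolding weight_op_def
proof (rule der_respects[where e = 0, unfolded add_0_left, OF zero_derivation], goal_cases)
  case (3 t s)
  note R = 3(2)
  show ?case using R
    by (elim rels_bvq_cases) (insert cls_rels(1-8),
      simp_all add: bv_term_defs qcomp_lin cls_op_zero cls_diff_scale cls_diff_add card_insert_if insert_commute insert_Diff_if ksgn_01 cls_rels(9) algebra_simps)
qed (auto simp: cls_lin card_image qwf_gen cls_eqI[OF opeq.relabel_gen] typed_iff)

lemma homotopy_op_respects:
  assumes "graded_derivation 0 weight_op"
  shows "qeq t s \<Longrightarrow> cls (homotopy_op t) = cls (homotopy_op s)"
  unfolding homotopy_op_def
proof (rule der_respects[where e = "- 1"], goal_cases)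
  case 1
  then show ?case using assms by simp
next
  case (2 g S)
  then show ?case by (cases g) auto
next
  case (3 g S f)
  then show ?case 
    by (cases g) (auto simp: cls_lin card_image cls_eqI[OF opeq.relabel_gen] typed_iff)
next
  case (4 t s)
  note R = 4(2)
  show ?case using R
    by (elim rels_bvq_cases) (insert cls_rels(1-8),
      simp_all add: bv_term_defs qcomp_lin cls_op_zero cls_diff_scale cls_diff_add card_insert_if insert_commute insert_Diff_if ksgn_01 cls_rels(9) weight_op_def algebra_simps)
qed auto

section \<open>Cocycles of nonzero degree are exact in the quotient\<close>

lemma weight_op_wf: "qwf t \<Longrightarrow> qwf (weight_op t) \<and> tset (weight_op t) = tset t \<and> qdeg (weight_op t) = qdeg t"
  using der_wf[of "\<lambda>t. OZero (tset t) (qdeg t + 1)" 0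
      "\<lambda>g S. OScale (real (bv_weight g)) (OGen g S)" t]
  by (simp add: weight_op_def finite_tset)

lemma weight_op_derivation: "graded_derivation 0 weight_op"
  unfolding graded_derivation_def
  by (intro conjI allI impI)
    (simp_all add: weight_op_wf weight_op_respects cls_lin ksgn_01, simp_all add: weight_op_def cls_lin ksgn_01 finite_tset
      weight_op_wf[unfolded weight_op_def])

lemma homotopy_op_wf: "qwf t \<Longrightarrow> qwf (homotopy_op t) \<and> tset (homotopy_op t) = tset t \<and> qdeg (homotopy_op t) = qdeg t - 1"
proof -
  assume "qwf t"
  then have "qwf (homotopy_op t) \<and> tset (homotopy_op t) = tset t \<and> qdeg (homotopy_op t) = qdeg t + (- 1)"
    unfolding homotopy_op_def
  proof (rule der_wf[rotated -1])
    fix g S assume "qwf (OGen g S)"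
    then show "qwf (case g of Delta \<Rightarrow> OScale (- 1) (OGen (Phi 1) S) | _ \<Rightarrow> OZero S (degr bvq_pres g - 1))
      \<and> tset (case g of Delta \<Rightarrow> OScale (- 1) (OGen (Phi 1) S) | _ \<Rightarrow> OZero S (degr bvq_pres g - 1)) = S
      \<and> qdeg (case g of Delta \<Rightarrow> OScale (- 1) (OGen (Phi 1) S) | _ \<Rightarrow> OZero S (degr bvq_pres g - 1))
        = degr bvq_pres g + - 1"
      by (cases g) auto
  qed (simp add: weight_op_wf)
  then show ?thesis by simp
qed

lemma homotopy_formula:
  assumes "qwf t"
  shows "cls (homotopy_op (ODiff t)) + cls (ODiff (homotopy_op t)) = cls (weight_op t)"
proof -
  have "homotopy_op (ODiff t) = OAdd (weight_op t) (OScale (ksgn (- 1)) (ODiff (homotopy_op t)))"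
    by (simp add: homotopy_op_def)
  then show ?thesis using homotopy_op_wf[OF assms] weight_op_wf[OF assms] by (simp add: cls_lin ksgn_01)
qed

text \<open>
Homogeneous expressions of weight \<open>w\<close>. Weight 0 comes with the extra information that such an
expression equals one that is built from \<open>\<mu>\<close> alone, which is recorded as: it is closed, and it
vanishes unless its degree is 0. These properties pass through compositions because weights are nonnegative.
\<close>

definition pure_weight :: "nat \<Rightarrow> bv_gen opterm \<Rightarrow> bool" where
  "pure_weight w t \<longleftrightarrow> qwf t \<and> cls (weight_op t) = real w *\<^sub>R cls t \<and>
     (w = 0 \<longrightarrow> cls (ODiff t) = 0 \<and> (qdeg t \<noteq> 0 \<longrightarrow> cls t = 0))"

inductive weights_upto :: "nat \<Rightarrow> bv_gen opterm \<Rightarrow> bool" for m where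
  pure: "\<lbrakk>pure_weight w t; w \<le> m\<rbrakk> \<Longrightarrow> weights_upto m t"
| sum: "\<lbrakk>weights_upto m t; weights_upto m s; tset t = tset s; qdeg t = qdeg s\<rbrakk>
    \<Longrightarrow> weights_upto m (OAdd t s)"
| eq: "\<lbrakk>weights_upto m t; qeq t s\<rbrakk> \<Longrightarrow> weights_upto m s"

lemma weights_upto_wf: "weights_upto m t \<Longrightarrow> qwf t"
  by (induction rule: weights_upto.induct) (auto simp: pure_weight_def dest: qeq_wf)

lemma weights_upto_mono: "weights_upto m t \<Longrightarrow> m \<le> n \<Longrightarrow> weights_upto n t"
  by (induction rule: weights_upto.induct) (auto intro: weights_upto.intros order.trans)

lemma weight_op_comp:
  assumes "qwf (OComp t a s)"
  shows "cls (weight_op (OComp t a s)) = cls (OComp (weight_op t) a s) + cls (OComp t a (weight_op s))"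
  using assms weight_op_wf[of t] weight_op_wf[of s] by (simp add: weight_op_def cls_lin ksgn_01)

lemma pure_weight_comp:
  assumes "pure_weight v t" "pure_weight w s" "qwf (OComp t a s)"
  shows "pure_weight (v + w) (OComp t a s)"
proof -
  have "cls (weight_op (OComp t a s)) = real (v + w) *\<^sub>R cls (OComp t a s)"
    using assms weight_op_wf[of t] weight_op_wf[of s]
    by (simp add: weight_op_comp pure_weight_def cls_comp_conv_qcomp qcomp_scale scaleR_add_left)
  moreover have "cls (ODiff (OComp t a s)) = 0 \<and> (qdeg (OComp t a s) \<noteq> 0 \<longrightarrow> cls (OComp t a s) = 0)"
    if "v + w = 0"
    using assms that
    by (auto simp: pure_weight_def cls_diff_comp cls_comp_conv_qcomp qcomp_zero)
  ultimately show ?thesis using assms(3) unfolding pure_weight_def by blast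
qed

lemma pure_weight_relabel:
  assumes "pure_weight w t" "inj_on f (tset t)"
  shows "pure_weight w (ORelabel f t)"
proof -
  have wf: "qwf t" and fin: "finite (tset t)" using assms finite_tset by (auto simp: pure_weight_def)
  have "cls (weight_op (ORelabel f t)) = cls (ORelabel f (weight_op t))" by (simp add: weight_op_def)
  also have "\<dots> = cls (ORelabel f (OScale (real w) t))"
    using assms weight_op_wf[OF wf] wf by (intro cls_relabel_cong) (auto simp: pure_weight_def cls_scale)
  finally have "cls (weight_op (ORelabel f t)) = real w *\<^sub>R cls (ORelabel f t)"
    using wf assms by (simp add: cls_lin)
  moreover have "cls (ORelabel f x) = 0" if "cls x = 0" "qwf x" "tset x = tset t" for x
  proof -
    have "cls (ORelabel f x) = cls (ORelabel f (OZero (tset t) (qdeg x)))"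
      using that assms fin by (intro cls_relabel_cong) (auto simp: cls_zero)
    then show ?thesis using assms fin by (simp add: cls_lin)
  qed
  ultimately show ?thesis
    using assms wf by (auto simp: pure_weight_def cls_diff_relabel)
qed

lemma pure_weight_scale: "pure_weight w t \<Longrightarrow> pure_weight w (OScale r t)"
  using weight_op_wf[of t] unfolding pure_weight_def by (auto simp: weight_op_def cls_lin)

lemma pure_weight_diff:
  assumes "pure_weight w t"
  shows "pure_weight w (ODiff t)"
proof -
  have wf: "qwf t" using assms by (simp add: pure_weight_def)
  have "cls (weight_op (ODiff t)) = cls (ODiff (weight_op t))"
    using wf weight_op_wf[OF wf] by (simp add: weight_op_def cls_lin ksgn_01 finite_tset)
  also have "\<dots> = cls (ODiff (OScale (real w) t))"
    using assms weight_op_wf[OF wf] wf by (intro cls_diff_cong) (auto simp: pure_weight_def cls_scale)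
  finally show ?thesis
    using assms wf by (auto simp: pure_weight_def cls_lin cls_diff_diff)
qed

lemma pure_weight_zero: "finite S \<Longrightarrow> pure_weight 0 (OZero S k)"
  by (simp add: pure_weight_def weight_op_def cls_lin)

text \<open>
Since \<open>1 \<circ> 1 = 1\<close>, the Leibniz rule gives \<open>d(1) = 2 d(1)\<close>.
\<close>

lemma cls_diff_unit: "cls (ODiff (OUnit a)) = 0"
proof -
  have "cls (OUnit a) = cls (OComp (OUnit a) a (OUnit a))"
    by (rule cls_eqI[OF opeq.sym[OF opeq.unit_left[where S = "{a}" and k = 0]]]) (simp add: typed_iff)
  then have "cls (ODiff (OUnit a)) = cls (ODiff (OComp (OUnit a) a (OUnit a)))"
    by (intro cls_diff_cong) auto
  also have "\<dots> = cls (OComp (ODiff (OUnit a)) a (OUnit a)) + cls (OComp (OUnit a) a (ODiff (OUnit a)))"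
    by (subst cls_diff_comp) (auto simp: ksgn_01)
  also have "cls (OComp (OUnit a) a (ODiff (OUnit a))) = cls (ODiff (OUnit a))"
    by (intro cls_eqI opeq.unit_left) (auto simp: typed_iff)
  also have "cls (OComp (ODiff (OUnit a)) a (OUnit a)) = cls (ORelabel (id(a := a)) (ODiff (OUnit a)))"
    by (intro cls_eqI opeq.unit_right) (auto simp: typed_iff)
  also have "ORelabel (id(a := a)) (ODiff (OUnit a)) = ORelabel id (ODiff (OUnit a :: bv_gen opterm))"
    by (simp add: fun_eq_iff)
  also have "cls \<dots> = cls (ODiff (OUnit a))"
    by (intro cls_eqI opeq.relabel_id) (auto simp: typed_iff)
  finally show ?thesis by simp
qed

lemma cls_diff_mu:
  assumes "finite S" "card S = 2"
  shows "cls (ODiff (OGen Mu S)) = 0"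
proof -
  from \<open>card S = 2\<close> obtain x y where S: "S = {x, y}" "x \<noteq> y" by (auto simp: card_2_iff)
  define f where "f i = (if i = 0 then x else y)" for i :: nat
  have f: "inj_on f {0, 1}" "f ` {0, 1} = S" using S by (auto simp: f_def)
  have "cls (OGen Mu S) = cls (ORelabel f (OGen Mu {0, 1}))"
    using f opeq.relabel_gen[of bvq_pres Mu "{0, 1}" 0 f] by (intro cls_eqI[OF opeq.sym]) (simp add: typed_iff)
  then have "cls (ODiff (OGen Mu S)) = cls (ODiff (ORelabel f (OGen Mu {0, 1})))"
    using f assms by (intro cls_diff_cong) auto
  also have "\<dots> = cls (ORelabel f (ODiff (OGen Mu {0, 1})))"
    using f by (intro cls_diff_relabel) auto
  also have "\<dots> = cls (ORelabel f (OZero {0, 1} 1))"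
    using f cls_rels(1) by (intro cls_relabel_cong) (auto simp: cls_zero)
  also have "\<dots> = 0" using f by (simp add: cls_lin)
  finally show ?thesis .
qed

lemma pure_weight_gen: "qwf (OGen g S) \<Longrightarrow> pure_weight (bv_weight g) (OGen g S)"
  by (cases g) (auto simp: pure_weight_def weight_op_def cls_lin cls_diff_mu)

text \<open>
Structural operations on expressions are linear, so a property of their values on homogeneous
expressions extends to sums. The predicate \<open>P\<close> carries the side condition on the type under which the
operation \<open>f\<close> is defined.
\<close>

lemma weights_upto_map:
  assumes "weights_upto m t" "P (tset t) (qdeg t)"
    and wf: "\<And>t. qwf t \<Longrightarrow> P (tset t) (qdeg t) \<Longrightarrow> qwf (f t)"
    and pure: "\<And>w t. w \<le> m \<Longrightarrow> pure_weight w t \<Longrightarrow> P (tset t) (qdeg t) \<Longrightarrow> weights_upto n (f t)"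
    and add: "\<And>t s. qwf (OAdd t s) \<Longrightarrow> P (tset t) (qdeg t) \<Longrightarrow> qeq (OAdd (f t) (f s)) (f (OAdd t s))"
    and eq: "\<And>t s. qeq t s \<Longrightarrow> P (tset t) (qdeg t) \<Longrightarrow> qeq (f t) (f s)"
  shows "weights_upto n (f t)"
  using assms(1,2)
proof (induction rule: weights_upto.induct)
  case (pure w t)
  then show ?case using assms(4) by blast
next
  case (sum t s)
  then have wf: "qwf (OAdd t s)" using weights_upto_wf by auto
  have "qeq (OAdd (f t) (f s)) (f (OAdd t s))" using sum add wf by simp
  moreover from this have "tset (f t) = tset (f s)" "qdeg (f t) = qdeg (f s)"
    using qeq_wf(1) by (metis wf_term_simps(6))+
  ultimately show ?case using sum by (auto intro!: weights_upto.intros(2) intro: weights_upto.eq)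
next
  case (eq t s)
  then show ?case using assms(6)[OF eq.hyps(2)] qeq_wf[OF eq.hyps(2)] weights_upto.eq by metis
qed

lemma qeq_iff_cls: "qwf t \<Longrightarrow> qwf s \<Longrightarrow> tset t = tset s \<Longrightarrow> qdeg t = qdeg s \<Longrightarrow> cls t = cls s \<Longrightarrow> qeq t s"
  by (simp add: cls_eq_iff)

lemma weights_upto_comp:
  assumes "weights_upto m t" "weights_upto n s" "qwf (OComp t a s)"
  shows "weights_upto (m + n) (OComp t a s)"
proof -
  have *: "weights_upto (m + w) (OComp t a s)"
    if "pure_weight w s" "weights_upto m t" "qwf (OComp t a s)" for w s t
  proof (rule weights_upto_map[where f = "\<lambda>t. OComp t a s" and P = "\<lambda>T k. a \<in> T \<and> (T - {a}) \<inter> tset s = {}"])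
    have s: "qwf s" using that by simp
    show "weights_upto m t" by fact
    show "a \<in> tset t \<and> (tset t - {a}) \<inter> tset s = {}" using that by simp
    fix t t' :: "bv_gen opterm" assume a: "a \<in> tset t \<and> (tset t - {a}) \<inter> tset s = {}"
    show "qwf (OComp t a s)" if "qwf t" using a that s by simp
    show "qeq (OAdd (OComp t a s) (OComp t' a s)) (OComp (OAdd t t') a s)" if "qwf (OAdd t t')"
      using a that s by (intro qeq_iff_cls) (simp_all add: cls_lin)
    show "qeq (OComp t a s) (OComp t' a s)" if "qeq t t'"
      using that a s qeq_wf(1)[OF that]
      by (intro opeq.comp_cong[OF that opeq.refl]) (auto simp: typed_iff)
    show "weights_upto (m + w) (OComp t a s)" if "v \<le> m" "pure_weight v t" for v
      using that \<open>pure_weight w s\<close> a s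
      by (intro weights_upto.pure[OF pure_weight_comp]) (auto simp: pure_weight_def)
  qed
  show ?thesis
  proof (rule weights_upto_map[where f = "\<lambda>s. OComp t a s" and P = "\<lambda>U k. a \<in> tset t \<and> (tset t - {a}) \<inter> U = {}"])
    have t: "qwf t" using assms by simp
    show "weights_upto n s" by fact
    show "a \<in> tset t \<and> (tset t - {a}) \<inter> tset s = {}" using assms by simp
    fix s s' :: "bv_gen opterm" assume a: "a \<in> tset t \<and> (tset t - {a}) \<inter> tset s = {}"
    show "qwf (OComp t a s)" if "qwf s" using a that t by simp
    show "qeq (OAdd (OComp t a s) (OComp t a s')) (OComp t a (OAdd s s'))" if "qwf (OAdd s s')"
      using a that t by (intro qeq_iff_cls) (simp_all add: cls_lin)
    show "qeq (OComp t a s) (OComp t a s')" if "qeq s s'"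
      using that a t qeq_wf(1)[OF that]
      by (intro opeq.comp_cong[OF opeq.refl that]) (auto simp: typed_iff)
    show "weights_upto (m + n) (OComp t a s)" if "v \<le> n" "pure_weight v s" for v
      using that assms(1) a t
      by (intro weights_upto_mono[OF *[of v s t]]) (auto simp: pure_weight_def)
  qed
qed

lemma weights_upto_exists: "qwf t \<Longrightarrow> \<exists>m. weights_upto m t"
proof (induction t)
  case (OGen g S)
  then show ?case using pure_weight_gen weights_upto.pure by blast
next
  case (OUnit a)
  have "pure_weight 0 (OUnit a)" by (simp add: pure_weight_def weight_op_def cls_lin cls_diff_unit)
  then show ?case using weights_upto.pure by blast
next
  case (OComp t a s)
  then show ?case using weights_upto_comp by (metis wf_term_simps(3))
next
  case (ORelabel f t)
  then obtain m where m: "weights_upto m t" by auto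
  have "weights_upto m (ORelabel f t)"
  proof (rule weights_upto_map[where f = "ORelabel f" and P = "\<lambda>T k. inj_on f T", OF m])
    show "inj_on f (tset t)" using ORelabel by simp
    fix t s :: "bv_gen opterm" assume a: "inj_on f (tset t)"
    show "weights_upto m (ORelabel f t)" if "w \<le> m" "pure_weight w t" for w
      using that a weights_upto.pure[OF pure_weight_relabel] by blast
    show "qeq (OAdd (ORelabel f t) (ORelabel f s)) (ORelabel f (OAdd t s))" if "qwf (OAdd t s)"
      using a that by (intro qeq_iff_cls) (simp_all add: cls_lin)
    show "qeq (ORelabel f t) (ORelabel f s)" if "qeq t s"
      using that a qeq_wf(1)[OF that] by (intro opeq.relabel_cong) (auto simp: typed_iff)
  qed simp
  then show ?case ..
next
  case (OZero S k)
  then show ?case using weights_upto.pure[OF pure_weight_zero] by fastforce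
next
  case (OAdd t s)
  then obtain m n where "weights_upto m t" "weights_upto n s" by auto
  then have "weights_upto (max m n) (OAdd t s)"
    using OAdd.prems by (intro weights_upto.sum) (auto intro: weights_upto_mono)
  then show ?case ..
next
  case (OScale r t)
  then obtain m where m: "weights_upto m t" by auto
  have "weights_upto m (OScale r t)"
  proof (rule weights_upto_map[where f = "OScale r" and P = "\<lambda>T k. True", OF m])
    fix t s :: "bv_gen opterm"
    show "weights_upto m (OScale r t)" if "w \<le> m" "pure_weight w t" for w
      using that weights_upto.pure[OF pure_weight_scale] by blast
    show "qeq (OAdd (OScale r t) (OScale r s)) (OScale r (OAdd t s))" if "qwf (OAdd t s)"
      using that by (intro qeq_iff_cls) (simp_all add: cls_lin scaleR_add_right)
  qed (auto intro: opeq.scale_cong)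
  then show ?case ..
next
  case (ODiff t)
  then obtain m where m: "weights_upto m t" by auto
  have "weights_upto m (ODiff t)"
  proof (rule weights_upto_map[where f = ODiff and P = "\<lambda>T k. True", OF m])
    fix t s :: "bv_gen opterm"
    show "weights_upto m (ODiff t)" if "w \<le> m" "pure_weight w t" for w
      using that weights_upto.pure[OF pure_weight_diff] by blast
    show "qeq (OAdd (ODiff t) (ODiff s)) (ODiff (OAdd t s))" if "qwf (OAdd t s)"
      using that by (intro qeq_iff_cls) (simp_all add: cls_lin)
  qed (auto intro: opeq.diff_cong)
  then show ?case ..
qed

text \<open>
The operator \<open>W - (m + 1)\<close> acts on weight \<open>w\<close> as \<open>w - (m + 1)\<close>, hence it removes the top weight.
\<close>

lemma weights_upto_Suc:
  assumes "weights_upto (Suc m) t"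
  shows "weights_upto m (OAdd (weight_op t) (OScale (- real (Suc m)) t))"
proof (rule weights_upto_map[where f = "\<lambda>t. OAdd (weight_op t) (OScale (- real (Suc m)) t)" and P = "\<lambda>T k. True", OF assms])
  fix t s :: "bv_gen opterm"
  show "qwf (OAdd (weight_op t) (OScale (- real (Suc m)) t))" if "qwf t"
    using that weight_op_wf[of t] by simp
  show "weights_upto m (OAdd (weight_op t) (OScale (- real (Suc m)) t))" if "w \<le> Suc m" "pure_weight w t" for w
  proof -
    have wf: "qwf t" using that by (simp add: pure_weight_def)
    let ?c = "real w - real (Suc m)"
    have "qeq (OScale ?c t) (OAdd (weight_op t) (OScale (- real (Suc m)) t))"
      using weight_op_wf[OF wf] that wf
      by (intro qeq_iff_cls) (simp_all add: cls_lin pure_weight_def algebra_simps)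
    moreover have "weights_upto m (OScale ?c t)"
    proof (cases "w = Suc m")
      case True
      then have "qeq (OZero (tset t) (qdeg t)) (OScale ?c t)"
        using wf by (intro qeq_iff_cls) (simp_all add: cls_lin finite_tset)
      then show ?thesis
        using weights_upto.pure[OF pure_weight_zero] finite_tset[OF wf] weights_upto.eq by blast
    next
      case False
      then show ?thesis using that by (intro weights_upto.pure[OF pure_weight_scale]) auto
    qed
    ultimately show ?thesis using weights_upto.eq by blast
  qed
  show "qeq (OAdd (OAdd (weight_op t) (OScale (- real (Suc m)) t)) (OAdd (weight_op s) (OScale (- real (Suc m)) s)))
      (OAdd (weight_op (OAdd t s)) (OScale (- real (Suc m)) (OAdd t s)))" if "qwf (OAdd t s)"
  proof -
    have "weight_op (OAdd t s) = OAdd (weight_op t) (weight_op s)" by (simp add: weight_op_def)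
    then show ?thesis using that weight_op_wf[of t] weight_op_wf[of s]
      by (intro qeq_iff_cls) (simp_all add: cls_lin algebra_simps)
  qed
  show "qeq (OAdd (weight_op t) (OScale (- real (Suc m)) t)) (OAdd (weight_op s) (OScale (- real (Suc m)) s))"
    if "qeq t s"
    using weight_op_wf[of t] weight_op_wf[of s] qeq_wf[OF that] weight_op_respects[OF that] cls_eqI[OF that]
    by (intro qeq_iff_cls) (simp_all add: cls_lin)
qed simp

lemma weights_upto_0:
  assumes "weights_upto 0 t"
  shows "qdeg t \<noteq> 0 \<Longrightarrow> cls t = 0"
  using assms
proof (induction rule: weights_upto.induct)
  case (sum t s)
  then show ?case using weights_upto_wf by (simp add: cls_lin)
next
  case (eq t s)
  then show ?case using cls_eqI[OF eq.hyps(2)] qeq_wf[OF eq.hyps(2)] by simp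
qed (simp add: pure_weight_def)

text \<open>
Induction on the largest weight \<open>m + 1\<close> of \<open>t\<close>. The cocycle \<open>W t - (m + 1) t\<close> has smaller weights and is
exact by induction, and \<open>W t = d h t\<close> because \<open>t\<close> is closed. Hence \<open>(m + 1) t\<close> is exact. At the bottom,
weight 0 vanishes in nonzero degree.
\<close>

lemma closed_imp_exact:
  assumes "weights_upto m t" "cls (ODiff t) = 0" "qdeg t \<noteq> 0"
  shows "\<exists>u. qwf u \<and> tset u = tset t \<and> qdeg u = qdeg t - 1 \<and> cls t = cls (ODiff u)"
  using assms
proof (induction m arbitrary: t)
  case 0
  have "qwf t" using 0 weights_upto_wf by blast
  then show ?case
    using weights_upto_0[OF 0(1)] 0(3) finite_tset[of bvq_pres t]
    by (intro exI[of _ "OZero (tset t) (qdeg t - 1)"]) (simp add: cls_lin)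
next
  case (Suc m)
  have wf: "qwf t" using Suc weights_upto_wf by blast
  note wW = weight_op_wf[OF wf] and wh = homotopy_op_wf[OF wf]
  have fin: "finite (tset t)" using wf by (rule finite_tset)
  have dt: "qeq (ODiff t) (OZero (tset t) (qdeg t + 1))"
    using wf fin Suc.prems by (intro qeq_iff_cls) (simp_all add: cls_zero)
  have "cls (homotopy_op (ODiff t)) = 0"
    using homotopy_op_respects[OF weight_op_derivation dt] by (simp add: homotopy_op_def cls_zero)
  then have W: "cls (weight_op t) = cls (ODiff (homotopy_op t))"
    using homotopy_formula[OF wf] by simp
  let ?t = "OAdd (weight_op t) (OScale (- real (Suc m)) t)"
  have "cls (weight_op (ODiff t)) = cls (ODiff (weight_op t))"
    using wf wW fin by (simp add: weight_op_def cls_lin ksgn_01)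
  then have "cls (ODiff (weight_op t)) = 0"
    using weight_op_respects[OF dt] by (simp add: weight_op_def cls_zero)
  then have "cls (ODiff ?t) = 0"
    using wf wW Suc.prems by (simp add: cls_lin)
  moreover have "weights_upto m ?t" using Suc.prems weights_upto_Suc by blast
  moreover have "qdeg ?t \<noteq> 0" using wW Suc.prems by simp
  ultimately obtain u where u: "qwf u" "tset u = tset t" "qdeg u = qdeg t - 1" "cls ?t = cls (ODiff u)"
    using Suc.IH[of ?t] wW by auto
  let ?u = "OScale (1 / real (Suc m)) (OAdd (homotopy_op t) (OScale (- 1) u))"
  have "cls (ODiff ?u) = (1 / real (Suc m)) *\<^sub>R (cls (ODiff (homotopy_op t)) - cls (ODiff u))"
    using u wh by (simp add: cls_lin)
  also have "\<dots> = (1 / real (Suc m)) *\<^sub>R (real (Suc m) *\<^sub>R cls t)"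
    using u(4) W wf wW by (simp add: cls_lin algebra_simps)
  also have "\<dots> = cls t" by (simp del: of_nat_Suc)
  finally show ?case using u wh by (intro exI[of _ ?u]) simp
qed

theorem qeq_closed_imp_exact:
  assumes "typed bvq_pres t S k" "qeq (ODiff t) (OZero S (k + 1))" "k \<noteq> 0"
  shows "\<exists>u. typed bvq_pres u S (k - 1) \<and> qeq t (ODiff u)"
proof -
  have t: "qwf t" "tset t = S" "qdeg t = k" using assms by (auto simp: typed_iff)
  obtain m where "weights_upto m t" using weights_upto_exists t by blast
  then obtain u where "qwf u" "tset u = S" "qdeg u = k - 1" "cls t = cls (ODiff u)"
    using closed_imp_exact[of m t] cls_eqI[OF assms(2)] t assms(3) by (auto simp: cls_zero)
  then show ?thesis using t by (auto simp: typed_iff cls_eq_iff)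
qed

section \<open>The quotient map\<close>

lemma bv_nested_wf:
  assumes "qs \<noteq> []" "\<forall>q\<in>set qs. 1 \<le> q"
  shows "qwf (bv_nested qs) \<and> tset (bv_nested qs) = {0} \<and> qdeg (bv_nested qs) = 1 - 2 * int (sum_list qs)"
  using assms by (induction qs rule: bv_nested.induct) (auto simp: obracket_def)

lemma cls_diff_phi: "1 \<le> n \<Longrightarrow> cls (ODiff (bv_phi n)) = (if n = 1 then - cls bv_delta else 0)"
proof (cases "n = 1")
  case False
  assume "1 \<le> n"
  then have "cls (ODiff (bv_phi n)) = cls (ODiff (OZero {0} (- 2 * int n)))"
    using False cls_rels(9)[of n] by (intro cls_diff_cong) (auto simp: cls_zero)
  then show ?thesis using False by (simp add: cls_lin)
qed (use cls_rels(6) in simp)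

text \<open>
The innermost bracket \<open>[\<phi>\<^sub>q, d\<phi>\<^sub>r]\<close> vanishes in Q: one of its entries is 0 unless \<open>q = r = 1\<close>, and
then it is \<open>-[\<phi>\<^sub>1, \<Delta>]\<close>.
\<close>

lemma bv_nested_zero:
  assumes "2 \<le> length qs" "\<forall>q\<in>set qs. 1 \<le> q"
  shows "cls (bv_nested qs) = 0"
  using assms
proof (induction qs rule: bv_nested.induct)
  case (3 q r rs)
  note wf = bv_nested_wf[of "r # rs"]
  have *: "cls (obracket k l (bv_phi q) s) = 0" if "qwf s" "tset s = {0}" "cls s = 0 \<or> cls (bv_phi q) = 0"
      "k = - 2 * int q" for k l s
  proof -
    have "1 \<le> q" using 3(3) by simp
    then show ?thesis
      using that(3) by (elim disjE) (simp_all add: that(1,2) obracket_def cls_add cls_scale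
          cls_comp_conv_qcomp qcomp_zero)
  qed
  show ?case
  proof (cases "rs = []")
    case True
    show ?thesis
    proof (cases "q = 1 \<and> r = 1")
      case False
      then show ?thesis using True 3(3) cls_diff_phi[of r] cls_rels(9)[of q] by (auto intro!: *)
    next
      case True
      then show ?thesis using \<open>rs = []\<close> cls_rels(8) cls_diff_phi[of 1]
        by (simp add: obracket_def cls_lin cls_comp_conv_qcomp qcomp_uminus ksgn_01)
    qed
  next
    case False
    then have "cls (bv_nested (r # rs)) = 0" using 3 by (cases rs) auto
    then show ?thesis using wf 3(3) by (auto intro!: *)
  qed
qed auto

lemma foldr_zero:
  assumes "finite S" "\<And>a. a \<in> set xs \<Longrightarrow> qwf (F a) \<and> tset (F a) = S \<and> qdeg (F a) = k \<and> cls (F a) = 0"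
  shows "let t = foldr (\<lambda>a. OAdd (F a)) xs (OZero S k) in qwf t \<and> tset t = S \<and> qdeg t = k \<and> cls t = 0"
  using assms by (induction xs) (auto simp: Let_def cls_lin)

lemma set_enum_of: "finite A \<Longrightarrow> set (enum_of A) = A"
  unfolding enum_of_def using finite_distinct_list[of A] by (metis (mono_tags, lifting) someI_ex)

lemma osum_zero:
  assumes "finite S" "finite A"
    "\<And>a. a \<in> A \<Longrightarrow> qwf (F a) \<and> tset (F a) = S \<and> qdeg (F a) = k \<and> cls (F a) = 0"
  shows "qwf (osum S k F A) \<and> tset (osum S k F A) = S \<and> qdeg (osum S k F A) = k \<and> cls (osum S k F A) = 0"
  using foldr_zero[OF assms(1), of "enum_of A" F k] assms(2,3)
  by (simp add: osum_def set_enum_of Let_def)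

lemma bv_phi_lhs_zero:
  assumes "2 \<le> n"
  shows "qeq (bv_phi_lhs n) (OZero {0} (1 - 2 * int n))"
proof -
  have fin: "finite {qs. length qs = p \<and> sum_list qs = n \<and> (\<forall>q\<in>set qs. 1 \<le> q)}" for p :: nat
    by (rule finite_subset[of _ "{qs. set qs \<subseteq> {..n} \<and> length qs = p}"])
      (auto simp: finite_lists_length_eq dest: member_le_sum_list)
  let ?I = "\<lambda>p. osum {0} (1 - 2 * int n) bv_nested {qs. length qs = p \<and> sum_list qs = n \<and> (\<forall>q\<in>set qs. 1 \<le> q)}"
  have I: "qwf (?I p) \<and> tset (?I p) = {0} \<and> qdeg (?I p) = 1 - 2 * int n \<and> cls (?I p) = 0" if "2 \<le> p" for p
  proof (rule osum_zero[OF _ fin])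
    fix qs assume qs: "qs \<in> {qs. length qs = p \<and> sum_list qs = n \<and> (\<forall>q\<in>set qs. 1 \<le> q)}"
    then show "qwf (bv_nested qs) \<and> tset (bv_nested qs) = {0} \<and> qdeg (bv_nested qs) = 1 - 2 * int n \<and> cls (bv_nested qs) = 0"
      using that bv_nested_wf[of qs] bv_nested_zero[of qs] by (cases "qs = []") auto
  qed simp
  let ?J = "osum {0} (1 - 2 * int n) (\<lambda>p. OScale (1 / fact p) (?I p)) {2..n}"
  have J: "qwf ?J \<and> tset ?J = {0} \<and> qdeg ?J = 1 - 2 * int n \<and> cls ?J = 0"
    by (rule osum_zero) (use I in \<open>auto simp: cls_scale\<close>)
  have "cls (ODiff (bv_phi n)) = 0" using cls_diff_phi[of n] assms by simp
  then show ?thesis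
    using J assms unfolding bv_phi_lhs_def by (intro qeq_iff_cls) (simp_all add: cls_lin)
qed

lemma bvq_sig_eq: "gens bv_pres = gens bvq_pres" "arity bv_pres = arity bvq_pres" "degr bv_pres = degr bvq_pres"
  by (simp_all add: bvq_pres_def)

lemma opeq_bv_imp_qeq: "opeq bv_pres t s \<Longrightarrow> qeq t s"
proof (rule opeq_mono[OF bvq_sig_eq])
  fix t s assume "(t, s) \<in> rels bv_pres"
  then have "(t, s) \<in> rels bvq_pres \<or> (\<exists>n\<ge>2. t = bv_phi_lhs n \<and> s = OZero {0} (1 - 2 * int n))"
    unfolding rels_bvq bv_pres_def presentation.select_convs by blast
  then show "qeq t s" using bv_phi_lhs_zero opeq.rel by blast
qed

section \<open>Interpretations of presented operads\<close>

lemma opclass_eqI: "opeq P t s \<Longrightarrow> opclass P t = opclass P s"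
  unfolding opclass_def by (auto intro: opeq.trans opeq.sym)

lemma opclass_refl: "typed P t S k \<Longrightarrow> t \<in> opclass P t"
  unfolding opclass_def by (auto intro: opeq.refl)

lemma opclass_UN:
  assumes "t \<in> opclass P t" "\<And>t'. opeq P t t' \<Longrightarrow> opclass P (F t') = C"
  shows "(\<Union>t'\<in>opclass P t. opclass P (F t')) = C"
  using assms unfolding opclass_def by auto

lemma opclass_UN2:
  assumes "t \<in> opclass P t" "s \<in> opclass P s"
    "\<And>t' s'. opeq P t t' \<Longrightarrow> opeq P s s' \<Longrightarrow> opclass P (F t' s') = C"
  shows "(\<Union>t'\<in>opclass P t. \<Union>s'\<in>opclass P s. opclass P (F t' s')) = C"
  using assms unfolding opclass_def by auto

lemma presented_add:
  assumes "typed P t S k" "typed P s S k"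
  shows "cadd (cpx (presented_operad P) S) (opclass P t) (opclass P s) = opclass P (OAdd t s)"
  unfolding presented_operad_def dg_operad.select_convs cochain.select_convs
  by (rule opclass_UN2)
    (use assms in \<open>auto intro: opclass_refl intro!: opclass_eqI[OF opeq.sym] opeq.add_cong\<close>)

lemma presented_scale:
  assumes "typed P t S k"
  shows "cscl (cpx (presented_operad P) S) r (opclass P t) = opclass P (OScale r t)"
  unfolding presented_operad_def dg_operad.select_convs cochain.select_convs
  by (rule opclass_UN)
    (use assms in \<open>auto intro: opclass_refl intro!: opclass_eqI[OF opeq.sym] opeq.scale_cong\<close>)

lemma presented_diff:
  assumes "typed P t S k"
  shows "cdif (cpx (presented_operad P) S) k (opclass P t) = opclass P (ODiff t)"
  unfolding presented_operad_def dg_operad.select_convs cochain.select_convs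
  by (rule opclass_UN)
    (use assms in \<open>auto intro: opclass_refl intro!: opclass_eqI[OF opeq.sym] opeq.diff_cong\<close>)

lemma presented_relabel:
  assumes "typed P t S k" "inj_on f S"
  shows "orelabel (presented_operad P) f S k (opclass P t) = opclass P (ORelabel f t)"
  unfolding presented_operad_def dg_operad.select_convs
  by (rule opclass_UN)
    (use assms in \<open>auto intro: opclass_refl intro!: opclass_eqI[OF opeq.sym] opeq.relabel_cong\<close>)

lemma presented_comp:
  assumes "typed P t S k" "typed P s U l" "a \<in> S" "(S - {a}) \<inter> U = {}"
  shows "ocomp (presented_operad P) S k a U l (opclass P t) (opclass P s) = opclass P (OComp t a s)"
  unfolding presented_operad_def dg_operad.select_convs
  by (rule opclass_UN2)
    (use assms in \<open>auto intro: opclass_refl intro!: opclass_eqI[OF opeq.sym] opeq.comp_cong\<close>)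

lemma opeq_scale_zero:
  assumes "typed P t S k"
  shows "opeq P (OZero S k) (OScale 0 t)"
proof -
  have t: "typed P (OScale 0 t) S k" "typed P (OScale (- 1) (OScale 0 t)) S k"
    using assms by (auto intro: typed.intros)
  have "opeq P (OZero S k) (OAdd (OScale 0 t) (OScale (- 1) (OScale 0 t)))"
    by (rule opeq.sym[OF opeq.add_neg[OF t(1)]])
  moreover have "opeq P (OAdd (OScale 0 t) (OScale (- 1) (OScale 0 t))) (OAdd (OScale 0 t) (OScale 0 t))"
    using opeq.add_cong[OF opeq.refl[OF t(1)] opeq.scale_scale[OF assms, of "- 1" 0] t] by simp
  moreover have "opeq P (OAdd (OScale 0 t) (OScale 0 t)) (OScale 0 t)"
    using opeq.sym[OF opeq.scale_add_left[OF assms, of 0 0]] by simp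
  ultimately show ?thesis by (blast intro: opeq.trans)
qed

locale operad_hom_on_presented =
  fixes P :: "'g presentation" and Q :: "'b dg_operad"
    and h :: "nat set \<Rightarrow> int \<Rightarrow> 'g opterm set \<Rightarrow> 'b"
  assumes hom: "dg_operad_hom (presented_operad P) Q h"
begin

definition sem :: "nat set \<Rightarrow> int \<Rightarrow> 'g opterm \<Rightarrow> 'b" where
  "sem S k t = h S k (opclass P t)"

lemma sem_cong: "opeq P t s \<Longrightarrow> sem S k t = sem S k s"
  unfolding sem_def by (simp add: opclass_eqI)

lemma presented_spc: "typed P t S k \<Longrightarrow> opclass P t \<in> spc (cpx (presented_operad P) S) k"
  by (simp add: presented_operad_def)

lemma hom_unary:
  assumes "x \<in> spc (cpx (presented_operad P) S) k"
  shows "h S k x \<in> spc (cpx Q S) k"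
    "y \<in> spc (cpx (presented_operad P) S) k \<Longrightarrow>
      h S k (cadd (cpx (presented_operad P) S) x y) = cadd (cpx Q S) (h S k x) (h S k y)"
    "h S k (cscl (cpx (presented_operad P) S) r x) = cscl (cpx Q S) r (h S k x)"
    "h S (k + 1) (cdif (cpx (presented_operad P) S) k x) = cdif (cpx Q S) k (h S k x)"
    "inj_on f S \<Longrightarrow> h (f ` S) k (orelabel (presented_operad P) f S k x) = orelabel Q f S k (h S k x)"
  using hom[unfolded dg_operad_hom_def, THEN conjunct1, rule_format, OF assms] by auto

lemma sem_spc: "typed P t S k \<Longrightarrow> sem S k t \<in> spc (cpx Q S) k"
  unfolding sem_def by (rule hom_unary(1)[OF presented_spc])

lemma sem_add:
  assumes "typed P t S k" "typed P s S k"
  shows "sem S k (OAdd t s) = cadd (cpx Q S) (sem S k t) (sem S k s)"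
  using presented_add[OF assms]
  unfolding sem_def using hom_unary(2)[OF presented_spc presented_spc, OF assms] by simp

lemma sem_scale:
  assumes "typed P t S k"
  shows "sem S k (OScale r t) = cscl (cpx Q S) r (sem S k t)"
  using presented_scale[OF assms, of r]
  unfolding sem_def using hom_unary(3)[OF presented_spc, OF assms, of r] by simp

lemma sem_diff:
  assumes "typed P t S k"
  shows "sem S (k + 1) (ODiff t) = cdif (cpx Q S) k (sem S k t)"
  using presented_diff[OF assms]
  unfolding sem_def using hom_unary(4)[OF presented_spc, OF assms] by simp

lemma sem_relabel:
  assumes "typed P t S k" "inj_on f S"
  shows "sem (f ` S) k (ORelabel f t) = orelabel Q f S k (sem S k t)"
  using presented_relabel[OF assms]
  unfolding sem_def using hom_unary(5)[OF presented_spc, OF assms] by simp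

lemma sem_comp:
  assumes "typed P t S k" "typed P s U l" "a \<in> S" "(S - {a}) \<inter> U = {}"
  shows "sem ((S - {a}) \<union> U) (k + l) (OComp t a s) = ocomp Q S k a U l (sem S k t) (sem U l s)"
proof -
  have "h ((S - {a}) \<union> U) (k + l) (ocomp (presented_operad P) S k a U l (opclass P t) (opclass P s))
    = ocomp Q S k a U l (h S k (opclass P t)) (h U l (opclass P s))"
    using hom[unfolded dg_operad_hom_def, THEN conjunct2, THEN conjunct2, rule_format,
        OF presented_spc[OF assms(1)] presented_spc[OF assms(2)]] assms(3,4) by blast
  then show ?thesis unfolding sem_def presented_comp[OF assms] .
qed

lemma sem_unit: "sem {a} 0 (OUnit a) = ounit Q a"
  using hom unfolding dg_operad_hom_def sem_def by (simp add: presented_operad_def)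

lemma sem_zero: "typed P t S k \<Longrightarrow> sem S k (OZero S k) = cscl (cpx Q S) 0 (sem S k t)"
  using sem_cong[OF opeq_scale_zero] sem_scale by simp

text \<open>
An interpretation of \<open>P\<close> respects a second presentation \<open>P'\<close> on the same generators as soon as it
respects the relations of \<open>P'\<close>: the kernel of a morphism out of \<open>P\<close> is a congruence that already
contains all instances of the operad axioms.
\<close>

lemma sem_congruence:
  assumes sig: "gens P' = gens P" "arity P' = arity P" "degr P' = degr P"
    and wf: "\<And>t s. (t, s) \<in> rels P' \<Longrightarrow>
      wf_term P' t \<and> wf_term P' s \<and> tset t = tset s \<and> tdeg P' t = tdeg P' s"
    and rels: "\<And>t s. (t, s) \<in> rels P' \<Longrightarrow> sem (tset t) (tdeg P' t) t = sem (tset t) (tdeg P' t) s"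
    and "opeq P' t s" "typed P' t S k"
  shows "sem S k t = sem S k s"
proof -
  note ty = typed_cong[OF sig]
  have tr: "typed P s S k" if "opeq P' t s" "typed P t S k" for t s S k
    using opeq_wf[OF wf that(1)] that(2) unfolding ty[symmetric] by (simp add: typed_iff)
  have tr': "typed P t S k" if "opeq P' t s" "typed P s S k" for t s S k
    using opeq_wf[OF wf that(1)] that(2) unfolding ty[symmetric] by (simp add: typed_iff)
  have "typed P t S k \<Longrightarrow> sem S k t = sem S k s"
    using \<open>opeq P' t s\<close>
  proof (induction arbitrary: S k rule: opeq.induct)
    case (rel t s)
    then show ?case using rels[of t s] unfolding ty[symmetric] by (auto simp: typed_iff)
  next
    case (refl t S k)
    show ?case ..
  next
    case (sym t s)
    then show ?case using tr[OF sym.hyps] tr'[OF sym.hyps] by metis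
  next
    case (trans t s u)
    then show ?case using tr by metis
  next
    case (comp_cong t t' s s' S k U l a T m)
    have tt: "typed P t S k" "typed P t' S k" "typed P s U l" "typed P s' U l"
      using comp_cong.hyps tr unfolding ty by blast+
    have "T = (S - {a}) \<union> U" "m = k + l"
      using comp_cong.prems comp_cong.hyps typed_unique[OF comp_cong.prems] typed_unique[OF tt(1)] typed_unique[OF tt(3)] by auto
    then show ?case
      using sem_comp[OF tt(1,3)] sem_comp[OF tt(2,4)] comp_cong.IH(1)[OF tt(1)] comp_cong.IH(2)[OF tt(3)] comp_cong.hyps
      by simp
  next
    case (relabel_cong t t' S k f T m)
    have tt: "typed P t S k" "typed P t' S k"
      using relabel_cong.hyps tr unfolding ty by blast+
    have "T = f ` S" "m = k"
      using typed_unique[OF relabel_cong.prems] typed_unique[OF tt(1)] by auto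
    then show ?case
      using sem_relabel[OF tt(1)] sem_relabel[OF tt(2)] relabel_cong.IH[OF tt(1)] relabel_cong.hyps by simp
  next
    case (add_cong t t' s s' S k T m)
    have tt: "typed P t S k" "typed P t' S k" "typed P s S k" "typed P s' S k"
      using add_cong.hyps tr unfolding ty by blast+
    have "T = S" "m = k"
      using typed_unique[OF add_cong.prems] typed_unique[OF tt(1)] by auto
    then show ?case
      using sem_add[OF tt(1,3)] sem_add[OF tt(2,4)] add_cong.IH(1)[OF tt(1)] add_cong.IH(2)[OF tt(3)] by simp
  next
    case (scale_cong t t' r S k)
    have tt: "typed P t S k" using scale_cong.prems by (simp add: typed_iff)
    then show ?case
      using sem_scale[OF tt] sem_scale[OF tr[OF scale_cong.hyps tt]] scale_cong.IH[OF tt] by simp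
  next
    case (diff_cong t t' S k)
    have tt: "typed P t S (k - 1)" using diff_cong.prems by (auto simp: typed_iff)
    then show ?case
      using sem_diff[OF tt] sem_diff[OF tr[OF diff_cong.hyps tt]] diff_cong.IH[OF tt] by simp
  next
    case relabel_ext
    then show ?case unfolding ty by (intro sem_cong opeq.relabel_ext)
  next
    case relabel_comp
    then show ?case unfolding ty by (intro sem_cong opeq.relabel_comp)
  qed (unfold ty, (rule sem_cong, rule opeq.intros(10-38); assumption)+)
  then show ?thesis using \<open>typed P' t S k\<close> unfolding ty by simp
qed

end

section \<open>Smooth functions\<close>

lemma Euclidean_space_top_of_set: "Euclidean_space n = top_of_set {x. \<forall>i\<ge>n. x i = 0}"
  by (simp add: Euclidean_space_def euclidean_product_topology)

lemma continuous_map_Euclidean_sub: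
  assumes "openin (Euclidean_space n) U"
  shows "continuous_map (subtopology (Euclidean_space n) U) euclideanreal g \<longleftrightarrow> continuous_on U g"
proof -
  have "U \<subseteq> {x. \<forall>i\<ge>n. x i = 0}" using openin_subset[OF assms] by (simp add: topspace_Euclidean_space)
  then have "subtopology (Euclidean_space n) U = top_of_set U"
    by (simp add: Euclidean_space_top_of_set subtopology_subtopology Int_absorb1)
  then show ?thesis by simp
qed

lemma eventually_update_in:
  assumes "openin (Euclidean_space n) U" "x \<in> U" "i < n"
  shows "eventually (\<lambda>t. x(i := t) \<in> U) (nhds (x i))"
proof -
  obtain T where T: "open T" "U = {x. \<forall>i\<ge>n. x i = 0} \<inter> T"
    using assms(1) by (auto simp: Euclidean_space_top_of_set openin_open)
  have "continuous_on UNIV (\<lambda>t. x(i := t))"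
  proof (rule continuous_on_coordinatewise_then_product)
    show "continuous_on UNIV (\<lambda>t. (x(i := t)) k)" for k
      by (cases "k = i") (auto intro: continuous_intros)
  qed
  then have "open ((\<lambda>t. x(i := t)) -` T)" using T(1) by (simp add: open_vimage)
  moreover have "x i \<in> (\<lambda>t. x(i := t)) -` T" using assms T by auto
  ultimately have "eventually (\<lambda>t. t \<in> (\<lambda>t. x(i := t)) -` T) (nhds (x i))"
    by (rule eventually_nhds_in_open)
  then show ?thesis
    by (rule eventually_mono) (use assms(2,3) T(2) in auto)
qed

lemma pderiv_at_cong:
  assumes "openin (Euclidean_space n) U" "x \<in> U" "i < n" "\<And>y. y \<in> U \<Longrightarrow> f y = g y"
  shows "pderiv_at i f x = pderiv_at i g x"
  unfolding pderiv_at_def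
  by (rule deriv_cong_ev[OF eventually_mono[OF eventually_update_in[OF assms(1-3)]]]) (auto simp: assms(4))

lemma differentiable_cong_ev:
  fixes f g :: "real \<Rightarrow> real"
  assumes "eventually (\<lambda>t. f t = g t) (nhds a)" "f differentiable (at a)"
  shows "g differentiable (at a)"
  using assms(2) DERIV_cong_ev[OF HOL.refl assms(1) HOL.refl] by (auto simp: real_differentiable_def)

lemma smooth_fun_continuous:
  assumes "openin (Euclidean_space n) U" "smooth_fun n U f" "set I \<subseteq> {..<n}"
  shows "continuous_on U (foldr pderiv_at I f)"
  using assms continuous_map_Euclidean_sub[OF assms(1)] by (auto simp: smooth_fun_def)

lemma smooth_fun_deriv:
  assumes "smooth_fun n U f" "set I \<subseteq> {..<n}" "x \<in> U" "i < n"
  shows "((\<lambda>t. foldr pderiv_at I f (x(i := t))) has_real_derivative foldr pderiv_at (i # I) f x) (at (x i))"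
proof -
  have "(\<lambda>t. foldr pderiv_at I f (x(i := t))) differentiable (at (x i))"
    using assms by (auto simp: smooth_fun_def)
  then show ?thesis by (simp add: pderiv_at_def DERIV_deriv_iff_real_differentiable)
qed

lemma smooth_fun_pderiv: "smooth_fun n U f \<Longrightarrow> i < n \<Longrightarrow> smooth_fun n U (pderiv_at i f)"
  unfolding smooth_fun_def
proof (intro allI impI)
  fix I assume *: "\<forall>I. set I \<subseteq> {..<n} \<longrightarrow> continuous_map (subtopology (Euclidean_space n) U) euclideanreal (foldr pderiv_at I f) \<and>
     (\<forall>x\<in>U. \<forall>i<n. (\<lambda>t. foldr pderiv_at I f (x(i := t))) differentiable at (x i))" "i < n" "set I \<subseteq> {..<n}"
  have e: "foldr pderiv_at (I @ [i]) f = foldr pderiv_at I (pderiv_at i f)" by simp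
  show "continuous_map (subtopology (Euclidean_space n) U) euclideanreal (foldr pderiv_at I (pderiv_at i f)) \<and>
     (\<forall>x\<in>U. \<forall>ia<n. (\<lambda>t. foldr pderiv_at I (pderiv_at i f) (x(ia := t))) differentiable at (x ia))"
    using *(1)[rule_format, of "I @ [i]"] *(2,3) unfolding e by auto
qed

lemma foldr_pderiv_lin:
  assumes U: "openin (Euclidean_space n) U" and f: "smooth_fun n U f" and g: "smooth_fun n U g"
  shows "set I \<subseteq> {..<n} \<Longrightarrow> x \<in> U \<Longrightarrow>
    foldr pderiv_at I (\<lambda>y. a * f y + b * g y) x = a * foldr pderiv_at I f x + b * foldr pderiv_at I g x"
proof (induction I arbitrary: x)
  case (Cons i I)
  let ?F = "foldr pderiv_at I f" and ?G = "foldr pderiv_at I g"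
  have i: "i < n" and I: "set I \<subseteq> {..<n}" using Cons.prems by auto
  have "foldr pderiv_at (i # I) (\<lambda>y. a * f y + b * g y) x = pderiv_at i (\<lambda>y. a * ?F y + b * ?G y) x"
    unfolding foldr_Cons o_def by (rule pderiv_at_cong[OF U Cons.prems(2) i]) (rule Cons.IH[OF I])
  also have "\<dots> = a * foldr pderiv_at (i # I) f x + b * foldr pderiv_at (i # I) g x"
    unfolding pderiv_at_def[of i "\<lambda>y. a * ?F y + b * ?G y"]
    using DERIV_add[OF DERIV_cmult[OF smooth_fun_deriv[OF f I Cons.prems(2) i]]
        DERIV_cmult[OF smooth_fun_deriv[OF g I Cons.prems(2) i]]]
    by (rule DERIV_imp_deriv)
  finally show ?case .
qed simp

lemma smooth_fun_lin:
  assumes U: "openin (Euclidean_space n) U" and f: "smooth_fun n U f" and g: "smooth_fun n U g"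
  shows "smooth_fun n U (\<lambda>y. a * f y + b * g y)"
  unfolding smooth_fun_def continuous_map_Euclidean_sub[OF U]
proof (intro allI impI conjI ballI)
  fix I assume I: "set I \<subseteq> {..<n}"
  let ?F = "foldr pderiv_at I f" and ?G = "foldr pderiv_at I g" and ?H = "foldr pderiv_at I (\<lambda>y. a * f y + b * g y)"
  note lin = foldr_pderiv_lin[OF U f g I]
  have "continuous_on U (\<lambda>y. a * ?F y + b * ?G y)"
    using smooth_fun_continuous[OF U f I] smooth_fun_continuous[OF U g I]
    by (intro continuous_on_add continuous_on_mult_left)
  then show "continuous_on U ?H" by (rule continuous_on_eq) (rule lin[symmetric])
  fix x i assume x: "x \<in> U" and i: "i < n"
  show "(\<lambda>t. ?H (x(i := t))) differentiable (at (x i))"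
  proof (rule differentiable_cong_ev)
    show "eventually (\<lambda>t. a * ?F (x(i := t)) + b * ?G (x(i := t)) = ?H (x(i := t))) (nhds (x i))"
      by (rule eventually_mono[OF eventually_update_in[OF U x i]]) (simp add: lin)
    show "(\<lambda>t. a * ?F (x(i := t)) + b * ?G (x(i := t))) differentiable at (x i)"
      using DERIV_add[OF DERIV_cmult[OF smooth_fun_deriv[OF f I x i]] DERIV_cmult[OF smooth_fun_deriv[OF g I x i]]]
        real_differentiable_def by blast
  qed
qed

lemma smooth_fun_zero: "smooth_fun n U (\<lambda>y. 0)"
proof -
  have "foldr pderiv_at I (\<lambda>y. 0) = (\<lambda>y. 0)" for I
    by (induction I) (auto simp: pderiv_at_def)
  then show ?thesis by (simp add: smooth_fun_def)
qed

lemma pderiv_lin: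
  assumes "openin (Euclidean_space n) U" "smooth_fun n U f" "smooth_fun n U g" "x \<in> U" "i < n"
  shows "pderiv_at i (\<lambda>y. a * f y + b * g y) x = a * pderiv_at i f x + b * pderiv_at i g x"
  using foldr_pderiv_lin[OF assms(1-3), of "[i]" x a b] assms(4,5) by simp

text \<open>
Two applications of the mean value theorem. The left-hand side is symmetric in the two variables,
so that it also equals \<open>h\<^sup>2\<close> times a value of the other mixed derivative.
\<close>

lemma second_difference:
  fixes g gs gst :: "real \<Rightarrow> real \<Rightarrow> real"
  assumes h: "0 < h"
    and gs: "\<And>s t. s \<in> {a..a + h} \<Longrightarrow> t \<in> {b..b + h} \<Longrightarrow> ((\<lambda>s. g s t) has_real_derivative gs s t) (at s)"
    and gst: "\<And>s t. s \<in> {a..a + h} \<Longrightarrow> t \<in> {b..b + h} \<Longrightarrow> ((\<lambda>t. gs s t) has_real_derivative gst s t) (at t)"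
  shows "\<exists>s\<in>{a..a + h}. \<exists>t\<in>{b..b + h}. g (a + h) (b + h) - g (a + h) b - g a (b + h) + g a b = h * h * gst s t"
proof -
  have "\<exists>s>a. s < a + h \<and> (g (a + h) (b + h) - g (a + h) b) - (g a (b + h) - g a b) = (a + h - a) * (gs s (b + h) - gs s b)"
    using h by (intro MVT2) (auto intro!: DERIV_diff gs)
  then obtain s where s: "a < s" "s < a + h"
    "(g (a + h) (b + h) - g (a + h) b) - (g a (b + h) - g a b) = h * (gs s (b + h) - gs s b)" by auto
  have "\<exists>t>b. t < b + h \<and> gs s (b + h) - gs s b = (b + h - b) * gst s t"
    using h s by (intro MVT2) (auto intro!: gst)
  then obtain t where t: "b < t" "t < b + h" "gs s (b + h) - gs s b = h * gst s t" by auto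
  have "g (a + h) (b + h) - g (a + h) b - g a (b + h) + g a b = h * h * gst s t"
    using s(3) t(3) by (simp add: algebra_simps)
  then show ?thesis using s t by (intro bexI[of _ s] bexI[of _ t]) auto
qed

text \<open>
Both mixed derivatives are limits of the same second difference divided by \<open>h\<^sup>2\<close>, because they are
continuous.
\<close>

lemma pderiv_commute:
  assumes U: "openin (Euclidean_space n) U" and f: "smooth_fun n U f" and x: "x \<in> U" and i: "i < n" and j: "j < n"
  shows "pderiv_at i (pderiv_at j f) x = pderiv_at j (pderiv_at i f) x"
proof (cases "i = j")
  case False
  let ?y = "\<lambda>s t. x(i := s, j := t)"
  let ?ij = "pderiv_at i (pderiv_at j f)" and ?ji = "pderiv_at j (pderiv_at i f)"
  have cy: "continuous_on UNIV (\<lambda>z. ?y (fst z) (snd z))"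
  proof (rule continuous_on_coordinatewise_then_product)
    show "continuous_on UNIV (\<lambda>z. (?y (fst z) (snd z)) k)" for k
      by (cases "k = j"; cases "k = i")
        (simp_all add: fun_upd_apply continuous_on_fst continuous_on_snd)
  qed
  obtain T where T: "open T" "U = {x. \<forall>i\<ge>n. x i = 0} \<inter> T"
    using U by (auto simp: Euclidean_space_top_of_set openin_open)
  let ?V = "(\<lambda>z. ?y (fst z) (snd z)) -` T"
  have V: "open ?V" using cy T(1) by (simp add: open_vimage)
  have VU: "?y (fst z) (snd z) \<in> U" if "z \<in> ?V" for z
    using that T x i j by auto
  have VU': "x(i := s, j := t) \<in> U" if "x(i := s, j := t) \<in> T" for s t
    using VU[of "(s, t)"] that by simp
  have xV: "(x i, x j) \<in> ?V" using x T by auto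
  have cont: "continuous_on ?V (\<lambda>z. ?ij (?y (fst z) (snd z)))" "continuous_on ?V (\<lambda>z. ?ji (?y (fst z) (snd z)))"
    using smooth_fun_continuous[OF U f, of "[i, j]"] smooth_fun_continuous[OF U f, of "[j, i]"] i j
    by (auto intro!: continuous_on_compose2[OF _ continuous_on_subset[OF cy]] simp: VU')
  show ?thesis
  proof (rule ccontr)
    assume ne: "?ij x \<noteq> ?ji x"
    define e where "e = \<bar>?ij x - ?ji x\<bar> / 2"
    have e: "e > 0" using ne by (simp add: e_def)
    have ev: "eventually (\<lambda>z. \<bar>G (?y (fst z) (snd z)) - G x\<bar> < e) (nhds (x i, x j))"
      if "continuous_on ?V (\<lambda>z. G (?y (fst z) (snd z)))" for G
    proof -
      have "isCont (\<lambda>z. G (?y (fst z) (snd z))) (x i, x j)"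
        using that V xV by (simp add: continuous_on_eq_continuous_at)
      then have "((\<lambda>z. G (?y (fst z) (snd z))) \<longlongrightarrow> G (?y (fst (x i, x j)) (snd (x i, x j)))) (nhds (x i, x j))"
        using tendsto_at_iff_tendsto_nhds[of "\<lambda>z. G (?y (fst z) (snd z))" "(x i, x j)"]
        by (simp only: continuous_at)
      then show ?thesis using tendstoD[OF _ e] by (fastforce simp: dist_real_def)
    qed
    have "eventually (\<lambda>z. z \<in> ?V) (nhds (x i, x j))"
      by (rule eventually_nhds_in_open[OF V xV])
    then have "eventually (\<lambda>z. z \<in> ?V \<and> \<bar>?ij (?y (fst z) (snd z)) - ?ij x\<bar> < e
        \<and> \<bar>?ji (?y (fst z) (snd z)) - ?ji x\<bar> < e) (nhds (x i, x j))"
      by (intro eventually_conj ev cont)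
    then obtain d where d: "d > 0" "\<And>z. dist z (x i, x j) < d \<Longrightarrow> z \<in> ?V \<and>
        \<bar>?ij (?y (fst z) (snd z)) - ?ij x\<bar> < e \<and> \<bar>?ji (?y (fst z) (snd z)) - ?ji x\<bar> < e"
      unfolding eventually_nhds_metric by blast
    define h where "h = d / 3"
    have h: "h > 0" using d by (simp add: h_def)
    have near: "?y s t \<in> U \<and> \<bar>?ij (?y s t) - ?ij x\<bar> < e \<and> \<bar>?ji (?y s t) - ?ji x\<bar> < e"
      if "s \<in> {x i..x i + h}" "t \<in> {x j..x j + h}" for s t
    proof -
      have "dist (s, t) (x i, x j) \<le> \<bar>s - x i\<bar> + \<bar>t - x j\<bar>"
        unfolding dist_Pair_Pair dist_real_def by (rule sqrt_sum_squares_le_sum) simp_all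
      also have "\<dots> < d" using that d(1) by (auto simp: h_def)
      finally show ?thesis using d(2)[of "(s, t)"] VU[of "(s, t)"] by simp
    qed
    have upd: "(?y s t)(i := s') = ?y s' t" "(?y s t)(j := t') = ?y s t'" "(?y s t) i = s" "(?y s t) j = t" for s t s' t'
      using False by (auto simp: fun_upd_twist)
    have Di: "((\<lambda>s. G (?y s t)) has_real_derivative pderiv_at i G (?y s t)) (at s)"
      if "smooth_fun n U G" "?y s t \<in> U" for G s t
      using smooth_fun_deriv[OF that(1), of "[]" "?y s t" i] that(2) i by (simp add: upd False)
    have Dj: "((\<lambda>t. G (?y s t)) has_real_derivative pderiv_at j G (?y s t)) (at t)"
      if "smooth_fun n U G" "?y s t \<in> U" for G s t
      using smooth_fun_deriv[OF that(1), of "[]" "?y s t" j] that(2) j by (simp add: upd False)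
    let ?D = "f (?y (x i + h) (x j + h)) - f (?y (x i + h) (x j)) - f (?y (x i) (x j + h)) + f (?y (x i) (x j))"
    obtain s t where 1: "s \<in> {x i..x i + h}" "t \<in> {x j..x j + h}" "?D = h * h * ?ji (?y s t)"
      using second_difference[OF h, of "x i" "x j" "\<lambda>s t. f (?y s t)" "\<lambda>s t. pderiv_at i f (?y s t)" "\<lambda>s t. ?ji (?y s t)"]
        near Di[OF f] Dj[OF smooth_fun_pderiv[OF f i]] by blast
    obtain t' s' where 2: "t' \<in> {x j..x j + h}" "s' \<in> {x i..x i + h}"
      "f (?y (x i + h) (x j + h)) - f (?y (x i) (x j + h)) - f (?y (x i + h) (x j)) + f (?y (x i) (x j)) = h * h * ?ij (?y s' t')"
      using second_difference[OF h, of "x j" "x i" "\<lambda>t s. f (?y s t)" "\<lambda>t s. pderiv_at j f (?y s t)" "\<lambda>t s. ?ij (?y s t)"]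
        near Dj[OF f] Di[OF smooth_fun_pderiv[OF f j]] by blast
    have "h * h * ?ji (?y s t) = h * h * ?ij (?y s' t')" using 1 2 by linarith
    then have "?ji (?y s t) = ?ij (?y s' t')" using h by simp
    then have "\<bar>?ij x - ?ji x\<bar> < 2 * e" using near[OF 1(1,2)] near[OF 2(2,1)] by linarith
    then show False by (simp add: e_def)
  qed
qed simp

section \<open>The exterior derivative\<close>

text \<open>
The exterior derivative in one chart. The recursion \<open>local_d_Cons\<close> is the Cartan formula
\<open>\<iota>\<^sub>i d + d \<iota>\<^sub>i = \<partial>\<^sub>i\<close> for a coordinate field; it turns statements about \<open>d\<close> into inductions on
the list of indices.
\<close>

definition local_d :: "(nat list \<Rightarrow> (nat \<Rightarrow> real) \<Rightarrow> real) \<Rightarrow> nat list \<Rightarrow> (nat \<Rightarrow> real) \<Rightarrow> real" where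
  "local_d w I x = (\<Sum>j<length I. (- 1) ^ j * pderiv_at (I ! j) (w (take j I @ drop (Suc j) I)) x)"

lemma local_d_Nil: "local_d w [] x = 0"
  by (simp add: local_d_def)

lemma local_d_Cons: "local_d w (i # I) x = pderiv_at i (w I) x - local_d (\<lambda>J. w (i # J)) I x"
  unfolding local_d_def
  by (simp add: sum.lessThan_Suc_shift sum_negf[symmetric] del: sum.lessThan_Suc)

context
  fixes n :: nat and U :: "(nat \<Rightarrow> real) set"
  assumes U: "openin (Euclidean_space n) U"
begin

lemma local_d_lin:
  assumes "\<And>J. smooth_fun n U (v J)" "\<And>J. smooth_fun n U (w J)" "x \<in> U"
  shows "set I \<subseteq> {..<n} \<Longrightarrow>
    local_d (\<lambda>J y. a * v J y + b * w J y) I x = a * local_d v I x + b * local_d w I x"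
  using assms
proof (induction I arbitrary: v w)
  case Nil
  show ?case by (simp add: local_d_Nil)
next
  case (Cons i I)
  then show ?case
    using Cons.IH[of "\<lambda>J. v (i # J)" "\<lambda>J. w (i # J)"]
    by (simp add: local_d_Cons pderiv_lin[OF U] algebra_simps)
qed

lemma local_d_cong:
  assumes "\<And>J y. set J \<subseteq> {..<n} \<Longrightarrow> y \<in> U \<Longrightarrow> v J y = w J y" "set I \<subseteq> {..<n}" "x \<in> U"
  shows "local_d v I x = local_d w I x"
  unfolding local_d_def
proof (intro sum.cong HOL.refl)
  fix j assume "j \<in> {..<length I}"
  then have "I ! j < n" using assms(2) nth_mem by fastforce
  moreover have "set (take j I @ drop (Suc j) I) \<subseteq> {..<n}"
    using assms(2) set_take_subset[of j I] set_drop_subset[of "Suc j" I] by auto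
  ultimately have "pderiv_at (I ! j) (v (take j I @ drop (Suc j) I)) x = pderiv_at (I ! j) (w (take j I @ drop (Suc j) I)) x"
    by (intro pderiv_at_cong[OF U assms(3)] assms(1))
  then show "(- 1) ^ j * pderiv_at (I ! j) (v (take j I @ drop (Suc j) I)) x
    = (- 1) ^ j * pderiv_at (I ! j) (w (take j I @ drop (Suc j) I)) x" by simp
qed

lemma smooth_local_d: "(\<And>J. smooth_fun n U (w J)) \<Longrightarrow> set I \<subseteq> {..<n} \<Longrightarrow> smooth_fun n U (local_d w I)"
proof (induction I arbitrary: w)
  case Nil
  then show ?case by (simp add: local_d_def smooth_fun_zero)
next
  case (Cons i I)
  have e: "local_d w (i # I) = (\<lambda>y. 1 * pderiv_at i (w I) y + (- 1) * local_d (\<lambda>J. w (i # J)) I y)"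
    by (simp add: fun_eq_iff local_d_Cons)
  have "smooth_fun n U (local_d (\<lambda>J. w (i # J)) I)"
    using Cons by simp
  then show ?case
    unfolding e using Cons.prems by (intro smooth_fun_lin[OF U] smooth_fun_pderiv) auto
qed

lemma pderiv_local_d:
  assumes "\<And>J. smooth_fun n U (w J)" "x \<in> U" "i < n"
  shows "set I \<subseteq> {..<n} \<Longrightarrow> pderiv_at i (local_d w I) x = local_d (\<lambda>J. pderiv_at i (w J)) I x"
  using assms
proof (induction I arbitrary: w)
  case Nil
  then show ?case by (simp add: local_d_def pderiv_at_def)
next
  case (Cons j I)
  have "local_d w (j # I) = (\<lambda>y. 1 * pderiv_at j (w I) y + (- 1) * local_d (\<lambda>J. w (j # J)) I y)"
    by (simp add: fun_eq_iff local_d_Cons)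
  moreover have "smooth_fun n U (pderiv_at j (w I))" "smooth_fun n U (local_d (\<lambda>J. w (j # J)) I)"
    using Cons.prems by (auto intro!: smooth_fun_pderiv smooth_local_d)
  ultimately have "pderiv_at i (local_d w (j # I)) x
    = 1 * pderiv_at i (pderiv_at j (w I)) x + (- 1) * pderiv_at i (local_d (\<lambda>J. w (j # J)) I) x"
    using Cons.prems by (simp only: pderiv_lin[OF U])
  also have "pderiv_at i (pderiv_at j (w I)) x = pderiv_at j (pderiv_at i (w I)) x"
    using Cons.prems by (intro pderiv_commute[OF U]) auto
  also have "pderiv_at i (local_d (\<lambda>J. w (j # J)) I) x = local_d (\<lambda>J. pderiv_at i (w (j # J))) I x"
    using Cons by simp
  finally show ?case by (simp add: local_d_Cons[of "\<lambda>J. pderiv_at i (w J)"])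
qed

text \<open>
By the Cartan formula, \<open>\<iota>\<^sub>i d d w = \<partial>\<^sub>i d w - d \<iota>\<^sub>i d w = \<partial>\<^sub>i d w - d \<partial>\<^sub>i w + d d \<iota>\<^sub>i w\<close>, and \<open>\<partial>\<^sub>i\<close> commutes
with \<open>d\<close> since partial derivatives commute.
\<close>

lemma local_d_local_d:
  assumes "\<And>J. smooth_fun n U (w J)" "x \<in> U"
  shows "set I \<subseteq> {..<n} \<Longrightarrow> local_d (local_d w) I x = 0"
  using assms
proof (induction I arbitrary: w)
  case Nil
  show ?case by (simp add: local_d_Nil)
next
  case (Cons i I)
  let ?w = "\<lambda>J. w (i # J)"
  have i: "i < n" and I: "set I \<subseteq> {..<n}" using Cons.prems by auto
  have "local_d (local_d w) (i # I) x = pderiv_at i (local_d w I) x - local_d (\<lambda>J. local_d w (i # J)) I x"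
    by (rule local_d_Cons)
  \<comment> \<open>Linearity of \<open>local_d\<close> asks for smooth coefficients at all lists, so those at lists with
    entries outside \<open>{..<n}\<close> are replaced by 0.\<close>
  also have "local_d (\<lambda>J. local_d w (i # J)) I x
    = local_d (\<lambda>J y. 1 * pderiv_at i (w J) y + (- 1) * (if set J \<subseteq> {..<n} then local_d ?w J y else 0)) I x"
    by (rule local_d_cong) (use I Cons.prems in \<open>auto simp: local_d_Cons\<close>)
  also have "\<dots> = 1 * local_d (\<lambda>J. pderiv_at i (w J)) I x
      + (- 1) * local_d (\<lambda>J y. if set J \<subseteq> {..<n} then local_d ?w J y else 0) I x"
  proof (rule local_d_lin)
    fix J
    show "smooth_fun n U (pderiv_at i (w J))" using Cons.prems i by (intro smooth_fun_pderiv)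
    show "smooth_fun n U (\<lambda>y. if set J \<subseteq> {..<n} then local_d ?w J y else 0)"
      using Cons.prems by (cases "set J \<subseteq> {..<n}") (auto intro!: smooth_local_d smooth_fun_zero)
  qed (use I Cons.prems in auto)
  also have "local_d (\<lambda>J y. if set J \<subseteq> {..<n} then local_d ?w J y else 0) I x = local_d (local_d ?w) I x"
    by (rule local_d_cong) (use I Cons.prems in auto)
  also have "\<dots> = 0" using Cons.IH[of ?w] I Cons.prems by blast
  finally show ?case using pderiv_local_d[of w x i I] Cons.prems i I by simp
qed

end

lemma ext_deriv_eq:
  "ext_deriv n A \<omega> c I x = (if c \<in> A \<and> set I \<subseteq> {..<n} \<and> x \<in> chart_image c then local_d (\<omega> c) I x else 0)"
  by (simp add: ext_deriv_def local_d_def)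

lemma chart_image_open: "smooth_manifold n M A \<Longrightarrow> c \<in> A \<Longrightarrow> openin (Euclidean_space n) (chart_image c)"
  by (simp add: smooth_manifold_def)

lemma forms_smooth: "\<omega> \<in> forms n A p \<Longrightarrow> c \<in> A \<Longrightarrow> smooth_fun n (chart_image c) (\<omega> c I)"
  by (simp add: forms_def)

lemma ext_deriv_ext_deriv:
  assumes M: "smooth_manifold n M A" and w: "\<omega> \<in> forms n A p"
  shows "ext_deriv n A (ext_deriv n A \<omega>) = (\<lambda>c I x. 0)"
proof (intro ext)
  fix c I x
  show "ext_deriv n A (ext_deriv n A \<omega>) c I x = 0"
  proof (cases "c \<in> A \<and> set I \<subseteq> {..<n} \<and> x \<in> chart_image c")
    case True
    then have U: "openin (Euclidean_space n) (chart_image c)" using M chart_image_open by blast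
    have "ext_deriv n A (ext_deriv n A \<omega>) c I x = local_d (ext_deriv n A \<omega> c) I x"
      using True by (simp add: ext_deriv_eq)
    also have "\<dots> = local_d (local_d (\<omega> c)) I x"
      by (rule local_d_cong[OF U]) (use True in \<open>auto simp: ext_deriv_eq\<close>)
    also have "\<dots> = 0" using True by (intro local_d_local_d[OF U] forms_smooth[OF w]) auto
    finally show ?thesis .
  qed (auto simp: ext_deriv_eq)
qed

lemma ext_deriv_lin:
  assumes M: "smooth_manifold n M A" and w: "\<omega> \<in> forms n A p" "\<eta> \<in> forms n A q"
  shows "ext_deriv n A (\<lambda>c I x. a * \<omega> c I x + b * \<eta> c I x)
    = (\<lambda>c I x. a * ext_deriv n A \<omega> c I x + b * ext_deriv n A \<eta> c I x)"
proof (intro ext)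
  fix c I x
  have "local_d (\<lambda>I x. a * \<omega> c I x + b * \<eta> c I x) I x = a * local_d (\<omega> c) I x + b * local_d (\<eta> c) I x"
    if "c \<in> A \<and> set I \<subseteq> {..<n} \<and> x \<in> chart_image c"
    using that by (intro local_d_lin[OF chart_image_open[OF M]]) (auto intro: forms_smooth[OF w(1)] forms_smooth[OF w(2)])
  then show "ext_deriv n A (\<lambda>c I x. a * \<omega> c I x + b * \<eta> c I x) c I x
    = a * ext_deriv n A \<omega> c I x + b * ext_deriv n A \<eta> c I x"
    by (simp add: ext_deriv_eq)
qed

lemma forms_support:
  "\<omega> \<in> forms n A p \<Longrightarrow> \<omega> c I x \<noteq> 0 \<Longrightarrow>
    c \<in> A \<and> int (length I) = p \<and> set I \<subseteq> {..<n} \<and> x \<in> chart_image c"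
  unfolding forms_def mem_Collect_eq by (drule conjunct1) blast

lemma forms_swap: "\<omega> \<in> forms n A p \<Longrightarrow> \<omega> c (I @ i # j # J) x = - \<omega> c (I @ j # i # J) x"
  unfolding forms_def mem_Collect_eq by (elim conjE) blast

lemma forms_transition:
  "\<lbrakk>\<omega> \<in> forms n A p; c \<in> A; c' \<in> A; x \<in> overlap c c'; set I \<subseteq> {..<n}\<rbrakk> \<Longrightarrow>
    \<omega> c I x = (\<Sum>J\<in>{J. length J = length I \<and> set J \<subseteq> {..<n}}.
       (\<Prod>l<length I. pderiv_at (I ! l) (\<lambda>y. transition c c' y (J ! l)) x) * \<omega> c' J (transition c c' x))"
  by (simp add: forms_def)

lemma forms_lin:
  assumes M: "smooth_manifold n M A" and w: "\<omega> \<in> forms n A p" "\<eta> \<in> forms n A p"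
  shows "(\<lambda>c I x. a * \<omega> c I x + b * \<eta> c I x) \<in> forms n A p"
proof -
  have 1: "c \<in> A \<and> int (length I) = p \<and> set I \<subseteq> {..<n} \<and> x \<in> chart_image c"
    if "a * \<omega> c I x + b * \<eta> c I x \<noteq> 0" for c I x
  proof -
    have "\<omega> c I x \<noteq> 0 \<or> \<eta> c I x \<noteq> 0" using that by auto
    then show ?thesis using forms_support[OF w(1)] forms_support[OF w(2)] by blast
  qed
  have 2: "\<omega> c (I @ i # j # J) x = - \<omega> c (I @ j # i # J) x" "\<eta> c (I @ i # j # J) x = - \<eta> c (I @ j # i # J) x"
    for c I i j J x
    by (rule forms_swap[OF w(1)], rule forms_swap[OF w(2)])
  let ?S = "\<lambda>\<omega> c c' I x. \<Sum>J\<in>{J. length J = length I \<and> set J \<subseteq> {..<n}}.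
             (\<Prod>l<length I. pderiv_at (I ! l) (\<lambda>y. transition c c' y (J ! l)) x) *
             \<omega> c' J (transition c c' x)"
  have 3: "\<omega> c I x = ?S \<omega> c c' I x" "\<eta> c I x = ?S \<eta> c c' I x"
    if "c \<in> A" "c' \<in> A" "x \<in> overlap c c'" "set I \<subseteq> {..<n}" for c c' I x
    using w that by (auto intro: forms_transition)
  have 4: "a * \<omega> c I x + b * \<eta> c I x = ?S (\<lambda>c I x. a * \<omega> c I x + b * \<eta> c I x) c c' I x"
    if "c \<in> A" "c' \<in> A" "x \<in> overlap c c'" "set I \<subseteq> {..<n}" for c c' I x
    unfolding 3[OF that] sum_distrib_left sum.distrib[symmetric] by (intro sum.cong) (simp_all add: algebra_simps)
  have 5: "smooth_fun n (chart_image c) (\<lambda>x. a * \<omega> c I x + b * \<eta> c I x)" if "c \<in> A" for c I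
    by (intro smooth_fun_lin[OF chart_image_open[OF M that]] forms_smooth[OF w(1) that] forms_smooth[OF w(2) that])
  have 6: "a * \<omega> c (I @ i # j # J) x + b * \<eta> c (I @ i # j # J) x
    = - (a * \<omega> c (I @ j # i # J) x + b * \<eta> c (I @ j # i # J) x)" for c I i j J x
    unfolding 2[of c I i j J x] by simp
  show ?thesis unfolding forms_def mem_Collect_eq
    by (intro conjI allI ballI impI) (use 1 4 5 6 in \<open>blast+\<close>)
qed

lemma forms_zero: "(\<lambda>c I x. 0) \<in> forms n A p"
  by (simp add: forms_def smooth_fun_zero)

section \<open>The interior product has order two\<close>

lemma ksgn_mult_2: "ksgn (a * 2) = 1"
  by (simp add: ksgn_def)

type_synonym cochain_fun = "nat list \<Rightarrow> real"

text \<open>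
At a point of a chart a form is a function of lists of indices. The algebra below is that of all functions
supported on lists of one length, of which \<open>wdg\<close> is the signed shuffle product; the alternating functions
are a subalgebra.
\<close>

definition homogeneous :: "int \<Rightarrow> cochain_fun \<Rightarrow> bool" where
  "homogeneous p f \<longleftrightarrow> (\<forall>I. f I \<noteq> 0 \<longrightarrow> int (length I) = p)"

definition wdg :: "cochain_fun \<Rightarrow> cochain_fun \<Rightarrow> cochain_fun" where
  "wdg f g I = (\<Sum>S\<in>Pow {..<length I}. shuffle_sgn (length I) S * f (nths I S) * g (nths I (- S)))"

definition contraction :: "nat \<Rightarrow> cochain_fun \<Rightarrow> cochain_fun" where
  "contraction i f I = f (i # I)"

lemma shuffle_sgn_insert_0: "shuffle_sgn (Suc n) (insert 0 (Suc ` T)) = shuffle_sgn n T"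
proof -
  have "{(a, b). a < b \<and> b < Suc n \<and> a \<notin> insert 0 (Suc ` T) \<and> b \<in> insert 0 (Suc ` T)}
      = (\<lambda>(a, b). (Suc a, Suc b)) ` {(a, b). a < b \<and> b < n \<and> a \<notin> T \<and> b \<in> T}" (is "?A = ?f ` ?B")
  proof (intro set_eqI iffI)
    fix z assume "z \<in> ?A"
    then obtain a b where z: "z = (a, b)" "a < b" "b < Suc n" "a \<notin> insert 0 (Suc ` T)" "b \<in> insert 0 (Suc ` T)"
      by blast
    then obtain a' b' where ab: "a = Suc a'" "b = Suc b'" by (cases a; cases b) auto
    then have "(a', b') \<in> ?B" using z by auto
    then show "z \<in> ?f ` ?B" using z(1) ab by (intro image_eqI[of _ _ "(a', b')"]) simp_all
  qed auto
  moreover have "inj_on ?f ?B" by (auto simp: inj_on_def)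
  ultimately show ?thesis by (simp add: shuffle_sgn_def card_image)
qed

lemma shuffle_sgn_Suc:
  assumes "T \<subseteq> {..<n}"
  shows "shuffle_sgn (Suc n) (Suc ` T) = (- 1) ^ card T * shuffle_sgn n T"
proof -
  let ?f = "\<lambda>(a, b). (Suc a, Suc b)" and ?B = "{(a, b). a < b \<and> b < n \<and> a \<notin> T \<and> b \<in> T}"
  have finT: "finite T" using assms finite_subset by blast
  have finB: "finite ?B" by (rule finite_subset[of _ "{..<n} \<times> {..<n}"]) auto
  have "{(a, b). a < b \<and> b < Suc n \<and> a \<notin> Suc ` T \<and> b \<in> Suc ` T}
      = Pair 0 ` Suc ` T \<union> ?f ` ?B" (is "?A = _")
  proof (intro set_eqI iffI)
    fix z assume "z \<in> ?A"
    then obtain a b where z: "z = (a, b)" "a < b" "b < Suc n" "a \<notin> Suc ` T" "b \<in> Suc ` T"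
      by blast
    then obtain b' where b: "b = Suc b'" by auto
    show "z \<in> Pair 0 ` Suc ` T \<union> ?f ` ?B"
    proof (cases a)
      case 0
      then show ?thesis using z by auto
    next
      case (Suc a')
      then have "(a', b') \<in> ?B" using z b by auto
      then show ?thesis using z(1) b Suc by (intro UnI2 image_eqI[of _ _ "(a', b')"]) simp_all
    qed
  qed (use assms in auto)
  moreover have "card (Pair 0 ` Suc ` T \<union> ?f ` ?B) = card (Pair (0::nat) ` Suc ` T) + card (?f ` ?B)"
    using finT finB by (intro card_Un_disjoint) auto
  moreover have "card (Pair (0::nat) ` Suc ` T) = card T"
    by (simp add: card_image inj_on_def)
  moreover have "card (?f ` ?B) = card ?B" by (rule card_image) (auto simp: inj_on_def)
  ultimately show ?thesis by (simp add: shuffle_sgn_def power_add)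
qed

lemma Pow_lessThan_Suc: "Pow {..<Suc n} = (\<lambda>T. insert 0 (Suc ` T)) ` Pow {..<n} \<union> (`) Suc ` Pow {..<n}"
proof -
  have "{..<Suc n} = insert 0 (Suc ` {..<n})" by (simp add: lessThan_Suc_eq_insert_0)
  then show ?thesis by (simp add: Pow_insert image_Pow_surj[OF HOL.refl, symmetric] image_image Un_commute)
qed

lemma wdg_Nil: "wdg f g [] = f [] * g []"
  by (simp add: wdg_def shuffle_sgn_def)

text \<open>
The first index goes either to \<open>f\<close> or to \<open>g\<close>; in the latter case it has to pass the \<open>p\<close> indices that go to \<open>f\<close>.
Together with \<open>wdg_Nil\<close> this determines the product by recursion on the list, and commutativity and
associativity follow by induction.
\<close>

lemma contraction_wdg:
  assumes "homogeneous p f"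
  shows "contraction i (wdg f g) I = wdg (contraction i f) g I + ksgn p * wdg f (contraction i g) I"
proof -
  let ?n = "length I"
  let ?t = "\<lambda>S. shuffle_sgn (Suc ?n) S * f (nths (i # I) S) * g (nths (i # I) (- S))"
  have inj: "inj ((`) Suc)" by (auto simp: inj_on_def)
  have sub: "{j. Suc j \<in> insert 0 (Suc ` T)} = T" "{j. Suc j \<in> Suc ` T} = T"
     "{j. j \<notin> T} = - T" for T
    by auto
  have "wdg f g (i # I) = (\<Sum>S\<in>Pow {..<Suc ?n}. ?t S)" by (simp add: wdg_def)
  also have "\<dots> = (\<Sum>S\<in>(\<lambda>T. insert 0 (Suc ` T)) ` Pow {..<?n}. ?t S) + (\<Sum>S\<in>(`) Suc ` Pow {..<?n}. ?t S)"
    unfolding Pow_lessThan_Suc by (rule sum.union_disjoint) auto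
  also have "(\<Sum>S\<in>(\<lambda>T. insert 0 (Suc ` T)) ` Pow {..<?n}. ?t S) = wdg (contraction i f) g I"
  proof -
    have "inj_on (\<lambda>T. insert 0 (Suc ` T)) (Pow {..<?n})"
    proof (rule inj_onI)
      fix T T' assume "insert 0 (Suc ` T) = insert 0 (Suc ` T')"
      then have "{j. Suc j \<in> insert 0 (Suc ` T)} = {j. Suc j \<in> insert 0 (Suc ` T')}" by simp
      then show "T = T'" by (simp only: sub)
    qed
    then show ?thesis
      by (simp add: wdg_def sum.reindex contraction_def shuffle_sgn_insert_0 nths_Cons sub inj_image_mem_iff)
  qed
  also have "(\<Sum>S\<in>(`) Suc ` Pow {..<?n}. ?t S) = ksgn p * wdg f (contraction i g) I"
  proof -
    have "?t (Suc ` T) = ksgn p * (shuffle_sgn ?n T * f (nths I T) * contraction i g (nths I (- T)))"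
      if "T \<in> Pow {..<?n}" for T
    proof (cases "f (nths I T) = 0")
      case True
      then show ?thesis by (simp add: nths_Cons sub inj_image_mem_iff)
    next
      case False
      have "{j. j < ?n \<and> j \<in> T} = T" using that by auto
      then have "int (card T) = p" using assms[unfolded homogeneous_def, rule_format, OF False] by (simp add: length_nths)
      then have "(- 1) ^ card T = ksgn p" by (auto simp: ksgn_def minus_one_power_iff)
      then show ?thesis using that
        by (simp add: nths_Cons sub inj_image_mem_iff shuffle_sgn_Suc contraction_def)
    qed
    then show ?thesis
      by (subst sum.reindex) (auto intro: inj_on_subset[OF inj] simp: wdg_def sum_distrib_left)
  qed
  finally show ?thesis by (simp add: contraction_def[of i "wdg f g" I])
qed

lemma homogeneous_contraction: "homogeneous p f \<Longrightarrow> homogeneous (p - 1) (contraction i f)"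
  by (fastforce simp: homogeneous_def contraction_def)

lemma homogeneous_wdg: "homogeneous p f \<Longrightarrow> homogeneous q g \<Longrightarrow> homogeneous (p + q) (wdg f g)"
proof -
  have "homogeneous p f \<Longrightarrow> homogeneous q g \<Longrightarrow> wdg f g I \<noteq> 0 \<Longrightarrow> int (length I) = p + q" for I
  proof (induction I arbitrary: p q f g)
    case Nil
    then have "f [] \<noteq> 0" "g [] \<noteq> 0" by (auto simp: wdg_Nil)
    then have "p = 0" "q = 0" using Nil(1,2) unfolding homogeneous_def by fastforce+
    then show ?case by simp
  next
    case (Cons i I)
    have "wdg f g (i # I) = wdg (contraction i f) g I + ksgn p * wdg f (contraction i g) I"
      using contraction_wdg[OF Cons.prems(1), of i g I] by (simp add: contraction_def)
    then have "wdg (contraction i f) g I \<noteq> 0 \<or> wdg f (contraction i g) I \<noteq> 0" using Cons.prems(3) by auto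
    then show ?case
      using Cons.IH[OF homogeneous_contraction[OF Cons.prems(1)] Cons.prems(2)]
        Cons.IH[OF Cons.prems(1) homogeneous_contraction[OF Cons.prems(2)]] by fastforce
  qed
  then show "homogeneous p f \<Longrightarrow> homogeneous q g \<Longrightarrow> homogeneous (p + q) (wdg f g)" unfolding homogeneous_def by blast
qed

lemma wdg_sum_left: "wdg (\<lambda>J. \<Sum>a\<in>A. c a * f a J) g I = (\<Sum>a\<in>A. c a * wdg (f a) g I)"
  unfolding wdg_def
  by (simp add: sum_distrib_left sum_distrib_right sum.swap[of _ A] mult_ac)

lemma wdg_sum_right: "wdg f (\<lambda>J. \<Sum>a\<in>A. c a * g a J) I = (\<Sum>a\<in>A. c a * wdg f (g a) I)"
  unfolding wdg_def
  by (simp add: sum_distrib_left sum_distrib_right sum.swap[of _ A] mult_ac)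

lemma wdg_lin_left: "wdg (\<lambda>J. a * f J + b * f' J) g I = a * wdg f g I + b * wdg f' g I"
  unfolding wdg_def by (simp add: sum_distrib_left sum.distrib[symmetric] algebra_simps)

lemma wdg_lin_right: "wdg f (\<lambda>J. a * g J + b * g' J) I = a * wdg f g I + b * wdg f g' I"
  unfolding wdg_def by (simp add: sum_distrib_left sum.distrib[symmetric] algebra_simps)

lemma wdg_add_left: "wdg (\<lambda>J. f J + b * f' J) g I = wdg f g I + b * wdg f' g I"
  using wdg_lin_left[of 1] by simp

lemma wdg_add_right: "wdg f (\<lambda>J. g J + b * g' J) I = wdg f g I + b * wdg f g' I"
  using wdg_lin_right[of f 1] by simp

lemma wdg_comm: "homogeneous p f \<Longrightarrow> homogeneous q g \<Longrightarrow> wdg f g I = ksgn (p * q) * wdg g f I"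
proof (induction I arbitrary: p q f g)
  case Nil
  show ?case
  proof (cases "f [] = 0 \<or> g [] = 0")
    case False
    then have "p = 0" "q = 0" using Nil by (auto simp: homogeneous_def)
    then show ?thesis by (simp add: wdg_Nil ksgn_def)
  qed (auto simp: wdg_Nil)
next
  case (Cons i I)
  have "wdg f g (i # I) = wdg (contraction i f) g I + ksgn p * wdg f (contraction i g) I"
    using contraction_wdg[OF Cons.prems(1), of i g I] by (simp add: contraction_def)
  also have "wdg (contraction i f) g I = ksgn ((p - 1) * q) * wdg g (contraction i f) I"
    using Cons.prems by (intro Cons.IH homogeneous_contraction)
  also have "wdg f (contraction i g) I = ksgn (p * (q - 1)) * wdg (contraction i g) f I"
    using Cons.prems by (intro Cons.IH homogeneous_contraction)
  also have "ksgn ((p - 1) * q) * wdg g (contraction i f) I + ksgn p * (ksgn (p * (q - 1)) * wdg (contraction i g) f I)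
    = ksgn (p * q) * (wdg (contraction i g) f I + ksgn q * wdg g (contraction i f) I)"
    by (simp add: ksgn_diff algebra_simps ksgn_mult_self ksgn_mult_self')
  also have "wdg (contraction i g) f I + ksgn q * wdg g (contraction i f) I = wdg g f (i # I)"
    using contraction_wdg[OF Cons.prems(2), of i f I] by (simp add: contraction_def)
  finally show ?case .
qed

lemma wdg_assoc: "homogeneous p f \<Longrightarrow> homogeneous q g \<Longrightarrow> wdg (wdg f g) h I = wdg f (wdg g h) I"
proof (induction I arbitrary: p q f g h)
  case Nil
  show ?case by (simp add: wdg_Nil)
next
  case (Cons i I)
  note c1 = contraction_wdg[OF Cons.prems(1)] and c2 = contraction_wdg[OF Cons.prems(2)]
    and c3 = contraction_wdg[OF homogeneous_wdg[OF Cons.prems]]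
  have e: "contraction i (wdg f g) = (\<lambda>J. wdg (contraction i f) g J + ksgn p * wdg f (contraction i g) J)"
    "contraction i (wdg g h) = (\<lambda>J. wdg (contraction i g) h J + ksgn q * wdg g (contraction i h) J)"
    using c1 c2 by auto
  have "contraction i (wdg (wdg f g) h) I = contraction i (wdg f (wdg g h)) I"
    unfolding c3 c1 e wdg_add_left wdg_add_right
    using Cons.IH[OF homogeneous_contraction[OF Cons.prems(1)] Cons.prems(2), of i h]
      Cons.IH[OF Cons.prems(1) homogeneous_contraction[OF Cons.prems(2)], of i h]
      Cons.IH[OF Cons.prems, of "contraction i h"]
    by (simp add: ksgn_add algebra_simps)
  then show ?case by (simp add: contraction_def)
qed

definition double_contraction :: "nat \<Rightarrow> nat \<Rightarrow> cochain_fun \<Rightarrow> cochain_fun" where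
  "double_contraction i j f I = f (i # j # I)"

lemma double_contraction_conv: "double_contraction i j f = contraction j (contraction i f)"
  by (simp add: fun_eq_iff double_contraction_def contraction_def)

lemma homogeneous_double_contraction: "homogeneous p f \<Longrightarrow> homogeneous (p - 2) (double_contraction i j f)"
  unfolding double_contraction_conv using homogeneous_contraction[OF homogeneous_contraction] by (metis diff_diff_eq one_add_one)

lemma contraction_lin: "contraction i (\<lambda>J. f J + b * g J) I = contraction i f I + b * contraction i g I"
  by (simp add: contraction_def)

lemma bicontraction_wdg:
  assumes "homogeneous p f"
  shows "double_contraction i j (wdg f g) I = wdg (double_contraction i j f) g I + wdg f (double_contraction i j g) I
    + ksgn p * (wdg (contraction j f) (contraction i g) I - wdg (contraction i f) (contraction j g) I)"
proof -
  have "contraction i (wdg f g) = (\<lambda>J. wdg (contraction i f) g J + ksgn p * wdg f (contraction i g) J)"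
    using contraction_wdg[OF assms] by auto
  then have "double_contraction i j (wdg f g) I = contraction j (\<lambda>J. wdg (contraction i f) g J + ksgn p * wdg f (contraction i g) J) I"
    by (simp add: double_contraction_conv)
  also have "\<dots> = contraction j (wdg (contraction i f) g) I + ksgn p * contraction j (wdg f (contraction i g)) I"
    by (rule contraction_lin)
  finally show ?thesis
    unfolding contraction_wdg[OF assms] contraction_wdg[OF homogeneous_contraction[OF assms]] double_contraction_conv
    by (simp add: ksgn_diff ksgn_01 algebra_simps ksgn_mult_self ksgn_mult_self')
qed

text \<open>
A composite of two odd derivations has order at most 2. The cross terms in
\<open>B (f \<and> g) = B f \<and> g + f \<and> B g + \<plusminus> (f\<^sub>j \<and> g\<^sub>i - f\<^sub>i \<and> g\<^sub>j)\<close> form a biderivation, which is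
what the identity expresses. In the proof every term is brought into the order \<open>f, g, h\<close>.
\<close>

lemma double_contraction_order2:
  assumes f: "homogeneous p f" and g: "homogeneous q g" and h: "homogeneous r h"
    and B_def: "B = double_contraction i j"
  shows "B (wdg (wdg f g) h) I =
    wdg (B (wdg f g)) h I + ksgn (q * r) * wdg (B (wdg f h)) g I + ksgn (p * (q + r)) * wdg (B (wdg g h)) f I
    - (wdg (wdg (B f) g) h I + wdg (wdg f (B g)) h I + wdg (wdg f g) (B h) I)"
proof -
  let ?c = "\<lambda>k. contraction k"
  note hc = homogeneous_contraction
  have E: "double_contraction i j (wdg f g) = (\<lambda>J. (wdg (B f) g J + 1 * wdg f (B g) J)
      + ksgn p * (wdg (?c j f) (?c i g) J + (- 1) * wdg (?c i f) (?c j g) J))" if "homogeneous p f" for p f g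
    using bicontraction_wdg[OF that] by (auto simp: B_def)
  have L: "wdg (double_contraction i j (wdg f g)) h I = wdg (wdg (B f) g) h I + wdg (wdg f (B g)) h I
      + ksgn p * (wdg (wdg (?c j f) (?c i g)) h I - wdg (wdg (?c i f) (?c j g)) h I)"
    if "homogeneous p f" for p f g h
    unfolding E[OF that] wdg_add_left by simp
  have D: "contraction k (wdg f g) = (\<lambda>J. wdg (contraction k f) g J + ksgn p * wdg f (contraction k g) J)" for k
    using contraction_wdg[OF f] by auto
  have swap: "wdg (wdg x y) z I = ksgn (b * c) * wdg (wdg x z) y I"
    if "homogeneous a x" "homogeneous b y" "homogeneous c z" for a b c x y z
  proof -
    have "wdg (wdg x y) z I = wdg x (wdg y z) I" by (rule wdg_assoc[OF that(1,2)])
    also have "wdg y z = (\<lambda>J. 0 * wdg z y J + ksgn (b * c) * wdg z y J)"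
      using wdg_comm[OF that(2,3)] by auto
    also have "wdg x \<dots> I = ksgn (b * c) * wdg x (wdg z y) I"
      unfolding wdg_lin_right by simp
    also have "wdg x (wdg z y) I = wdg (wdg x z) y I"
      by (rule wdg_assoc[OF that(1,3), symmetric])
    finally show ?thesis .
  qed
  have rot: "wdg (wdg y z) x I = ksgn (a * (b + c)) * wdg (wdg x y) z I"
    if "homogeneous a x" "homogeneous b y" "homogeneous c z" for a b c x y z
    using wdg_comm[OF homogeneous_wdg[OF that(2,3)] that(1), of I] wdg_assoc[OF that(1,2), of z I]
    by (simp add: mult.commute)
  have bf: "homogeneous (p - 2) (B f)" "homogeneous (q - 2) (B g)" "homogeneous (r - 2) (B h)"
    using f g h homogeneous_double_contraction by (auto simp: B_def)
  note sg = ksgn_diff ksgn_add ksgn_01 ksgn_mult_2 ksgn_mult_self ksgn_mult_self' algebra_simps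
  have lhs: "B (wdg (wdg f g) h) I = wdg (B (wdg f g)) h I + wdg (wdg f g) (B h) I
    + ksgn (p + q) * (wdg (wdg (?c j f) g) (?c i h) I + ksgn p * wdg (wdg f (?c j g)) (?c i h) I
       - wdg (wdg (?c i f) g) (?c j h) I - ksgn p * wdg (wdg f (?c i g)) (?c j h) I)"
    unfolding B_def bicontraction_wdg[OF homogeneous_wdg[OF f g]] D wdg_add_left by simp
  have t1: "ksgn (q * r) * wdg (B (wdg f h)) g I = wdg (wdg (B f) g) h I + wdg (wdg f g) (B h) I
    + ksgn (p + q) * (wdg (wdg (?c j f) g) (?c i h) I - wdg (wdg (?c i f) g) (?c j h) I)"
    unfolding B_def L[OF f]
    unfolding B_def[symmetric] swap[OF bf(1) h g] swap[OF f bf(3) g]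
      swap[OF hc[OF f, of j] hc[OF h, of i] g] swap[OF hc[OF f, of i] hc[OF h, of j] g]
    by (simp add: sg)
  have t2: "ksgn (p * (q + r)) * wdg (B (wdg g h)) f I = wdg (wdg f (B g)) h I + wdg (wdg f g) (B h) I
    + ksgn q * (wdg (wdg f (?c j g)) (?c i h) I - wdg (wdg f (?c i g)) (?c j h) I)"
    unfolding B_def L[OF g]
    unfolding B_def[symmetric] rot[OF f bf(2) h] rot[OF f g bf(3)]
      rot[OF f hc[OF g, of j] hc[OF h, of i]] rot[OF f hc[OF g, of i] hc[OF h, of j]]
    by (simp add: sg)
  show ?thesis unfolding lhs t1 t2 by (simp add: sg)
qed

lemma wedge_wdg: "wedge \<omega> \<eta> c I x = wdg (\<lambda>J. \<omega> c J x) (\<lambda>J. \<eta> c J x) I"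
  by (simp add: wedge_def wdg_def)

lemma interior_double_contraction: "interior n \<pi> \<omega> c I x =
    (\<Sum>z\<in>{..<n} \<times> {..<n}. 1 / 2 * \<pi> c (fst z) (snd z) x * double_contraction (fst z) (snd z) (\<lambda>J. \<omega> c J x) I)"
  by (simp add: interior_def double_contraction_def sum.cartesian_product sum_distrib_left case_prod_unfold mult_ac)

definition form_degree :: "int \<Rightarrow> 'm form \<Rightarrow> bool" where
  "form_degree p \<omega> \<longleftrightarrow> (\<forall>c x. homogeneous p (\<lambda>J. \<omega> c J x))"

lemma form_degreeD: "form_degree p \<omega> \<Longrightarrow> homogeneous p (\<lambda>J. \<omega> c J x)"
  unfolding form_degree_def by (elim allE)

lemma form_degree_forms:
  assumes "\<omega> \<in> forms n A p"
  shows "form_degree p \<omega>"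
  unfolding form_degree_def homogeneous_def
proof (intro allI impI)
  fix c I x assume "\<omega> c I x \<noteq> 0"
  from forms_support[OF assms this] show "int (length I) = p" by simp
qed

lemma form_degree_wedge: "form_degree p \<omega> \<Longrightarrow> form_degree q \<eta> \<Longrightarrow> form_degree (p + q) (wedge \<omega> \<eta>)"
  by (simp add: form_degree_def wedge_wdg homogeneous_wdg)

lemma form_degree_interior: "form_degree p \<omega> \<Longrightarrow> form_degree (p - 2) (interior n \<pi> \<omega>)"
proof -
  assume *: "form_degree p \<omega>"
  have "int (length I) = p - 2" if "interior n \<pi> \<omega> c I x \<noteq> 0" for c I x
  proof -
    from that obtain z where "1 / 2 * \<pi> c (fst z) (snd z) x * double_contraction (fst z) (snd z) (\<lambda>J. \<omega> c J x) I \<noteq> 0"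
      unfolding interior_double_contraction by (rule sum.not_neutral_contains_not_neutral)
    then have "double_contraction (fst z) (snd z) (\<lambda>J. \<omega> c J x) I \<noteq> 0" by simp
    moreover have "homogeneous (p - 2) (double_contraction (fst z) (snd z) (\<lambda>J. \<omega> c J x))"
      by (intro homogeneous_double_contraction form_degreeD *)
    ultimately show ?thesis by (simp add: homogeneous_def)
  qed
  then show ?thesis by (simp add: form_degree_def homogeneous_def)
qed

lemma wedge_comm:
  assumes "form_degree p \<omega>" "form_degree q \<eta>"
  shows "wedge \<omega> \<eta> c I x = ksgn (p * q) * wedge \<eta> \<omega> c I x"
  unfolding wedge_wdg by (intro wdg_comm form_degreeD assms)

lemma interior_order2:
  assumes "form_degree p \<alpha>" "form_degree q \<beta>" "form_degree r \<gamma>"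
  shows "interior n \<pi> (wedge (wedge \<alpha> \<beta>) \<gamma>) c I x =
    wedge (interior n \<pi> (wedge \<alpha> \<beta>)) \<gamma> c I x
    + ksgn (q * r) * wedge (interior n \<pi> (wedge \<alpha> \<gamma>)) \<beta> c I x
    + ksgn (p * (q + r)) * wedge (interior n \<pi> (wedge \<beta> \<gamma>)) \<alpha> c I x
    - (wedge (wedge (interior n \<pi> \<alpha>) \<beta>) \<gamma> c I x + wedge (wedge \<alpha> (interior n \<pi> \<beta>)) \<gamma> c I x
      + wedge (wedge \<alpha> \<beta>) (interior n \<pi> \<gamma>) c I x)"
proof -
  let ?f = "\<lambda>J. \<alpha> c J x" and ?g = "\<lambda>J. \<beta> c J x" and ?h = "\<lambda>J. \<gamma> c J x"
  let ?w = "\<lambda>z. 1 / 2 * \<pi> c (fst z) (snd z) x" and ?B = "\<lambda>z. double_contraction (fst z) (snd z)"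
  let ?S = "\<lambda>F. \<Sum>z\<in>{..<n} \<times> {..<n}. ?w z * F z"
  have int: "(\<lambda>J. interior n \<pi> \<omega> c J x) = (\<lambda>J. \<Sum>z\<in>{..<n} \<times> {..<n}. ?w z * ?B z (\<lambda>K. \<omega> c K x) J)" for \<omega> :: "'a form"
    by (simp only: interior_double_contraction)
  have w: "(\<lambda>K. wedge \<omega> \<eta> c K x) = wdg (\<lambda>K. \<omega> c K x) (\<lambda>K. \<eta> c K x)" for \<omega> \<eta> :: "'a form"
    by (simp add: wedge_wdg fun_eq_iff)
  have sl: "wdg (\<lambda>J. \<Sum>z\<in>{..<n} \<times> {..<n}. ?w z * F z J) k = (\<lambda>J. ?S (\<lambda>z. wdg (F z) k J))" for F k
    by (intro ext) (rule wdg_sum_left)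
  have sr: "wdg k (\<lambda>J. \<Sum>z\<in>{..<n} \<times> {..<n}. ?w z * F z J) = (\<lambda>J. ?S (\<lambda>z. wdg k (F z) J))" for F k
    by (intro ext) (rule wdg_sum_right)
  have lhs: "interior n \<pi> (wedge (wedge \<alpha> \<beta>) \<gamma>) c I x = ?S (\<lambda>z. ?B z (wdg (wdg ?f ?g) ?h) I)"
    unfolding interior_double_contraction w ..
  have t: "wedge (interior n \<pi> (wedge \<omega> \<eta>)) \<zeta> c I x
      = ?S (\<lambda>z. wdg (?B z (wdg (\<lambda>K. \<omega> c K x) (\<lambda>K. \<eta> c K x))) (\<lambda>K. \<zeta> c K x) I)" for \<omega> \<eta> \<zeta> :: "'a form"
    unfolding wedge_wdg[of "interior n \<pi> (wedge \<omega> \<eta>)"] int w sl ..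
  have u1: "wedge (wedge (interior n \<pi> \<alpha>) \<beta>) \<gamma> c I x = ?S (\<lambda>z. wdg (wdg (?B z ?f) ?g) ?h I)"
    unfolding wedge_wdg[of "wedge (interior n \<pi> \<alpha>) \<beta>"] w int sl ..
  have u2: "wedge (wedge \<alpha> (interior n \<pi> \<beta>)) \<gamma> c I x = ?S (\<lambda>z. wdg (wdg ?f (?B z ?g)) ?h I)"
    unfolding wedge_wdg[of "wedge \<alpha> (interior n \<pi> \<beta>)"] w int sr sl ..
  have u3: "wedge (wedge \<alpha> \<beta>) (interior n \<pi> \<gamma>) c I x = ?S (\<lambda>z. wdg (wdg ?f ?g) (?B z ?h) I)"
    unfolding wedge_wdg[of "wedge \<alpha> \<beta>"] w int sr ..
  have B: "?B z (wdg (wdg ?f ?g) ?h) I =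
    wdg (?B z (wdg ?f ?g)) ?h I + ksgn (q * r) * wdg (?B z (wdg ?f ?h)) ?g I
    + ksgn (p * (q + r)) * wdg (?B z (wdg ?g ?h)) ?f I
    - (wdg (wdg (?B z ?f) ?g) ?h I + wdg (wdg ?f (?B z ?g)) ?h I + wdg (wdg ?f ?g) (?B z ?h) I)" for z
    by (rule double_contraction_order2[OF assms[THEN form_degreeD] HOL.refl])
  show ?thesis
    unfolding lhs t u1 u2 u3 B
    by (simp add: sum.distrib sum_subtractf sum_distrib_left algebra_simps)
qed

section \<open>Evaluation in the endomorphism operad\<close>

lemma endo_select [simp]:
  "cpx (endo_operad X) = endo_cpx X"
  "spc (endo_cpx X S) = endo_spc X S"
  "cadd (endo_cpx X S) F G = (\<lambda>\<xi>\<in>inputs X S. cadd X (F \<xi>) (G \<xi>))"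
  "cscl (endo_cpx X S) r F = (\<lambda>\<xi>\<in>inputs X S. cscl X r (F \<xi>))"
  "cdif (endo_cpx X S) k F = endo_dif X S k F"
  by (simp_all add: endo_operad_def endo_cpx_def)

lemma de_rham_select [simp]:
  "spc (de_rham n A) = forms n A"
  "cadd (de_rham n A) \<omega> \<eta> = (\<lambda>c I x. \<omega> c I x + \<eta> c I x)"
  "cscl (de_rham n A) r \<omega> = (\<lambda>c I x. r * \<omega> c I x)"
  "czero (de_rham n A) p = (\<lambda>c I x. 0)"
  "cdif (de_rham n A) p = ext_deriv n A"
  by (simp_all add: de_rham_def)

lemma inputs_iff: "\<xi> \<in> inputs X S \<longleftrightarrow> \<xi> \<in> extensional S \<and> (\<forall>s\<in>S. snd (\<xi> s) \<in> spc X (fst (\<xi> s)))"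
  unfolding inputs_def PiE_def Pi_def by (auto simp: mem_Sigma_iff) (metis prod.collapse mem_Sigma_iff UNIV_I)+

lemma restrict_inputs: "\<xi> \<in> inputs X S \<Longrightarrow> U \<subseteq> S \<Longrightarrow> restrict \<xi> U \<in> inputs X U"
  by (auto simp: inputs_iff)

lemma total_deg_restrict: "total_deg U (restrict \<xi> U) = total_deg U \<xi>"
  by (simp add: total_deg_def)

lemma endo_spc_value: "F \<in> endo_spc X S k \<Longrightarrow> \<xi> \<in> inputs X S \<Longrightarrow> F \<xi> \<in> spc X (total_deg S \<xi> + k)"
  by (simp add: endo_spc_def)

lemma endo_spc_eqI:
  assumes "F \<in> endo_spc X S k" "G \<in> endo_spc X S k" "\<And>\<xi>. \<xi> \<in> inputs X S \<Longrightarrow> F \<xi> = G \<xi>"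
  shows "F = G"
  using assms by (intro extensionalityI[of F "inputs X S" G]) (auto simp: endo_spc_def)

lemma koszul_one:
  assumes "\<And>u v. u \<in> W \<Longrightarrow> v \<in> W \<Longrightarrow> u < v \<Longrightarrow> \<not> lt v u"
  shows "koszul lt W \<xi> = 1"
proof -
  have *: "{(u, v). u \<in> W \<and> v \<in> W \<and> u < v \<and> lt v u} = {}" using assms by auto
  show ?thesis unfolding koszul_def * by simp
qed

lemma koszul_insert_order_trivial:
  assumes "U = W \<or> U = {a}"
  shows "koszul (insert_order a U) W \<xi> = 1"
  using assms by (intro koszul_one) (auto simp: insert_order_def Let_def split: if_splits)

text \<open>
The labels in \<open>U\<close> are moved to the position of 3, that is behind the remaining label.
\<close>

lemma koszul_insert_order_012:
  "koszul (insert_order 3 {0, 1}) {0, 1, 2} \<xi> = ksgn (fst (\<xi> 0) * fst (\<xi> 2)) * ksgn (fst (\<xi> 1) * fst (\<xi> 2))"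
  "koszul (insert_order 3 {0, 2}) {0, 1, 2} \<xi> = ksgn (fst (\<xi> 0) * fst (\<xi> 1))"
  "koszul (insert_order 3 {1, 2}) {0, 1, 2} \<xi> = 1"
proof -
  have "{(u, v). u \<in> {0, 1, 2} \<and> v \<in> {0, 1, 2} \<and> u < v \<and> insert_order 3 {0, 1} v u} = {(0, 2), (1, 2)}"
    by (auto simp: insert_order_def Let_def)
  then show "koszul (insert_order 3 {0, 1}) {0, 1, 2} \<xi> = ksgn (fst (\<xi> 0) * fst (\<xi> 2)) * ksgn (fst (\<xi> 1) * fst (\<xi> 2))"
    by (simp add: koszul_def)
  have "{(u, v). u \<in> {0, 1, 2} \<and> v \<in> {0, 1, 2} \<and> u < v \<and> insert_order 3 {0, 2} v u} = {(0, 1)}"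
    by (auto simp: insert_order_def Let_def)
  then show "koszul (insert_order 3 {0, 2}) {0, 1, 2} \<xi> = ksgn (fst (\<xi> 0) * fst (\<xi> 1))"
    by (simp add: koszul_def)
  show "koszul (insert_order 3 {1, 2}) {0, 1, 2} \<xi> = 1"
    by (rule koszul_one) (auto simp: insert_order_def Let_def)
qed

text \<open>
The arguments of the outer operation in a partial composition at \<open>a\<close>.
\<close>

definition graft :: "nat set \<Rightarrow> nat \<Rightarrow> nat set \<Rightarrow> int \<Rightarrow> ((nat \<Rightarrow> int \<times> 'x) \<Rightarrow> 'x) \<Rightarrow> (nat \<Rightarrow> int \<times> 'x) \<Rightarrow> nat \<Rightarrow> int \<times> 'x" where
  "graft S a U l G \<xi> = (\<lambda>s\<in>S. if s = a then (total_deg U \<xi> + l, G (restrict \<xi> U)) else \<xi> s)"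

lemma graft_inputs:
  assumes "G \<in> endo_spc X U l" "\<xi> \<in> inputs X ((S - {a}) \<union> U)"
  shows "graft S a U l G \<xi> \<in> inputs X S" "restrict \<xi> U \<in> inputs X U"
proof -
  show r: "restrict \<xi> U \<in> inputs X U" using assms(2) by (rule restrict_inputs) blast
  then have "G (restrict \<xi> U) \<in> spc X (total_deg U \<xi> + l)"
    using endo_spc_value[OF assms(1)] total_deg_restrict by metis
  then show "graft S a U l G \<xi> \<in> inputs X S"
    using assms(2) by (auto simp: inputs_iff graft_def)
qed

lemma typed_bv: "typed bv_pres = typed bvq_pres"
  by (rule typed_cong[OF bvq_sig_eq])

locale bv_forms = operad_hom_on_presented bv_pres "endo_operad (de_rham n A)" \<rho>
  for n :: nat and A :: "'m chart set" and \<pi> :: "'m bivector"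
    and \<rho> :: "nat set \<Rightarrow> int \<Rightarrow> bv_gen opterm set \<Rightarrow> (nat \<Rightarrow> int \<times> 'm form) \<Rightarrow> 'm form" +
  assumes mu: "sem {0, 1} 0 (OGen Mu {0, 1}) = binary_op (de_rham n A) wedge"
    and phi_1: "sem {0} (- 2) (bv_phi 1) = unary_op (de_rham n A) (interior n \<pi>)"
    and phi_n: "\<And>i. 2 \<le> i \<Longrightarrow> sem {0} (- 2 * int i) (bv_phi i) = czero (endo_cpx (de_rham n A) {0}) (- 2 * int i)"
begin

abbreviation X where "X \<equiv> de_rham n A"

lemma sem_endo_spc: "typed bv_pres t S k \<Longrightarrow> sem S k t \<in> endo_spc X S k"
  using sem_spc by simp

lemma sem_add_value:
  assumes "typed bv_pres t S k" "typed bv_pres s S k" "\<xi> \<in> inputs X S"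
  shows "sem S k (OAdd t s) \<xi> = (\<lambda>c I x. sem S k t \<xi> c I x + sem S k s \<xi> c I x)"
  using assms by (simp add: sem_add)

lemma sem_scale_value:
  assumes "typed bv_pres t S k" "\<xi> \<in> inputs X S"
  shows "sem S k (OScale r t) \<xi> = (\<lambda>c I x. r * sem S k t \<xi> c I x)"
  using assms by (simp add: sem_scale)

lemma sem_zero_value:
  assumes "finite S" "\<xi> \<in> inputs X S"
  shows "sem S k (OZero S k) \<xi> = (\<lambda>c I x. 0)"
  using sem_zero[of "OZero S k" S k] assms by (simp add: typed_iff)

lemma sem_comp_value:
  assumes "typed bv_pres t S k" "typed bv_pres s U l" "a \<in> S" "(S - {a}) \<inter> U = {}"
    and "(S - {a}) \<union> U = T" "m = k + l" "\<xi> \<in> inputs X T"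
  shows "sem T m (OComp t a s) \<xi> = (\<lambda>c I x. koszul (insert_order a U) T \<xi> * ksgn (l * total_deg {s \<in> S. s < a} \<xi>) *
     sem S k t (graft S a U l (sem U l s) \<xi>) c I x)"
  using sem_comp[OF assms(1-4)] assms(5-7) by (simp add: endo_operad_def graft_def)

lemma sem_graft:
  assumes "typed bv_pres s U l" "(S - {a}) \<union> U = T" "\<xi> \<in> inputs X T"
  shows "graft S a U l (sem U l s) \<xi> \<in> inputs X S" "restrict \<xi> U \<in> inputs X U"
  using graft_inputs[OF sem_endo_spc[OF assms(1)]] assms(2,3) by blast+

text \<open>
Generators are fixed by relabelling, and an order-preserving relabelling produces no Koszul sign.
So a generator acts in the same way for every label set.
\<close>

lemma sem_relabel_value:
  assumes "typed bv_pres (OGen g S) S k" "inj_on f S" "f ` S = T" "\<xi> \<in> inputs X T"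
    and mono: "\<And>u v. u \<in> S \<Longrightarrow> v \<in> S \<Longrightarrow> f u < f v \<Longrightarrow> u \<le> v"
  shows "sem T k (OGen g T) \<xi> = sem S k (OGen g S) (\<lambda>s\<in>S. \<xi> (f s))"
proof -
  have e: "sem T k (OGen g T) = orelabel (endo_operad X) f S k (sem S k (OGen g S))"
    using sem_cong[OF opeq.relabel_gen[OF assms(1,2)]] sem_relabel[OF assms(1,2)] assms(3) by simp
  have "sem T k (OGen g T) \<xi> = (\<lambda>c I x. koszul (\<lambda>v w. inv_into S f v < inv_into S f w) (f ` S) \<xi> * sem S k (OGen g S) (\<lambda>s\<in>S. \<xi> (f s)) c I x)"
    unfolding e using assms(3,4) by (simp add: endo_operad_def)
  also have "koszul (\<lambda>v w. inv_into S f v < inv_into S f w) (f ` S) \<xi> = 1"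
    using mono assms(2) by (intro koszul_one) (fastforce simp: not_less)
  finally show ?thesis by (simp only: mult_1)
qed

lemma sem_mu_value:
  assumes "a < b" "\<xi> \<in> inputs X {a, b}"
  shows "sem {a, b} 0 (OGen Mu {a, b}) \<xi> = wedge (snd (\<xi> a)) (snd (\<xi> b))"
proof -
  let ?f = "\<lambda>i::nat. if i = 0 then a else b"
  have "sem {a, b} 0 (OGen Mu {a, b}) \<xi> = sem {0, 1} 0 (OGen Mu {0, 1}) (\<lambda>s\<in>{0, 1}. \<xi> (?f s))"
    by (rule sem_relabel_value[where f = ?f]) (use assms in \<open>auto simp: typed_bv typed_iff inj_on_def\<close>)
  also have "(\<lambda>s\<in>{0, 1}. \<xi> (?f s)) \<in> inputs X {0, 1}"
    using assms by (auto simp: inputs_iff)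
  then have "sem {0, 1} 0 (OGen Mu {0, 1}) (\<lambda>s\<in>{0, 1}. \<xi> (?f s)) = wedge (snd (\<xi> a)) (snd (\<xi> b))"
    unfolding mu binary_op_def by simp
  finally show ?thesis .
qed

lemma sem_phi_value:
  assumes "\<xi> \<in> inputs X {a}"
  shows "sem {a} (- 2) (OGen (Phi 1) {a}) \<xi> = interior n \<pi> (snd (\<xi> a))"
proof -
  have "sem {a} (- 2) (OGen (Phi 1) {a}) \<xi> = sem {0} (- 2) (OGen (Phi 1) {0}) (\<lambda>s\<in>{0}. \<xi> a)"
    using sem_relabel_value[where f = "\<lambda>_. a" and S = "{0}" and g = "Phi 1" and k = "- 2" and T = "{a}"] assms
    by (simp add: typed_bv typed_iff)
  also have "(\<lambda>s\<in>{0}. \<xi> a) \<in> inputs X {0}"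
    using assms by (auto simp: inputs_iff)
  then have "sem {0} (- 2) (OGen (Phi 1) {0}) (\<lambda>s\<in>{0}. \<xi> a) = interior n \<pi> (snd (\<xi> a))"
    unfolding phi_1 unary_op_def by simp
  finally show ?thesis .
qed

lemma sem_triple_value:
  assumes "i < j" "j < 3" "l < 3" "{l, i, j} = {0, 1, 2}" "l \<notin> {i, j}" "\<xi> \<in> inputs X {0, 1, 2}"
  shows "sem {0, 1, 2} 0 (bv_triple i j l) \<xi> =
    (\<lambda>c I x. koszul (insert_order 3 {i, j}) {0, 1, 2} \<xi> * wedge (snd (\<xi> l)) (wedge (snd (\<xi> i)) (snd (\<xi> j))) c I x)"
proof -
  have t: "typed bv_pres (OGen Mu {3, l}) {3, l} 0" "typed bv_pres (OGen Mu {i, j}) {i, j} 0"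
    using assms(1-3) by (auto simp: typed_bv typed_iff)
  have T: "({3, l} - {3}) \<union> {i, j} = {0, 1, 2}" using assms(3) unfolding assms(4)[symmetric] by auto
  note g = sem_graft[OF t(2) T assms(6)]
  have "sem {0, 1, 2} 0 (bv_triple i j l) \<xi> =
    (\<lambda>c I x. koszul (insert_order 3 {i, j}) {0, 1, 2} \<xi> * ksgn (0 * total_deg {s \<in> {3, l}. s < 3} \<xi>) *
      sem {3, l} 0 (OGen Mu {3, l}) (graft {3, l} 3 {i, j} 0 (sem {i, j} 0 (OGen Mu {i, j})) \<xi>) c I x)"
    unfolding bv_triple_def
    by (rule sem_comp_value[OF t _ _ T]) (use assms(5,6) in auto)
  also have "sem {3, l} 0 (OGen Mu {3, l}) (graft {3, l} 3 {i, j} 0 (sem {i, j} 0 (OGen Mu {i, j})) \<xi>)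
    = wedge (snd (\<xi> l)) (wedge (snd (\<xi> i)) (snd (\<xi> j)))"
    using sem_mu_value[OF assms(3), of "graft {3, l} 3 {i, j} 0 (sem {i, j} 0 (OGen Mu {i, j})) \<xi>"]
      sem_mu_value[OF assms(1) g(2)] g(1) assms(3)
    by (simp add: insert_commute[of 3 l] graft_def)
  finally show ?thesis by (simp add: ksgn_01)
qed

lemma sem_inner_value:
  assumes "i < j" "j < 3" "l < 3" "{l, i, j} = {0, 1, 2}" "l \<notin> {i, j}" "\<xi> \<in> inputs X {0, 1, 2}"
  shows "sem {0, 1, 2} (- 2) (bv_inner (Phi 1) i j l) \<xi> =
    (\<lambda>c I x. koszul (insert_order 3 {i, j}) {0, 1, 2} \<xi> *
      wedge (snd (\<xi> l)) (interior n \<pi> (wedge (snd (\<xi> i)) (snd (\<xi> j)))) c I x)"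
proof -
  let ?s = "OComp (OGen (Phi 1) {4}) 4 (OGen Mu {i, j})"
  have t: "typed bv_pres (OGen Mu {3, l}) {3, l} 0" "typed bv_pres (OGen Mu {i, j}) {i, j} 0"
     "typed bv_pres (OGen (Phi 1) {4}) {4} (- 2)" "typed bv_pres ?s {i, j} (- 2)"
    using assms(1-3) by (auto simp: typed_bv typed_iff)
  have T: "({3, l} - {3}) \<union> {i, j} = {0, 1, 2}" using assms(3) unfolding assms(4)[symmetric] by auto
  note g = sem_graft[OF t(4) T assms(6)]
  have s: "sem {i, j} (- 2) ?s \<zeta> = interior n \<pi> (wedge (snd (\<zeta> i)) (snd (\<zeta> j)))" if "\<zeta> \<in> inputs X {i, j}" for \<zeta>
  proof -
    have U: "({4} - {4}) \<union> {i, j} = {i, j}" by simp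
    have "sem {i, j} (- 2) ?s \<zeta> = (\<lambda>c I x. koszul (insert_order 4 {i, j}) {i, j} \<zeta> * ksgn (0 * total_deg {s \<in> {4}. s < 4} \<zeta>) *
      sem {4} (- 2) (OGen (Phi 1) {4}) (graft {4} 4 {i, j} 0 (sem {i, j} 0 (OGen Mu {i, j})) \<zeta>) c I x)"
      by (rule sem_comp_value[OF t(3,2) _ _ U]) (use that in auto)
    then show ?thesis
      using sem_phi_value[OF sem_graft(1)[OF t(2) U that]] sem_mu_value[OF assms(1) sem_graft(2)[OF t(2) U that]]
      by (simp add: ksgn_01 koszul_insert_order_trivial graft_def)
  qed
  have "sem {0, 1, 2} (- 2) (bv_inner (Phi 1) i j l) \<xi> =
    (\<lambda>c I x. koszul (insert_order 3 {i, j}) {0, 1, 2} \<xi> * ksgn (- 2 * total_deg {s \<in> {3, l}. s < 3} \<xi>) *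
      sem {3, l} 0 (OGen Mu {3, l}) (graft {3, l} 3 {i, j} (- 2) (sem {i, j} (- 2) ?s) \<xi>) c I x)"
    unfolding bv_inner_def
    by (rule sem_comp_value[OF t(1,4) _ _ T]) (use assms(5,6) in auto)
  also have "sem {3, l} 0 (OGen Mu {3, l}) (graft {3, l} 3 {i, j} (- 2) (sem {i, j} (- 2) ?s) \<xi>)
    = wedge (snd (\<xi> l)) (interior n \<pi> (wedge (snd (\<xi> i)) (snd (\<xi> j))))"
    using sem_mu_value[OF assms(3), of "graft {3, l} 3 {i, j} (- 2) (sem {i, j} (- 2) ?s) \<xi>"]
      s[OF g(2)] g(1) assms(3)
    by (simp add: insert_commute[of 3 l] graft_def)
  finally show ?thesis by (simp add: ksgn_def)
qed

text \<open>
The Koszul signs of the partial compositions are exactly those that arise when the factors in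
\<open>interior_order2\<close> are put into the order in which the composites produce them.
\<close>

lemma sem_order2:
  "sem {0, 1, 2} (- 2) (fst (bv_order2 (Phi 1) (- 2))) = sem {0, 1, 2} (- 2) (snd (bv_order2 (Phi 1) (- 2)))"
proof (rule endo_spc_eqI)
  let ?T = "{0, 1, 2} :: nat set"
  let ?t = "bv_triple 0 1 2"
  let ?i = "bv_inner (Phi 1)"
  let ?u = "\<lambda>i. OComp ?t i (OGen (Phi 1) {i})"
  have tt: "typed bv_pres ?t ?T 0" "typed bv_pres (?i 0 1 2) ?T (- 2)" "typed bv_pres (?i 0 2 1) ?T (- 2)"
     "typed bv_pres (?i 1 2 0) ?T (- 2)" "typed bv_pres (?u 0) ?T (- 2)" "typed bv_pres (?u 1) ?T (- 2)"
     "typed bv_pres (?u 2) ?T (- 2)" "typed bv_pres (OGen (Phi 1) {3}) {3} (- 2)"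
    by (auto simp: typed_bv typed_iff bv_triple_def bv_inner_def)
  have tphi: "typed bv_pres (OGen (Phi 1) {i}) {i} (- 2)" for i
    by (auto simp: typed_bv typed_iff)
  show "sem ?T (- 2) (fst (bv_order2 (Phi 1) (- 2))) \<in> endo_spc X ?T (- 2)"
    by (rule sem_endo_spc) (auto simp: typed_bv typed_iff bv_order2_def bv_triple_def)
  show "sem ?T (- 2) (snd (bv_order2 (Phi 1) (- 2))) \<in> endo_spc X ?T (- 2)"
    by (rule sem_endo_spc) (use tt in \<open>auto simp: bv_order2_def intro!: typed.intros\<close>)
  fix \<xi> assume \<xi>: "\<xi> \<in> inputs X ?T"
  define p where "p i = fst (\<xi> i)" for i
  define w where "w i = snd (\<xi> i)" for i
  have deg: "form_degree (p i) (w i)" if "i \<in> ?T" for i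
    using \<xi> that unfolding inputs_iff p_def w_def by (auto intro: form_degree_forms)
  let ?K = "ksgn (p 0 * p 2) * ksgn (p 1 * p 2)"
  have triple: "sem ?T 0 ?t \<zeta> = wedge (wedge (snd (\<zeta> 0)) (snd (\<zeta> 1))) (snd (\<zeta> 2))" if "\<zeta> \<in> inputs X ?T" for \<zeta>
  proof -
    have d: "form_degree (fst (\<zeta> i)) (snd (\<zeta> i))" if "i \<in> ?T" for i
      using \<open>\<zeta> \<in> inputs X ?T\<close> that unfolding inputs_iff by (auto intro: form_degree_forms)
    show ?thesis
      using sem_triple_value[of 0 1 2 \<zeta>] that
        wedge_comm[OF form_degree_wedge[OF d[of 0] d[of 1]] d[of 2]]
      by (simp add: koszul_insert_order_012[unfolded One_nat_def] ksgn_add algebra_simps fun_eq_iff insert_commute)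
  qed
  have lhs: "sem ?T (- 2) (fst (bv_order2 (Phi 1) (- 2))) \<xi> = interior n \<pi> (wedge (wedge (w 0) (w 1)) (w 2))"
  proof -
    have U: "({3} - {3}) \<union> ?T = ?T" by simp
    have "sem ?T (- 2) (OComp (OGen (Phi 1) {3}) 3 ?t) \<xi> = (\<lambda>c I x. koszul (insert_order 3 ?T) ?T \<xi> * ksgn (0 * total_deg {s \<in> {3}. s < 3} \<xi>) *
      sem {3} (- 2) (OGen (Phi 1) {3}) (graft {3} 3 ?T 0 (sem ?T 0 ?t) \<xi>) c I x)"
      by (rule sem_comp_value[OF tt(8,1) _ _ U]) (use \<xi> in auto)
    then show ?thesis
      using sem_phi_value[OF sem_graft(1)[OF tt(1) U \<xi>]] triple[OF sem_graft(2)[OF tt(1) U \<xi>]]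
      by (simp add: bv_order2_def ksgn_01 koszul_insert_order_trivial graft_def w_def)
  qed
  have u: "sem ?T (- 2) (?u i) \<xi> = sem ?T 0 ?t (graft ?T i {i} (- 2) (sem {i} (- 2) (OGen (Phi 1) {i})) \<xi>)"
    if "i \<in> ?T" for i
  proof -
    have U: "(?T - {i}) \<union> {i} = ?T" using that by auto
    have "sem ?T (- 2) (?u i) \<xi> = (\<lambda>c I x. koszul (insert_order i {i}) ?T \<xi> * ksgn (- 2 * total_deg {s \<in> ?T. s < i} \<xi>) *
      sem ?T 0 ?t (graft ?T i {i} (- 2) (sem {i} (- 2) (OGen (Phi 1) {i})) \<xi>) c I x)"
      by (rule sem_comp_value[OF tt(1) tphi _ _ U]) (use \<xi> that in auto)
    then show ?thesis by (simp add: koszul_insert_order_trivial ksgn_def)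
  qed
  have u': "snd (graft ?T i {i} (- 2) (sem {i} (- 2) (OGen (Phi 1) {i})) \<xi> j) = (if j = i then interior n \<pi> (w i) else w j)"
    "graft ?T i {i} (- 2) (sem {i} (- 2) (OGen (Phi 1) {i})) \<xi> \<in> inputs X ?T"
    if "i \<in> ?T" "j \<in> ?T" for i j
  proof -
    have U: "(?T - {i}) \<union> {i} = ?T" using that by auto
    show "snd (graft ?T i {i} (- 2) (sem {i} (- 2) (OGen (Phi 1) {i})) \<xi> j) = (if j = i then interior n \<pi> (w i) else w j)"
      using that sem_phi_value[OF sem_graft(2)[OF tphi[of i] U \<xi>]] by (auto simp: graft_def w_def)
    show "graft ?T i {i} (- 2) (sem {i} (- 2) (OGen (Phi 1) {i})) \<xi> \<in> inputs X ?T"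
      by (rule sem_graft(1)[OF tphi[of i] U \<xi>])
  qed
  have i2: "sem ?T (- 2) (?i 0 1 2) \<xi> = wedge (interior n \<pi> (wedge (w 0) (w 1))) (w 2)"
  proof -
    have "form_degree (p 0 + p 1 - 2) (interior n \<pi> (wedge (w 0) (w 1)))"
      using deg by (intro form_degree_interior form_degree_wedge) auto
    then have *: "wedge (interior n \<pi> (wedge (w 0) (w 1))) (w 2) c I x
       = ?K * wedge (w 2) (interior n \<pi> (wedge (w 0) (w 1))) c I x" for c I x
      using wedge_comm[of "p 0 + p 1 - 2" _ "p 2" "w 2" c I x] deg[of 2] by (simp add: ksgn_add ksgn_diff ksgn_01 algebra_simps)
    show ?thesis
      using sem_inner_value[of 0 1 2 \<xi>] \<xi>
      by (simp add: *[unfolded One_nat_def] koszul_insert_order_012[unfolded One_nat_def] insert_commute fun_eq_iff p_def[symmetric] w_def[symmetric])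
  qed
  have i1: "sem ?T (- 2) (?i 0 2 1) \<xi> = (\<lambda>c I x. ksgn (p 1 * p 2) * wedge (interior n \<pi> (wedge (w 0) (w 2))) (w 1) c I x)"
  proof -
    have "form_degree (p 0 + p 2 - 2) (interior n \<pi> (wedge (w 0) (w 2)))"
      using deg by (intro form_degree_interior form_degree_wedge) auto
    then have *: "ksgn (p 1 * p 2) * wedge (interior n \<pi> (wedge (w 0) (w 2))) (w 1) c I x
       = ksgn (p 0 * p 1) * wedge (w 1) (interior n \<pi> (wedge (w 0) (w 2))) c I x" for c I x
      using wedge_comm[of "p 0 + p 2 - 2" _ "p 1" "w 1" c I x] deg[of 1]
      by (simp add: ksgn_add ksgn_diff ksgn_01 ksgn_mult_self' algebra_simps)
    show ?thesis
      using sem_inner_value[of 0 2 1 \<xi>] \<xi>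
      by (simp add: *[unfolded One_nat_def] koszul_insert_order_012[unfolded One_nat_def] insert_commute fun_eq_iff p_def[symmetric] w_def[symmetric])
  qed
  have i0: "sem ?T (- 2) (?i 1 2 0) \<xi> = (\<lambda>c I x. ksgn (p 0 * (p 1 + p 2)) * wedge (interior n \<pi> (wedge (w 1) (w 2))) (w 0) c I x)"
  proof -
    have "form_degree (p 1 + p 2 - 2) (interior n \<pi> (wedge (w 1) (w 2)))"
      using deg by (intro form_degree_interior form_degree_wedge) auto
    then have *: "ksgn (p 0 * (p 1 + p 2)) * wedge (interior n \<pi> (wedge (w 1) (w 2))) (w 0) c I x
       = wedge (w 0) (interior n \<pi> (wedge (w 1) (w 2))) c I x" for c I x
      using wedge_comm[of "p 1 + p 2 - 2" _ "p 0" "w 0" c I x] deg[of 0]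
      by (simp add: ksgn_add ksgn_diff ksgn_01 ksgn_mult_self ksgn_mult_self' ksgn_mult_2 algebra_simps)
    show ?thesis
      using sem_inner_value[of 1 2 0 \<xi>] \<xi>
      by (simp add: *[unfolded One_nat_def] koszul_insert_order_012[unfolded One_nat_def] insert_commute fun_eq_iff p_def[symmetric] w_def[symmetric])
  qed
  have u0: "sem ?T (- 2) (?u 0) \<xi> = wedge (wedge (interior n \<pi> (w 0)) (w 1)) (w 2)"
    using u[of 0] triple[OF u'(2)[of 0 0]] u'(1)[of 0] by simp
  have u1: "sem ?T (- 2) (?u 1) \<xi> = wedge (wedge (w 0) (interior n \<pi> (w 1))) (w 2)"
    using u[of 1] triple[OF u'(2)[of 1 0]] u'(1)[of 1] by simp
  have u2: "sem ?T (- 2) (?u 2) \<xi> = wedge (wedge (w 0) (w 1)) (interior n \<pi> (w 2))"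
    using u[of 2] triple[OF u'(2)[of 2 0]] u'(1)[of 2] by simp
  have rhs: "sem ?T (- 2) (snd (bv_order2 (Phi 1) (- 2))) \<xi> c I x =
     sem ?T (- 2) (?i 0 1 2) \<xi> c I x + sem ?T (- 2) (?i 0 2 1) \<xi> c I x + sem ?T (- 2) (?i 1 2 0) \<xi> c I x
     - (sem ?T (- 2) (?u 0) \<xi> c I x + sem ?T (- 2) (?u 1) \<xi> c I x + sem ?T (- 2) (?u 2) \<xi> c I x)" for c I x
  proof -
    let ?I = "OAdd (OAdd (?i 0 1 2) (?i 0 2 1)) (?i 1 2 0)" and ?U = "OAdd (OAdd (?u 0) (?u 1)) (?u 2)"
    have ty: "typed bv_pres (OAdd (?i 0 1 2) (?i 0 2 1)) ?T (- 2)" "typed bv_pres ?I ?T (- 2)"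
      "typed bv_pres (OAdd (?u 0) (?u 1)) ?T (- 2)" "typed bv_pres ?U ?T (- 2)" "typed bv_pres (OScale (- 1) ?U) ?T (- 2)"
      using tt by (blast intro: typed.intros)+
    have "snd (bv_order2 (Phi 1) (- 2)) = OAdd ?I (OScale (- 1) ?U)" by (simp add: bv_order2_def)
    then show ?thesis
      by (simp only: sem_add_value[OF ty(2,5) \<xi>] sem_scale_value[OF ty(4) \<xi>] sem_add_value[OF ty(1) tt(4) \<xi>]
        sem_add_value[OF tt(2,3) \<xi>] sem_add_value[OF ty(3) tt(7) \<xi>] sem_add_value[OF tt(5,6) \<xi>] mult_minus1 add_uminus_conv_diff)
  qed
  show "sem ?T (- 2) (fst (bv_order2 (Phi 1) (- 2))) \<xi> = sem ?T (- 2) (snd (bv_order2 (Phi 1) (- 2))) \<xi>"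
    unfolding lhs fun_eq_iff rhs i0 i1 i2 u0 u1 u2
    using interior_order2[OF deg[of 0] deg[of 1] deg[of 2]] by simp
qed

end

section \<open>The representation on forms factors through the quotient\<close>

lemma enum_of_singleton: "enum_of {a} = [a]"
proof -
  have "set (enum_of {a}) = {a} \<and> distinct (enum_of {a})"
    unfolding enum_of_def by (rule someI[of _ "[a]"]) simp
  then show ?thesis
    by (metis distinct_card card.empty card_insert_disjoint empty_iff finite.emptyI length_0_conv length_Suc_conv list.set_intros(1) singletonD)
qed

lemma csum_zero:
  assumes "finite S" "\<And>s. s \<in> S \<Longrightarrow> F s = (\<lambda>c I x. 0)"
  shows "csum (de_rham n A) p F S = (\<lambda>c I x. 0)"
proof -
  have "set xs \<subseteq> S \<Longrightarrow> foldr (\<lambda>a. cadd (de_rham n A) (F a)) xs (czero (de_rham n A) p) = (\<lambda>c I x. 0)" for xs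
    by (induction xs) (auto simp: assms(2))
  then show ?thesis unfolding csum_def using set_enum_of[OF assms(1)] by simp
qed

context bv_forms
begin

text \<open>
For \<open>n = 2\<close> the defining relation reads \<open>d(\<phi>\<^sub>2) + [\<phi>\<^sub>1, d\<phi>\<^sub>1]/2 = 0\<close>. Since \<open>\<phi>\<^sub>2\<close> acts by 0 and
\<open>d\<phi>\<^sub>1 = -\<Delta>\<close>, the operators \<open>\<phi>\<^sub>1\<close> and \<open>\<Delta>\<close> commute on forms.
\<close>

lemma sem_phi_delta_commute:
  "sem {0} (- 3) (OComp (bv_phi 1) 0 bv_delta) = sem {0} (- 3) (OComp bv_delta 0 (bv_phi 1))"
proof (rule endo_spc_eqI)
  let ?S = "{0} :: nat set" and ?Z = "OZero {0} (- 3) :: bv_gen opterm"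
  let ?A = "OComp (bv_phi 1) 0 (ODiff (bv_phi 1))" and ?B = "OComp (ODiff (bv_phi 1)) 0 (bv_phi 1)"
  let ?P = "OComp (bv_phi 1) 0 bv_delta" and ?R = "OComp bv_delta 0 (bv_phi 1)"
  have ty: "typed bv_pres ?A ?S (- 3)" "typed bv_pres ?B ?S (- 3)" "typed bv_pres ?P ?S (- 3)" "typed bv_pres ?R ?S (- 3)"
    "typed bv_pres ?Z ?S (- 3)" "typed bv_pres (bv_phi 2) ?S (- 4)" "typed bv_pres (bv_phi 1) ?S (- 2)"
    "typed bv_pres bv_delta ?S (- 1)" "typed bv_pres (ODiff (bv_phi 1)) ?S (- 1)" "typed bv_pres (ODiff (bv_phi 2)) ?S (- 3)"
    by (auto simp: typed_bv typed_iff)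
  show "sem ?S (- 3) ?P \<in> endo_spc X ?S (- 3)" "sem ?S (- 3) ?R \<in> endo_spc X ?S (- 3)"
    by (rule sem_endo_spc ty)+
  have dphi: "opeq bv_pres (ODiff (bv_phi 1)) (OScale (- 1) bv_delta)"
    by (rule opeq.rel) (simp add: bv_pres_def)
  have A: "opeq bv_pres ?A (OScale (- 1) ?P)"
    by (rule opeq.trans[OF opeq.comp_cong[OF opeq.refl dphi ty(7,9)] opeq.comp_scale_right[OF ty(7,8)]])
      (use ty in auto)
  have B: "opeq bv_pres ?B (OScale (- 1) ?R)"
    by (rule opeq.trans[OF opeq.comp_cong[OF dphi opeq.refl ty(9,7)] opeq.comp_scale_left[OF ty(8,7)]])
      (use ty in auto)
  have lists: "{qs. length qs = 2 \<and> sum_list qs = 2 \<and> (\<forall>q\<in>set qs. 1 \<le> q)} = {[1, 1 :: nat]}"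
  proof (intro set_eqI iffI)
    fix qs :: "nat list" assume "qs \<in> {qs. length qs = 2 \<and> sum_list qs = 2 \<and> (\<forall>q\<in>set qs. 1 \<le> q)}"
    then show "qs \<in> {[1, 1]}" by (auto simp: length_Suc_conv numeral_2_eq_2)
  qed auto
  have "bv_phi_lhs 2 = OAdd (ODiff (bv_phi 2)) (OAdd (OScale (1 / 2) (OAdd (bv_nested [1, 1]) ?Z)) ?Z)"
    unfolding bv_phi_lhs_def osum_def using lists by (simp add: enum_of_singleton)
  also have "bv_nested [1, 1] = OAdd ?A (OScale (- 1) ?B)"
    by (simp add: obracket_def ksgn_01)
  finally have lhs: "bv_phi_lhs 2 = OAdd (ODiff (bv_phi 2)) (OAdd (OScale (1 / 2) (OAdd (OAdd ?A (OScale (- 1) ?B)) ?Z)) ?Z)" .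
  have "(bv_phi_lhs 2, OZero {0} (1 - 2 * int 2)) \<in> rels bv_pres"
    unfolding bv_pres_def presentation.select_convs by blast
  then have rel: "opeq bv_pres (bv_phi_lhs 2) ?Z"
    using opeq.rel by fastforce
  have ty': "typed bv_pres (OScale (- 1) ?B) ?S (- 3)" "typed bv_pres (OAdd ?A (OScale (- 1) ?B)) ?S (- 3)"
    "typed bv_pres (OAdd (OAdd ?A (OScale (- 1) ?B)) ?Z) ?S (- 3)"
    "typed bv_pres (OScale (1 / 2) (OAdd (OAdd ?A (OScale (- 1) ?B)) ?Z)) ?S (- 3)"
    "typed bv_pres (OAdd (OScale (1 / 2) (OAdd (OAdd ?A (OScale (- 1) ?B)) ?Z)) ?Z) ?S (- 3)"
    using ty by (blast intro: typed.intros)+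
  fix \<xi> assume \<xi>: "\<xi> \<in> inputs X ?S"
  have "sem ?S (- 4) (bv_phi 2) = sem ?S (- 4) (OZero ?S (- 4))"
  proof (rule endo_spc_eqI)
    show "sem ?S (- 4) (bv_phi 2) \<in> endo_spc X ?S (- 4)" "sem ?S (- 4) (OZero ?S (- 4)) \<in> endo_spc X ?S (- 4)"
      by (rule sem_endo_spc, simp add: typed_bv typed_iff)+
    show "sem ?S (- 4) (bv_phi 2) \<zeta> = sem ?S (- 4) (OZero ?S (- 4)) \<zeta>" if "\<zeta> \<in> inputs X ?S" for \<zeta>
      using phi_n[of 2] that by (simp add: sem_zero_value endo_cpx_def)
  qed
  then have "sem ?S (- 4 + 1) (ODiff (bv_phi 2)) = sem ?S (- 4 + 1) (ODiff (OZero ?S (- 4)))"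
    using sem_diff[OF ty(6)] sem_diff[of "OZero ?S (- 4)" ?S "- 4"] by (simp add: typed_bv typed_iff)
  also have "sem ?S (- 4 + 1) (ODiff (OZero ?S (- 4))) = sem ?S (- 4 + 1) (OZero ?S (- 4 + 1))"
  proof -
    have z: "typed bv_pres (OZero ?S (- 4)) ?S (- 4)" by (simp add: typed_bv typed_iff)
    have "opeq bv_pres (ODiff (OZero ?S (- 4))) (ODiff (OScale 0 (OZero ?S (- 4))))"
      by (rule opeq.diff_cong[OF opeq_scale_zero[OF z]])
    moreover have "opeq bv_pres (ODiff (OScale 0 (OZero ?S (- 4)))) (OScale 0 (ODiff (OZero ?S (- 4))))"
      by (rule opeq.diff_scale[OF z])
    moreover have "opeq bv_pres (OScale 0 (ODiff (OZero ?S (- 4)))) (OZero ?S (- 4 + 1))"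
      by (rule opeq.sym[OF opeq_scale_zero[OF typed.intros(8)[OF z]]])
    ultimately show ?thesis by (blast intro: sem_cong opeq.trans)
  qed
  finally have d2: "sem ?S (- 3) (ODiff (bv_phi 2)) \<xi> = (\<lambda>c I x. 0)"
    using sem_zero_value[OF _ \<xi>, of "- 3"] by simp
  have z: "sem ?S (- 3) ?Z \<xi> = (\<lambda>c I x. 0)" using sem_zero_value[OF _ \<xi>] by simp
  have f: "sem ?S (- 3) (bv_phi_lhs 2) \<xi> = (\<lambda>c I x. 0)"
    using sem_cong[OF rel] z by simp
  have e: "1 / 2 * (sem ?S (- 3) ?A \<xi> c I x + - 1 * sem ?S (- 3) ?B \<xi> c I x) = 0" for c I x
    using f[THEN fun_cong, THEN fun_cong, THEN fun_cong, of c I x]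
    unfolding lhs sem_add_value[OF ty(10) ty'(5) \<xi>] sem_add_value[OF ty'(4) ty(5) \<xi>] sem_scale_value[OF ty'(3) \<xi>]
      sem_add_value[OF ty'(2) ty(5) \<xi>] sem_add_value[OF ty(1) ty'(1) \<xi>] sem_scale_value[OF ty(2) \<xi>] d2 z
    by simp
  have "sem ?S (- 3) ?A \<xi> c I x = sem ?S (- 3) ?B \<xi> c I x" for c I x
    using e[of c I x] by simp
  then have "sem ?S (- 3) ?A \<xi> = sem ?S (- 3) ?B \<xi>" by (intro ext)
  then show "sem ?S (- 3) ?P \<xi> = sem ?S (- 3) ?R \<xi>"
    unfolding sem_cong[OF A] sem_cong[OF B] sem_scale_value[OF ty(3) \<xi>] sem_scale_value[OF ty(4) \<xi>]
    by (simp add: fun_eq_iff)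
qed

text \<open>
Among the relations of Q, those that are not among the defining relations of BV/Delta are the order 2 condition on
\<open>\<phi>\<^sub>1\<close>, the commutation of \<open>\<phi>\<^sub>1\<close> with \<open>\<Delta>\<close>, and the vanishing of the higher \<open>\<phi>\<^sub>n\<close>; all of them hold
on forms.
\<close>

theorem qeq_imp_sem_eq:
  assumes "qeq t s" "typed bv_pres t S k"
  shows "sem S k t = sem S k s"
proof (rule sem_congruence[OF bvq_sig_eq[symmetric] bvq_rels_wf _ assms(1)])
  show "typed bvq_pres t S k" using assms(2) by (simp add: typed_bv)
  fix t s assume r: "(t, s) \<in> rels bvq_pres"
  have *: "opeq bv_pres t s" if "(t, s) \<in> rels bv_pres" for t s
    using that by (rule opeq.rel)
  show "sem (tset t) (qdeg t) t = sem (tset t) (qdeg t) s"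
  proof (cases "(t, s) \<in> rels bv_pres")
    case True
    then show ?thesis by (intro sem_cong *)
  next
    case False
    then consider "(t, s) = bv_order2 (Phi 1) (- 2)"
      | "t = OComp (bv_phi 1) 0 bv_delta" "s = OComp bv_delta 0 (bv_phi 1)"
      | i where "2 \<le> i" "t = bv_phi i" "s = OZero {0} (- 2 * int i)"
      using r unfolding rels_bvq bv_pres_def presentation.select_convs by blast
    then show ?thesis
    proof cases
      case 1
      then have ts: "t = fst (bv_order2 (Phi 1) (- 2))" "s = snd (bv_order2 (Phi 1) (- 2))"
        by (metis fst_conv, metis snd_conv)
      have "tset t = {0, 1, 2}" "qdeg t = - 2"
        unfolding ts by (auto simp: bv_order2_def bv_triple_def)
      then show ?thesis using sem_order2 ts by simp
    next
      case 2
      then show ?thesis using sem_phi_delta_commute by simp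
    next
      case 3
      have "sem {0} (- 2 * int i) (bv_phi i) = sem {0} (- 2 * int i) (OZero {0} (- 2 * int i))"
      proof (rule endo_spc_eqI)
        show "sem {0} (- 2 * int i) (bv_phi i) \<in> endo_spc X {0} (- 2 * int i)"
          "sem {0} (- 2 * int i) (OZero {0} (- 2 * int i)) \<in> endo_spc X {0} (- 2 * int i)"
          by (rule sem_endo_spc, use 3 in \<open>simp add: typed_bv typed_iff\<close>)+
        show "sem {0} (- 2 * int i) (bv_phi i) \<zeta> = sem {0} (- 2 * int i) (OZero {0} (- 2 * int i)) \<zeta>"
          if "\<zeta> \<in> inputs X {0}" for \<zeta>
          using phi_n[OF 3(1)] that by (simp add: sem_zero_value endo_cpx_def)
      qed
      then show ?thesis using 3 by simp
    qed
  qed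
qed

theorem closed_imp_sem_exact:
  assumes "typed bv_pres t S k" "opeq bv_pres (ODiff t) (OZero S (k + 1))" "k \<noteq> 0"
  obtains G where "G \<in> endo_spc X S (k - 1)" "sem S k t = endo_dif X S (k - 1) G"
proof -
  obtain u where u: "typed bvq_pres u S (k - 1)" "qeq t (ODiff u)"
    using qeq_closed_imp_exact[OF assms(1)[unfolded typed_bv] opeq_bv_imp_qeq[OF assms(2)] assms(3)] by blast
  have "sem S k t = sem S (k - 1 + 1) (ODiff u)"
    using qeq_imp_sem_eq[OF u(2) assms(1)] by simp
  also have "\<dots> = endo_dif X S (k - 1) (sem S (k - 1) u)"
    using sem_diff[of u S "k - 1"] u(1) by (simp add: typed_bv)
  finally show thesis using that sem_endo_spc[of u S "k - 1"] u(1) by (simp add: typed_bv)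
qed

section \<open>Triviality in cohomology\<close>

text \<open>
That \<open>d\<close> preserves forms is contained in the existence of the representation: the unit of
BV/Delta is a cocycle, so the identity of \<open>\<Omega>(M)\<close> is one as well. The value of
\<open>d(id)\<close> at \<open>\<omega>\<close> is \<open>d\<omega>\<close> minus the extensional identity at \<open>d\<omega>\<close>, which is \<open>undefined\<close> if \<open>d\<omega>\<close> is not
a form. So \<open>d\<omega>\<close> is a form or the element \<open>undefined\<close>, and comparing \<open>\<omega>\<close> with \<open>2\<omega>\<close> excludes the second
case.
\<close>

lemma ext_deriv_forms:
  assumes M: "smooth_manifold n M A" and w: "\<omega> \<in> forms n A p"
  shows "ext_deriv n A \<omega> \<in> forms n A (p + 1)"
proof -
  have key: "ext_deriv n A \<omega> \<in> forms n A (p + 1) \<or> ext_deriv n A \<omega> = undefined" if "\<omega> \<in> forms n A p" for \<omega>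
  proof (rule ccontr)
    assume neg: "\<not> ?thesis"
    let ?\<xi> = "\<lambda>s\<in>{0::nat}. (p, \<omega>)" and ?T = "OUnit 0 :: bv_gen opterm"
    let ?\<eta> = "?\<xi>(0 := (p + 1, ext_deriv n A \<omega>))"
    have \<xi>: "?\<xi> \<in> inputs X {0}" using that by (auto simp: inputs_iff)
    have \<eta>: "?\<eta> \<notin> inputs X {0}" using neg by (auto simp: inputs_iff)
    have ty: "typed bv_pres ?T {0} 0" by (rule typed.intros)
    have q: "qeq (ODiff ?T) (OZero {0} 1)"
      by (intro qeq_iff_cls) (simp_all add: cls_diff_unit cls_zero)
    have "sem {0} (0 + 1) (ODiff ?T) = sem {0} (0 + 1) (OZero {0} 1)"
      by (rule qeq_imp_sem_eq[OF q]) (rule typed.intros(8)[OF ty])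
    moreover have "sem {0} (0 + 1) (ODiff ?T) = endo_dif X {0} 0 (ounit (endo_operad X) 0)"
      using sem_diff[OF ty] sem_unit by simp
    ultimately have "endo_dif X {0} 0 (ounit (endo_operad X) 0) ?\<xi> = (\<lambda>c I x. 0)"
      using sem_zero_value[OF _ \<xi>, of 1] by simp
    then have g: "(\<lambda>c I x. ext_deriv n A \<omega> c I x + - 1 * (1 * (undefined :: 'm form) c I x + 0)) = (\<lambda>c I x. 0)"
      using \<xi> \<eta> by (simp add: endo_dif_def endo_operad_def csum_def enum_of_singleton ksgn_01 total_deg_def)
    have "ext_deriv n A \<omega> c I x = (undefined :: 'm form) c I x" for c I x
      using g[THEN fun_cong, THEN fun_cong, THEN fun_cong, of c I x] by simp
    then have "ext_deriv n A \<omega> = undefined" by (intro ext)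
    then show False using neg by simp
  qed
  show ?thesis
  proof (rule ccontr)
    assume neg: "ext_deriv n A \<omega> \<notin> forms n A (p + 1)"
    let ?\<omega> = "\<lambda>c I x. 2 * \<omega> c I x + 0 * \<omega> c I x"
    have d2: "ext_deriv n A ?\<omega> = (\<lambda>c I x. 2 * ext_deriv n A \<omega> c I x + 0 * ext_deriv n A \<omega> c I x)"
      by (rule ext_deriv_lin[OF M w w])
    \<comment> \<open>If \<open>d\<omega>\<close> is not a form, then \<open>d(2\<omega>)\<close> is not one either, so both equal \<open>undefined\<close>;
      hence \<open>2 d\<omega> = d\<omega>\<close> and \<open>d\<omega> = 0\<close>.\<close>
    have "?\<omega> \<in> forms n A p" by (rule forms_lin[OF M w w])
    from key[OF this] show False
    proof
      assume 2: "ext_deriv n A ?\<omega> \<in> forms n A (p + 1)"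
      have "(\<lambda>c I x. 1 / 2 * ext_deriv n A ?\<omega> c I x + 0 * ext_deriv n A ?\<omega> c I x) \<in> forms n A (p + 1)"
        by (rule forms_lin[OF M 2 2])
      then show False using neg unfolding d2 by simp
    next
      assume "ext_deriv n A ?\<omega> = undefined"
      then have h: "ext_deriv n A ?\<omega> = ext_deriv n A \<omega>" using key[OF w] neg by simp
      have "ext_deriv n A \<omega> c I x = 0" for c I x
        using h[unfolded d2, THEN fun_cong, THEN fun_cong, THEN fun_cong, of c I x] by simp
      then have "ext_deriv n A \<omega> = (\<lambda>c I x. 0)" by (intro ext)
      then show False using neg forms_zero by metis
    qed
  qed
qed

text \<open>
On closed arguments only the first term of \<open>[d, G] = d G \<mp> G d\<close> survives.
\<close>

lemma endo_dif_on_closed: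
  assumes "G \<in> endo_spc X S k" "finite S" "\<xi> \<in> inputs X S"
    and "\<And>s. s \<in> S \<Longrightarrow> ext_deriv n A (snd (\<xi> s)) = (\<lambda>c I x. 0)"
  shows "endo_dif X S k G \<xi> = ext_deriv n A (G \<xi>)"
proof -
  let ?z = "(\<lambda>c I x. 0) :: 'm form"
  have G0: "G (\<xi>(s := (q, ?z))) = ?z" if "s \<in> S" for s q
  proof -
    have "\<forall>\<xi>\<in>inputs X S. \<forall>s\<in>S. \<forall>p. \<forall>x\<in>forms n A p. \<forall>r.
        G (\<xi>(s := (p, \<lambda>c I y. r * x c I y))) = (\<lambda>c I y. r * G (\<xi>(s := (p, x))) c I y)"
      using assms(1) unfolding endo_spc_def by simp
    from this[rule_format, OF assms(3) that forms_zero, of q 0]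
    have "G (\<xi>(s := (q, \<lambda>c I y. 0 * ?z c I y))) = (\<lambda>c I y. 0 * G (\<xi>(s := (q, ?z))) c I y)"
      by simp
    then show ?thesis by simp
  qed
  have "csum X (total_deg S \<xi> + k + 1) (\<lambda>s. cscl X (ksgn (total_deg {t \<in> S. t < s} \<xi>))
      (G (\<xi>(s := (fst (\<xi> s) + 1, cdif X (fst (\<xi> s)) (snd (\<xi> s))))))) S = ?z"
    by (rule csum_zero[OF assms(2)]) (simp add: assms(4) G0)
  then show ?thesis
    unfolding endo_dif_def restrict_apply'[OF assms(3)] by (simp only:) simp
qed

end

text \<open>
Adding an exact form only reparametrizes the set of exact forms.
\<close>

lemma coset_exact:
  assumes M: "smooth_manifold n M A" and g: "\<gamma> \<in> forms n A (p - 1)"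
  shows "coset (de_rham n A) p (ext_deriv n A \<gamma>) = null_class (de_rham n A) p"
proof -
  have "\<exists>\<zeta>\<in>forms n A (p - 1). (\<lambda>c I x. ext_deriv n A \<gamma> c I x + ext_deriv n A \<eta> c I x) = (\<lambda>c I x. 0 + ext_deriv n A \<zeta> c I x)"
    if "\<eta> \<in> forms n A (p - 1)" for \<eta>
    using ext_deriv_lin[OF M g that, of 1 1] forms_lin[OF M g that, of 1 1]
    by (intro bexI[of _ "\<lambda>c I x. 1 * \<gamma> c I x + 1 * \<eta> c I x"]) (simp_all add: fun_eq_iff)
  moreover have "\<exists>\<zeta>\<in>forms n A (p - 1). (\<lambda>c I x. 0 + ext_deriv n A \<eta> c I x) = (\<lambda>c I x. ext_deriv n A \<gamma> c I x + ext_deriv n A \<zeta> c I x)"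
    if "\<eta> \<in> forms n A (p - 1)" for \<eta>
    using ext_deriv_lin[OF M that g, of 1 "- 1"] forms_lin[OF M that g, of 1 "- 1"]
    by (intro bexI[of _ "\<lambda>c I x. 1 * \<eta> c I x + - 1 * \<gamma> c I x"]) (simp_all add: fun_eq_iff)
  ultimately show ?thesis
    unfolding null_class_def coset_def by (fastforce simp: set_eq_iff)
qed

lemma (in bv_forms) cohomology_rep:
  assumes M: "smooth_manifold n M A" and C: "C \<in> cohomology X p" and w: "\<omega> \<in> C"
  shows "\<omega> \<in> forms n A p" "ext_deriv n A \<omega> = (\<lambda>c I x. 0)"
proof -
  obtain \<zeta> \<eta> where z: "\<zeta> \<in> forms n A p" "ext_deriv n A \<zeta> = (\<lambda>c I x. 0)" and e: "\<eta> \<in> forms n A (p - 1)"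
    and w': "\<omega> = (\<lambda>c I x. \<zeta> c I x + ext_deriv n A \<eta> c I x)"
    using C w unfolding cohomology_def cocycles_def coset_def by auto
  have de: "ext_deriv n A \<eta> \<in> forms n A p" using ext_deriv_forms[OF M e] by simp
  have w1: "\<omega> = (\<lambda>c I x. 1 * \<zeta> c I x + 1 * ext_deriv n A \<eta> c I x)" using w' by simp
  show "\<omega> \<in> forms n A p" unfolding w1 by (rule forms_lin[OF M z(1) de])
  show "ext_deriv n A \<omega> = (\<lambda>c I x. 0)"
    unfolding w1 ext_deriv_lin[OF M z(1) de] z(2) ext_deriv_ext_deriv[OF M e] by simp
qed

lemma cohomology_nonempty: "C \<in> cohomology (de_rham n A) p \<Longrightarrow> C \<noteq> {}"
  using forms_zero[of n A "p - 1"] unfolding cohomology_def coset_def by auto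

text \<open>
Cocycles of nonzero degree act on forms by coboundaries, which take closed representatives
to exact forms.
\<close>

theorem (in bv_forms) induced_op_null:
  assumes M: "smooth_manifold n M A" and S: "finite S"
    and t: "typed bv_pres t S k" "opeq bv_pres (ODiff t) (OZero S (k + 1))" "k \<noteq> 0"
    and c: "\<And>s. s \<in> S \<Longrightarrow> c s \<in> cohomology X (p s)"
  shows "induced_op X S k (sem S k t) p c = null_class X ((\<Sum>s\<in>S. p s) + k)"
proof -
  obtain G where G: "G \<in> endo_spc X S (k - 1)" "sem S k t = endo_dif X S (k - 1) G"
    using closed_imp_sem_exact[OF t] .
  let ?m = "(\<Sum>s\<in>S. p s) + k" and ?I = "PiE S (\<lambda>s. {p s} \<times> c s)"
  have "coset X ?m (sem S k t \<xi>) = null_class X ?m" if \<xi>: "\<xi> \<in> ?I" for \<xi>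
  proof -
    have s: "fst (\<xi> s) = p s" "snd (\<xi> s) \<in> c s" if "s \<in> S" for s
      using \<xi> that by (auto dest!: PiE_mem)
    have inp: "\<xi> \<in> inputs X S"
      using \<xi> cohomology_rep(1)[OF M c s(2)] s(1) by (auto simp: inputs_iff PiE_def)
    have deg: "total_deg S \<xi> = (\<Sum>s\<in>S. p s)" unfolding total_deg_def by (intro sum.cong) (simp_all add: s)
    have "sem S k t \<xi> = ext_deriv n A (G \<xi>)"
      unfolding G(2) by (rule endo_dif_on_closed[OF G(1) S inp]) (rule cohomology_rep(2)[OF M c s(2)])
    moreover have "G \<xi> \<in> forms n A (?m - 1)"
      using endo_spc_value[OF G(1) inp] deg by (simp add: algebra_simps)
    ultimately show ?thesis using coset_exact[OF M] by simp
  qed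
  moreover have "?I \<noteq> {}" using cohomology_nonempty[OF c] by (simp add: PiE_eq_empty_iff)
  ultimately show ?thesis unfolding induced_op_def by auto
qed

theorem corollary1p5:
  fixes M :: "'m topology" and n :: nat and A :: "'m chart set" and \<pi> :: "'m bivector"
    and \<theta> :: "nat set \<Rightarrow> int \<Rightarrow> nat opterm set \<Rightarrow> bv_gen opterm set"
    and \<rho> :: "nat set \<Rightarrow> int \<Rightarrow> bv_gen opterm set \<Rightarrow> (nat \<Rightarrow> int \<times> 'm form) \<Rightarrow> 'm form"
  assumes "poisson_manifold n M A \<pi>"
    and "dg_operad_quasi_iso hycom bv_operad \<theta>"
    and "\<theta> {0, 1} 0 (hycom_m 2) = opclass bv_pres (OGen Mu {0, 1})"
    and "de_rham_bv_structure n A \<pi> \<rho>"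
  shows "\<forall>N > 2. \<forall>p c. (\<forall>i<N. c i \<in> cohomology (de_rham n A) (p i)) \<longrightarrow>
           cohomology_m (de_rham n A) (\<lambda>S k x. \<rho> S k (\<theta> S k x)) N p c =
             null_class (de_rham n A) ((\<Sum>i<N. p i) + 2 * (2 - int N))"
proof (intro allI impI)
  fix N :: nat and p :: "nat \<Rightarrow> int" and c :: "nat \<Rightarrow> 'm form set"
  assume N: "2 < N" and c: "\<forall>i<N. c i \<in> cohomology (de_rham n A) (p i)"
  have M: "smooth_manifold n M A" using assms(1) by (simp add: poisson_manifold_def)
  interpret \<theta>: operad_hom_on_presented hycom_pres bv_operad \<theta>
    using assms(2) by unfold_locales (simp add: dg_operad_quasi_iso_def hycom_def)
  note \<rho> = assms(4)[unfolded de_rham_bv_structure_def]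
  interpret \<rho>: operad_hom_on_presented bv_pres "endo_operad (de_rham n A)" \<rho>
    using \<rho> by unfold_locales (simp add: bv_operad_def)
  interpret \<rho>: bv_forms n A \<pi> \<rho>
    using \<rho> by unfold_locales (auto simp: \<rho>.sem_def)
  let ?S = "{..<N}" and ?k = "2 * (2 - int N)" and ?m = "OGen N {..<N} :: nat opterm"
  have m: "hycom_m N = opclass hycom_pres ?m" by (simp add: hycom_m_def)
  have ty: "typed hycom_pres ?m ?S ?k"
    using typed.intros(1)[of N hycom_pres ?S] N by (simp add: hycom_pres_def)
  have closed: "opeq hycom_pres (ODiff ?m) (OZero ?S (?k + 1))"
    by (rule opeq.rel) (use N in \<open>auto simp: hycom_pres_def\<close>)
  obtain t where t: "typed bv_pres t ?S ?k" "\<theta> ?S ?k (hycom_m N) = opclass bv_pres t"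
    using \<theta>.sem_spc[OF ty] unfolding \<theta>.sem_def m by (auto simp: bv_operad_def presented_operad_def)
  \<comment> \<open>The representative \<open>t\<close> of the image of \<open>m\<^sub>N\<close> is closed in BV/Delta, since \<open>\<theta>\<close> commutes
    with differentials and with multiplication by 0.\<close>
  have d: "opclass bv_pres (ODiff t) = \<theta>.sem ?S (?k + 1) (ODiff ?m)"
    unfolding \<theta>.sem_diff[OF ty] using presented_diff[OF t(1)] t(2) by (simp add: \<theta>.sem_def m bv_operad_def)
  also have "\<theta>.sem ?S (?k + 1) (ODiff ?m) = \<theta>.sem ?S (?k + 1) (OZero ?S (?k + 1))"
    by (rule \<theta>.sem_cong[OF closed])
  also have "\<dots> = cscl (cpx bv_operad ?S) 0 (\<theta>.sem ?S (?k + 1) (ODiff ?m))"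
    by (rule \<theta>.sem_zero[OF typed.intros(8)[OF ty]])
  also have "\<theta>.sem ?S (?k + 1) (ODiff ?m) = opclass bv_pres (ODiff t)" by (rule d[symmetric])
  finally have "opclass bv_pres (ODiff t) = opclass bv_pres (OScale 0 (ODiff t))"
    using presented_scale[OF typed.intros(8)[OF t(1)], of 0] by (simp add: bv_operad_def)
  then have "opeq bv_pres (ODiff t) (OScale 0 (ODiff t))"
    using opclass_refl[OF typed.intros(7)[OF typed.intros(8)[OF t(1)]]] by (auto simp: opclass_def)
  then have dt: "opeq bv_pres (ODiff t) (OZero ?S (?k + 1))"
    using opeq.trans opeq.sym[OF opeq_scale_zero[OF typed.intros(8)[OF t(1)]]] by blast
  have "induced_op (de_rham n A) ?S ?k (\<rho>.sem ?S ?k t) p c = null_class (de_rham n A) ((\<Sum>i<N. p i) + ?k)"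
    by (rule \<rho>.induced_op_null[OF M _ t(1) dt]) (use N c in auto)
  then show "cohomology_m (de_rham n A) (\<lambda>S k x. \<rho> S k (\<theta> S k x)) N p c =
             null_class (de_rham n A) ((\<Sum>i<N. p i) + ?k)"
    unfolding cohomology_m_def t(2) \<rho>.sem_def .
qed

end
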